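(* Under Assumption (A), with the chain started at an initial state as in (I), there exist an integer $N$ and constants $C_1,C_2,C_3>0$ and $0<\gamma<1$, none depending on $n$ or $k$, such that for all $n\ge N$ and all $k\ge1$, $$\|\mathcal L(X^{(k)})-\pi\|_{\mathrm{TV}}\le C_1\gamma^k+C_2\frac{k(1+k)}{n}+C_3\frac{k}{\sqrt n}.$$
   Context: Fix $V>0$, $a>0$, $b_0>0$. For each $n\ge2$ observed data $Y_1,\dots,Y_n\in\mathbb R$ are given; $\bar Y=\frac1n\sum_iY_i$, $\Delta=\Delta_n=\sum_{i=1}^n(Y_i-\bar Y)^2$. Model: $Y_i\mid\theta_i\sim\mathcal N(\theta_i,V)$, $\theta_i\mid\mu,A\sim\mathcal N(\mu,A)$ independently ($1\le i\le n$), flat prior on $\mu\in\mathbb R$, $A\sim\mathrm{IG}(a,b_0)$ (density $\propto A^{-a-1}e^{-b_0/A}$ on $(0,\infty)$). The posterior $\pi$ on $\mathcal X=(0,\infty)\times\mathbb R\times\mathbb R^n$, $x=(A,\mu,\theta_1,\dots,\theta_n)$, has density $\propto A^{-a-1}e^{-b_0/A}\prod_{i=1}^n A^{-1/2}e^{-(\theta_i-\mu)^2/(2A)}e^{-(Y_i-\theta_i)^2/(2V)}$. Write $\bar\theta=\frac1n\sum_i\theta_i$. The Gibbs sampler $X^{(k)}=(A^{(k)},\mu^{(k)},\theta^{(k)}_1,\dots,\theta^{(k)}_n)$ updates: $\mu^{(k+1)}\sim\mathcal N(\bar\theta^{(k)},A^{(k)}/n)$; then independently $\theta_i^{(k+1)}\sim\mathcal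 N\big(\frac{\mu^{(k+1)}V+Y_iA^{(k)}}{V+A^{(k)}},\frac{A^{(k)}V}{V+A^{(k)}}\big)$, $i=1,\dots,n$; then $A^{(k+1)}\sim\mathrm{IG}\big(a+\frac{n-1}2,\ b_0+\frac12\sum_i(\theta_i^{(k+1)}-\bar\theta^{(k+1)})^2\big)$. Assumption (A): there are $\delta>0$, $M<\infty$ and an integer $N_0$ with $\frac{\Delta_n}{n-1}\le M$ for all $n$ and $\frac{\Delta_n}{n-1}\ge V+\delta$ for all $n\ge N_0$. Initial state (I): $x^{(0)}=(A^{(0)},\mu^{(0)},\theta^{(0)}_1,\dots,\theta^{(0)}_n)$ with $\bar\theta^{(0)}=\bar Y$, $\mu^{(0)}$ arbitrary, and $A^{(0)}=\frac{\Delta}{n-1}-V$ if $\frac{\Delta}{n-1}>V$, $A^{(0)}=\frac{\Delta}{n-1}$ otherwise. $\|\cdot\|_{\mathrm{TV}}$ is total variation distance $\sup_B|\cdot(B)|$ and $\mathcal L(X^{(k)})$ the law of $X^{(k)}$. *)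

theory Defs
  imports "HOL-Probability.Probability"
begin

(* State x = (A, mu, theta) with theta :: nat => real, meaningful on {..<n} (extensional). *)

definition state_space :: "nat \<Rightarrow> (real \<times> real \<times> (nat \<Rightarrow> real)) measure" where
  "state_space n = lborel \<Otimes>\<^sub>M lborel \<Otimes>\<^sub>M PiM {..<n} (\<lambda>_. lborel)"

definition normal_meas :: "real \<Rightarrow> real \<Rightarrow> real measure" where
  "normal_meas m v = density lborel (\<lambda>x. ennreal (normal_density m (sqrt v) x))"

definition inv_gamma_meas :: "real \<Rightarrow> real \<Rightarrow> real measure" where
  "inv_gamma_meas \<alpha> \<beta> = density lborel (\<lambda>x. ennreal
      (if x > 0 then \<beta> powr \<alpha> / Gamma \<alpha> * x powr (-\<alpha> - 1) * exp (-\<beta> / x) else 0))"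

(* data: Y n i is the i-th observation (i < n) of the n-th data set *)
definition Ybar :: "(nat \<Rightarrow> nat \<Rightarrow> real) \<Rightarrow> nat \<Rightarrow> real" where
  "Ybar Y n = (\<Sum>i<n. Y n i) / real n"

definition Delta :: "(nat \<Rightarrow> nat \<Rightarrow> real) \<Rightarrow> nat \<Rightarrow> real" where
  "Delta Y n = (\<Sum>i<n. (Y n i - Ybar Y n)\<^sup>2)"

definition vmean :: "nat \<Rightarrow> (nat \<Rightarrow> real) \<Rightarrow> real" where
  "vmean n \<theta> = (\<Sum>i<n. \<theta> i) / real n"

definition gibbs_step :: "real \<Rightarrow> real \<Rightarrow> real \<Rightarrow> (nat \<Rightarrow> nat \<Rightarrow> real) \<Rightarrow> nat
    \<Rightarrow> real \<times> real \<times> (nat \<Rightarrow> real) \<Rightarrow> (real \<times> real \<times> (nat \<Rightarrow> real)) measure" where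
  "gibbs_step V a b0 Y n x =
     (let A = fst x; \<theta> = snd (snd x) in
      normal_meas (vmean n \<theta>) (A / real n) \<bind> (\<lambda>\<mu>'.
      PiM {..<n} (\<lambda>i. normal_meas ((\<mu>' * V + Y n i * A) / (V + A)) (A * V / (V + A))) \<bind> (\<lambda>\<theta>'.
      inv_gamma_meas (a + (real n - 1) / 2)
         (b0 + (1/2) * (\<Sum>i<n. (\<theta>' i - vmean n \<theta>')\<^sup>2)) \<bind> (\<lambda>A'.
      return (state_space n) (A', \<mu>', \<theta>')))))"

fun chain_law :: "real \<Rightarrow> real \<Rightarrow> real \<Rightarrow> (nat \<Rightarrow> nat \<Rightarrow> real) \<Rightarrow> nat
    \<Rightarrow> real \<times> real \<times> (nat \<Rightarrow> real) \<Rightarrow> nat \<Rightarrow> (real \<times> real \<times> (nat \<Rightarrow> real)) measure" where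
  "chain_law V a b0 Y n x0 0 = return (state_space n) x0"
| "chain_law V a b0 Y n x0 (Suc k) = chain_law V a b0 Y n x0 k \<bind> gibbs_step V a b0 Y n"

definition post_dens :: "real \<Rightarrow> real \<Rightarrow> real \<Rightarrow> (nat \<Rightarrow> nat \<Rightarrow> real) \<Rightarrow> nat
    \<Rightarrow> real \<times> real \<times> (nat \<Rightarrow> real) \<Rightarrow> real" where
  "post_dens V a b0 Y n x =
     (let A = fst x; \<mu> = fst (snd x); \<theta> = snd (snd x) in
      if A > 0 then A powr (-a - 1) * exp (-b0 / A) *
        (\<Prod>i<n. A powr (-1/2) * exp (-(\<theta> i - \<mu>)\<^sup>2 / (2 * A)) * exp (-(Y n i - \<theta> i)\<^sup>2 / (2 * V)))
      else 0)"

definition posterior :: "real \<Rightarrow> real \<Rightarrow> real \<Rightarrow> (nat \<Rightarrow> nat \<Rightarrow> real) \<Rightarrow> nat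
    \<Rightarrow> (real \<times> real \<times> (nat \<Rightarrow> real)) measure" where
  "posterior V a b0 Y n =
     (let Z = (\<integral>\<^sup>+ x. ennreal (post_dens V a b0 Y n x) \<partial>state_space n) in
      density (state_space n) (\<lambda>x. ennreal (post_dens V a b0 Y n x) / Z))"

definition tv_dist :: "'a measure \<Rightarrow> 'a measure \<Rightarrow> real" where
  "tv_dist P Q = (SUP B \<in> sets P. \<bar>measure P B - measure Q B\<bar>)"

definition init_state :: "real \<Rightarrow> (nat \<Rightarrow> nat \<Rightarrow> real) \<Rightarrow> nat \<Rightarrow> real \<times> real \<times> (nat \<Rightarrow> real) \<Rightarrow> bool" where
  "init_state V Y n x0 \<longleftrightarrow>
     snd (snd x0) \<in> extensional {..<n} \<and>
     vmean n (snd (snd x0)) = Ybar Y n \<and>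
     fst x0 = (if Delta Y n / (real n - 1) > V then Delta Y n / (real n - 1) - V
               else Delta Y n / (real n - 1))"

end

theory Submission
  imports Defs "HOL-Real_Asymp.Real_Asymp"
begin

text \<open>
  The pair of \<open>A\<close> and the mean of \<open>\<theta>\<close> is itself a Markov chain. Write \<open>D = \<Delta> / (n - 1)\<close> and \<open>\<alpha> = A / (V + A)\<close>. Up to
  fluctuations of order \<open>1 / sqrt n\<close> the update of \<open>A\<close> is \<open>A \<mapsto> \<alpha>\<^sup>2 D + V \<alpha>\<close>, whose fixed point is \<open>D - V\<close> with slope
  \<open>1 - (1 - V / D)\<^sup>2 < 1\<close>. Hence two chains driven by the same noise contract in expectation as long as both stay near this
  fixed point, and by Chebyshev's inequality they leave its neighbourhood with probability \<open>O(1 / n)\<close> per step. A Hellinger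
  bound turns a distance \<open>d\<close> before a step into a total variation distance \<open>O(d sqrt n)\<close> after it. Started from the
  posterior and from the given initial state the two chains have expected distance \<open>O(1 / sqrt n)\<close>, which gives
  the geometric term.

  The posterior of \<open>(A, \<mu>, \<theta>)\<close> is not invariant, because \<open>A\<close> is drawn with \<open>\<mu>\<close> integrated out while the old \<open>\<mu>\<close> is
  kept. Its \<open>(A, \<theta>)\<close>-marginal is, and a step depends on these coordinates only, so any number of steps from the
  posterior differs from it by the same error. Given \<open>\<theta>\<close>, the law of \<open>\<mu>\<close> depends on \<open>A\<close> only through its scale,
  and \<open>A\<close> has relative fluctuations \<open>1 / sqrt n\<close>; hence this error is \<open>O(1 / sqrt n)\<close>.
\<close>

subsection \<open>Kernels with densities and the Hellinger affinity\<close>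

text \<open>Every estimate is stated for test functions: \<open>T h x \<le> T h y + error\<close>
  for measurable \<open>h \<le> 1\<close>. Neither a coupled chain on a product space nor an optimal
  coupling is built; total variation appears only at the end, through indicators. The powers of n
  balance because smoothing, which costs a factor sqrt n, is used once, for the last step, while all
  earlier steps only contract. The factor is repaid by averaging over the posterior: its second
  moments about the starting point are of order 1/n, and sqrt n |t| <= 1/2 + n t^2 / 2 turns the
  expected distance into them. The obstacle is that contraction is only local, whereas the noise and
  the posterior have full support. What happens outside the good region is charged to second
  moments: of the noise at each step, of the posterior at the start. A weighted distance suffices
  because the recursion is triangular: the spread of theta about its own mean does not feel mu, so
  the next A does not feel the old mean of theta. Assumption (A) makes 1 - V/D at least delta/M, so
  the slope at the fixed point stays below 1 uniformly in n.\<close>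

lemma measurable_density_kernel:
  assumes [measurable]: "f \<in> borel_measurable (M \<Otimes>\<^sub>M N)" and N: "sigma_finite_measure N" and ne: "space N \<noteq> {}"
    and le: "\<And>x. x \<in> space M \<Longrightarrow> (\<integral>\<^sup>+ y. f (x, y) \<partial>N) \<le> 1"
  shows "(\<lambda>x. density N (\<lambda>y. f (x, y))) \<in> measurable M (subprob_algebra N)"
proof (rule measurable_subprob_algebra)
  interpret sigma_finite_measure N by fact
  fix x assume x[measurable]: "x \<in> space M"
  show "subprob_space (density N (\<lambda>y. f (x, y)))"
    by (rule subprob_spaceI) (use le[OF x] ne in \<open>auto simp: emeasure_density cong: nn_integral_cong\<close>)
next
  interpret sigma_finite_measure N by fact
  fix A assume [measurable]: "A \<in> sets N"
  have "(\<lambda>x. \<integral>\<^sup>+ y. f (x, y) * indicator A y \<partial>N) \<in> borel_measurable M" by measurable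
  then show "(\<lambda>x. emeasure (density N (\<lambda>y. f (x, y))) A) \<in> borel_measurable M"
    by (rule measurable_cong[THEN iffD1, rotated]) (simp add: emeasure_density)
qed simp

lemma PiM_density:
  fixes f :: "'i \<Rightarrow> 'a \<Rightarrow> real"
  assumes fin: "finite I" and M: "\<And>i. sigma_finite_measure (M i)"
    and [measurable]: "\<And>i. i \<in> I \<Longrightarrow> f i \<in> borel_measurable (M i)"
    and nn: "\<And>i x. 0 \<le> f i x"
  shows "PiM I (\<lambda>i. density (M i) (\<lambda>x. ennreal (f i x))) =
         density (PiM I M) (\<lambda>x. ennreal (\<Prod>i\<in>I. f i (x i)))"
proof -
  \<comment> \<open>Measurability of \<open>f i\<close> is known only for \<open>i \<in> I\<close>,
    but \<open>product_sigma_finite\<close> concerns every index; outside \<open>I\<close> the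
    factor falls back to \<open>M i\<close>.\<close>
  define D where "D = (\<lambda>i. if i \<in> I then density (M i) (\<lambda>x. ennreal (f i x)) else M i)"
  interpret P: product_sigma_finite M using M by (simp add: product_sigma_finite_def)
  have sD: "sigma_finite_measure (D i)" for i
    unfolding D_def using sigma_finite_measure.sigma_finite_iff_density_finite[OF M, of "\<lambda>x. ennreal (f i x)" i] M
    by auto
  interpret Q: product_sigma_finite D using sD by (simp add: product_sigma_finite_def)
  have sets_eq: "sets (PiM I D) = sets (PiM I M)" by (intro sets_PiM_cong) (auto simp: D_def)
  have "PiM I D = density (PiM I M) (\<lambda>x. ennreal (\<Prod>i\<in>I. f i (x i)))"
  proof (rule Q.PiM_eqI[symmetric, OF fin])
    show "sets (density (PiM I M) (\<lambda>x. ennreal (\<Prod>i\<in>I. f i (x i)))) = sets (PiM I D)"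
      using sets_eq by simp
    fix A assume A: "\<And>i. i \<in> I \<Longrightarrow> A i \<in> sets (D i)"
    then have A'[measurable]: "\<And>i. i \<in> I \<Longrightarrow> A i \<in> sets (M i)" by (auto simp: D_def)
    have [measurable]: "Pi\<^sub>E I A \<in> sets (PiM I M)" using A' fin by (intro sets_PiM_I_finite) auto
    have [measurable]: "(\<lambda>x. \<Prod>i\<in>I. f i (x i)) \<in> borel_measurable (PiM I M)" by measurable
    have "emeasure (density (PiM I M) (\<lambda>x. ennreal (\<Prod>i\<in>I. f i (x i)))) (Pi\<^sub>E I A) =
      (\<integral>\<^sup>+x. ennreal (\<Prod>i\<in>I. f i (x i)) * indicator (Pi\<^sub>E I A) x \<partial>PiM I M)"
      by (simp add: emeasure_density)
    also have "\<dots> = (\<integral>\<^sup>+x. (\<Prod>i\<in>I. ennreal (f i (x i)) * indicator (A i) (x i)) \<partial>PiM I M)"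
    proof (rule nn_integral_cong)
      fix x assume x: "x \<in> space (PiM I M)"
      then have "indicator (Pi\<^sub>E I A) x = (\<Prod>i\<in>I. indicator (A i) (x i) :: ennreal)"
        using fin by (auto simp: space_PiM PiE_iff indicator_def prod_zero_iff split: if_splits intro!: prod.neutral[symmetric])
      then show "ennreal (\<Prod>i\<in>I. f i (x i)) * indicator (Pi\<^sub>E I A) x =
         (\<Prod>i\<in>I. ennreal (f i (x i)) * indicator (A i) (x i))"
        by (simp add: prod.distrib prod_ennreal nn)
    qed
    also have "\<dots> = (\<Prod>i\<in>I. \<integral>\<^sup>+x. ennreal (f i x) * indicator (A i) x \<partial>M i)"
      by (rule P.product_nn_integral_prod[OF fin]) auto
    also have "\<dots> = (\<Prod>i\<in>I. emeasure (D i) (A i))"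
      by (rule prod.cong) (auto simp: D_def emeasure_density)
    finally show "emeasure (density (PiM I M) (\<lambda>x. ennreal (\<Prod>i\<in>I. f i (x i)))) (Pi\<^sub>E I A) = (\<Prod>i\<in>I. emeasure (D i) (A i))" .
  qed
  moreover have "PiM I (\<lambda>i. density (M i) (\<lambda>x. ennreal (f i x))) = PiM I D"
    by (rule PiM_cong) (auto simp: D_def)
  ultimately show ?thesis by simp
qed

text \<open>Cauchy-Schwarz for |f - g| = |sqrt f - sqrt g| (sqrt f + sqrt g), used in its weighted
  arithmetic-geometric form: for every s > 0 the integral is at most s \<open>\<kappa>\<close> + 2 /
  s. Optimizing s gives the square root.\<close>

lemma nn_integral_abs_diff_le_affinity:
  fixes f g :: "'a \<Rightarrow> real"
  assumes [measurable]: "f \<in> borel_measurable M" "g \<in> borel_measurable M"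
    and nn: "\<And>x. 0 \<le> f x" "\<And>x. 0 \<le> g x"
    and f1: "(\<integral>\<^sup>+x. ennreal (f x) \<partial>M) = 1" and g1: "(\<integral>\<^sup>+x. ennreal (g x) \<partial>M) = 1"
    and aff: "(\<integral>\<^sup>+x. ennreal (sqrt (f x * g x)) \<partial>M) \<ge> ennreal (1 - \<kappa>)" and k: "0 \<le> \<kappa>"
  shows "(\<integral>\<^sup>+x. ennreal \<bar>f x - g x\<bar> \<partial>M) \<le> ennreal (3 * sqrt \<kappa>)"
proof -
  have int: "integrable M f" "integrable M g"
    using f1 g1 by (auto intro!: integrableI_nonneg simp: nn)
  have int2: "integrable M (\<lambda>x. sqrt (f x * g x))"
  proof (rule Bochner_Integration.integrable_bound[OF Bochner_Integration.integrable_add[OF int]])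
    show "AE x in M. norm (sqrt (f x * g x)) \<le> norm (f x + g x)"
    proof (rule AE_I2)
      fix x
      show "norm (sqrt (f x * g x)) \<le> norm (f x + g x)"
      proof -
        have "\<bar>p\<bar> \<le> \<bar>a + b\<bar>" if "p \<le> (a + b) / 2" "0 \<le> a" "0 \<le> b" "0 \<le> p" for p a b :: real using that by simp
        from this[OF arith_geo_mean_sqrt[OF nn(1)[of x] nn(2)[of x]] nn real_sqrt_ge_zero[OF mult_nonneg_nonneg[OF nn]]]
        show ?thesis by simp
      qed
    qed
  qed measurable
  have If: "integral\<^sup>L M f = 1" "integral\<^sup>L M g = 1"
    using f1 g1 by (auto simp: integral_eq_nn_integral nn)
  have Ifg: "(\<integral>x. sqrt (f x * g x) \<partial>M) \<ge> 1 - \<kappa>"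
    using aff nn_integral_eq_integral[OF int2] nn k
    by (smt (verit) AE_I2 ennreal_le_iff integral_nonneg_AE mult_nonneg_nonneg real_sqrt_ge_zero ennreal_neg)
  have bound: "(\<integral>x. \<bar>f x - g x\<bar> \<partial>M) \<le> s * \<kappa> + 2 / s" if s: "s > 0" for s :: real
  proof -
    have "(\<integral>x. \<bar>f x - g x\<bar> \<partial>M) \<le> (\<integral>x. s/2 * (f x + g x - 2 * sqrt (f x * g x)) + 1/(2 * s) * (f x + g x + 2 * sqrt (f x * g x)) \<partial>M)"
    proof (rule integral_mono)
      fix x
      let ?p = "sqrt (f x)" and ?q = "sqrt (g x)"
      have e: "f x = ?p^2" "g x = ?q^2" "sqrt (f x * g x) = ?p * ?q" using nn by (auto simp: real_sqrt_mult)
      have pq: "0 \<le> ?p" "0 \<le> ?q" using nn by auto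
      have "f x - g x = (?p - ?q) * (?p + ?q)" by (simp add: algebra_simps nn)
      then have "\<bar>f x - g x\<bar> = \<bar>?p - ?q\<bar> * (?p + ?q)"
        using pq by (simp add: abs_mult)
      also have "\<dots> \<le> s/2 * (?p - ?q)^2 + 1/(2 * s) * (?p + ?q)^2"
      proof -
        have "0 \<le> (s * \<bar>?p - ?q\<bar> - (?p + ?q))^2 / (2 * s)" using s by simp
        also have "\<dots> = s/2 * (?p - ?q)^2 + 1/(2 * s) * (?p + ?q)^2 - \<bar>?p - ?q\<bar> * (?p + ?q)"
          using s by (simp add: power2_diff field_simps power_mult_distrib power2_eq_square)
        finally show ?thesis by simp
      qed
      also have "\<dots> = s/2 * (f x + g x - 2 * sqrt (f x * g x)) + 1/(2 * s) * (f x + g x + 2 * sqrt (f x * g x))"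
        unfolding e(3) by (subst (3) e(1), subst (3) e(2), subst (5) e(1), subst (5) e(2)) (simp add: power2_eq_square algebra_simps)
      finally show "\<bar>f x - g x\<bar> \<le> s/2 * (f x + g x - 2 * sqrt (f x * g x)) + 1/(2 * s) * (f x + g x + 2 * sqrt (f x * g x))" .
    qed (use int int2 in auto)
    also have "\<dots> = s/2 * (2 - 2 * (\<integral>x. sqrt (f x * g x) \<partial>M)) + 1/(2 * s) * (2 + 2 * (\<integral>x. sqrt (f x * g x) \<partial>M))"
      using int int2 If by simp
    also have "\<dots> \<le> s * \<kappa> + 2 / s"
    proof -
      have "(\<integral>x. sqrt (f x * g x) \<partial>M) \<le> (\<integral>x. (f x + g x) / 2 \<partial>M)"
        by (rule integral_mono[OF int2 _ arith_geo_mean_sqrt[OF nn]]) (use int in auto)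
      then have "(\<integral>x. sqrt (f x * g x) \<partial>M) \<le> 1" using int If by simp
      then have "1/(2 * s) * (2 + 2 * (\<integral>x. sqrt (f x * g x) \<partial>M)) \<le> 1/(2 * s) * 4" using s by (intro mult_left_mono) auto
      moreover have "s/2 * (2 - 2 * (\<integral>x. sqrt (f x * g x) \<partial>M)) \<le> s/2 * (2 * \<kappa>)" using s Ifg by (intro mult_left_mono) auto
      ultimately show ?thesis by simp
    qed
    finally show ?thesis .
  qed
  have "(\<integral>x. \<bar>f x - g x\<bar> \<partial>M) \<le> 3 * sqrt \<kappa>"
  \<comment> \<open>Without defect there is no optimal s; the bound follows by letting s
    grow.\<close>
  proof (cases "\<kappa> = 0")
    case True
    show ?thesis
    proof (rule field_le_epsilon)
      fix e :: real assume "e > 0"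
      then show "(\<integral>x. \<bar>f x - g x\<bar> \<partial>M) \<le> 3 * sqrt \<kappa> + e" using bound[of "2/e"] True by simp
    qed
  next
    case False
    then have kp: "\<kappa> > 0" using k by simp
    \<comment> \<open>The optimal s is sqrt 2 / sqrt \<open>\<kappa>\<close>. Replacing sqrt 2 by
      3/2 keeps the arithmetic rational and gives 3/2 + 4/3 = 17/6, still below 3.\<close>
    have "(3/2 / sqrt \<kappa>) * \<kappa> = 3/2 * sqrt \<kappa>" using kp by (simp add: field_simps)
    moreover have "2 / (3/2 / sqrt \<kappa>) = 4/3 * sqrt \<kappa>" by simp
    ultimately have "(\<integral>x. \<bar>f x - g x\<bar> \<partial>M) \<le> 3/2 * sqrt \<kappa> + 4/3 * sqrt \<kappa>" using bound[of "3/2 / sqrt \<kappa>"] kp by simp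
    also have "\<dots> \<le> 3 * sqrt \<kappa>" using k by simp
    finally show ?thesis .
  qed
  then show ?thesis
    using int by (subst nn_integral_eq_integral) (auto intro!: ennreal_leI)
qed

lemma nn_integral_le_add_abs_diff:
  fixes f g :: "'a \<Rightarrow> real"
  assumes [measurable]: "f \<in> borel_measurable M" "g \<in> borel_measurable M" "h \<in> borel_measurable M"
    and nn: "\<And>x. 0 \<le> f x" "\<And>x. 0 \<le> g x" and h: "\<And>x. x \<in> space M \<Longrightarrow> h x \<le> 1"
  shows "(\<integral>\<^sup>+x. ennreal (f x) * h x \<partial>M) \<le> (\<integral>\<^sup>+x. ennreal (g x) * h x \<partial>M) + (\<integral>\<^sup>+x. ennreal \<bar>f x - g x\<bar> \<partial>M)"
proof -
  have "(\<integral>\<^sup>+x. ennreal (f x) * h x \<partial>M) \<le> (\<integral>\<^sup>+x. ennreal (g x) * h x + ennreal \<bar>f x - g x\<bar> \<partial>M)"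
  proof (rule nn_integral_mono)
    fix x assume x: "x \<in> space M"
    have "ennreal (f x) * h x \<le> (ennreal (g x) + ennreal \<bar>f x - g x\<bar>) * h x"
      by (intro mult_right_mono) (auto simp: nn ennreal_plus[symmetric] simp del: ennreal_plus intro!: ennreal_leI)
    also have "\<dots> \<le> ennreal (g x) * h x + ennreal \<bar>f x - g x\<bar>"
      using h[OF x] mult_left_mono[OF h[OF x], of "ennreal \<bar>f x - g x\<bar>"] by (simp add: distrib_right)
    finally show "ennreal (f x) * h x \<le> ennreal (g x) * h x + ennreal \<bar>f x - g x\<bar>" .
  qed
  also have "\<dots> = (\<integral>\<^sup>+x. ennreal (g x) * h x \<partial>M) + (\<integral>\<^sup>+x. ennreal \<bar>f x - g x\<bar> \<partial>M)"
    by (rule nn_integral_add) auto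
  finally show ?thesis .
qed

text \<open>Affinities multiply over independent coordinates. This converts such a product into a
  sum of defects \<open>1 - r i\<close>, as a union bound would.\<close>

lemma prod_ge_one_minus_sum:
  fixes r :: "'i \<Rightarrow> real"
  assumes "finite I" "\<And>i. i \<in> I \<Longrightarrow> 0 \<le> r i \<and> r i \<le> 1"
  shows "1 - (\<Sum>i\<in>I. 1 - r i) \<le> (\<Prod>i\<in>I. r i)"
  using assms
proof (induction I rule: finite_induct)
  case (insert i I)
  have p: "0 \<le> prod r I" "prod r I \<le> 1" using insert by (auto intro!: prod_nonneg prod_le_1)
  have "0 \<le> (1 - r i) * (1 - prod r I)" using insert p by (intro mult_nonneg_nonneg) auto
  then show ?case using insert by (auto simp: algebra_simps)
qed simp

section \<open>Affinity of two normal densities\<close>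

lemma nn_integral_normal_density:
  assumes "\<sigma> > 0" shows "(\<integral>\<^sup>+x. ennreal (normal_density m \<sigma> x) \<partial>lborel) = 1"
  using assms by (subst nn_integral_eq_integral) auto

text \<open>By completing the square, the geometric mean of two normal densities is a multiple of a
  third normal density, and the multiple is the affinity.\<close>

lemma nn_integral_sqrt_normal_density:
  assumes s: "\<sigma> > 0" "\<tau> > 0"
  shows "(\<integral>\<^sup>+x. ennreal (sqrt (normal_density m \<sigma> x * normal_density k \<tau> x)) \<partial>lborel) =
     ennreal (sqrt (2 * \<sigma> * \<tau> / (\<sigma>\<^sup>2 + \<tau>\<^sup>2)) * exp (- (m - k)\<^sup>2 / (4 * (\<sigma>\<^sup>2 + \<tau>\<^sup>2))))"
proof -
  define w where "w = \<sigma>\<^sup>2 + \<tau>\<^sup>2"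
  have w: "w > 0" using s by (simp add: w_def add_pos_pos)
  \<comment> \<open>The variance of the third density is the harmonic mean of the two variances;
    \<open>l\<close> is the precision-weighted mean.\<close>
  define r where "r = sqrt (2 * \<sigma>\<^sup>2 * \<tau>\<^sup>2 / w)"
  define l where "l = (m * \<tau>\<^sup>2 + k * \<sigma>\<^sup>2) / w"
  have r: "r > 0" "r^2 = 2 * \<sigma>\<^sup>2 * \<tau>\<^sup>2 / w" using s w by (auto simp: r_def)
  let ?c = "sqrt (2 * \<sigma> * \<tau> / w) * exp (- (m - k)\<^sup>2 / (4 * w))"
  have "sqrt (normal_density m \<sigma> x * normal_density k \<tau> x) = ?c * normal_density l r x" for x
  proof -
    have ex: "-(x - m)\<^sup>2 / (2 * \<sigma>\<^sup>2) + -(x - k)\<^sup>2 / (2 * \<tau>\<^sup>2) = 2 * (- (m - k)\<^sup>2 / (4 * w) + -(x - l)\<^sup>2 / (2 * r\<^sup>2))"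
    proof -
      have "(x - m)\<^sup>2 / \<sigma>\<^sup>2 + (x - k)\<^sup>2 / \<tau>\<^sup>2 = ((x - m)\<^sup>2 * \<tau>\<^sup>2 + (x - k)\<^sup>2 * \<sigma>\<^sup>2) / (\<sigma>\<^sup>2 * \<tau>\<^sup>2)"
        using s by (simp add: field_simps)
      moreover have "(m - k)\<^sup>2 / w + (x - l)\<^sup>2 * w / (\<sigma>\<^sup>2 * \<tau>\<^sup>2) = ((m-k)\<^sup>2 * (\<sigma>\<^sup>2 * \<tau>\<^sup>2) + (w * x - w * l)\<^sup>2) / (w * (\<sigma>\<^sup>2 * \<tau>\<^sup>2))"
        using s w by (simp add: field_simps power2_eq_square)
      moreover have "w * l = m * \<tau>\<^sup>2 + k * \<sigma>\<^sup>2" using w by (simp add: l_def)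
      moreover have "(m-k)\<^sup>2 * (\<sigma>\<^sup>2 * \<tau>\<^sup>2) + (w * x - (m * \<tau>\<^sup>2 + k * \<sigma>\<^sup>2))\<^sup>2 = w * ((x - m)\<^sup>2 * \<tau>\<^sup>2 + (x - k)\<^sup>2 * \<sigma>\<^sup>2)"
        unfolding w_def by (simp add: power2_eq_square algebra_simps)
      ultimately have "(x - m)\<^sup>2 / \<sigma>\<^sup>2 + (x - k)\<^sup>2 / \<tau>\<^sup>2 = (m - k)\<^sup>2 / w + (x - l)\<^sup>2 * w / (\<sigma>\<^sup>2 * \<tau>\<^sup>2)"
        using w s by (simp add: mult.assoc)
      then show ?thesis unfolding r(2) using s w by (simp add: field_simps)
    qed
    have "sqrt (normal_density m \<sigma> x * normal_density k \<tau> x) =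
       sqrt (1 / (2 * pi * \<sigma> * \<tau>)) * sqrt (exp (-(x - m)\<^sup>2 / (2 * \<sigma>\<^sup>2) + -(x - k)\<^sup>2 / (2 * \<tau>\<^sup>2)))"
    proof -
      have q: "sqrt (2 * pi * z\<^sup>2) = sqrt (2 * pi) * z" if "z > 0" for z :: real using that by (simp add: real_sqrt_mult)
      have "normal_density m \<sigma> x * normal_density k \<tau> x = 1 / ((sqrt (2 * pi) * sqrt (2 * pi)) * \<sigma> * \<tau>) * exp (-(x - m)\<^sup>2 / (2 * \<sigma>\<^sup>2) + -(x - k)\<^sup>2 / (2 * \<tau>\<^sup>2))"
        unfolding exp_add normal_density_def q[OF s(1)] q[OF s(2)] by (simp del: real_sqrt_mult)
      also have "sqrt (2 * pi) * sqrt (2 * pi) = 2 * pi" by simp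
      finally show ?thesis by (simp only: real_sqrt_mult)
    qed
    also have "sqrt (exp (-(x - m)\<^sup>2 / (2 * \<sigma>\<^sup>2) + -(x - k)\<^sup>2 / (2 * \<tau>\<^sup>2))) = exp (- (m - k)\<^sup>2 / (4 * w)) * exp (-(x - l)\<^sup>2 / (2 * r\<^sup>2))"
    proof -
      have h: "sqrt (exp (2 * z)) = exp z" for z :: real by (simp add: exp_double)
      show ?thesis unfolding ex h exp_add ..
    qed
    also have "sqrt (1 / (2 * pi * \<sigma> * \<tau>)) = sqrt (2 * \<sigma> * \<tau> / w) * (1 / sqrt (2 * pi * r^2))"
    proof -
      have "1 / (2 * pi * \<sigma> * \<tau>) = (2 * \<sigma> * \<tau> / w) * (1 / (2 * pi * r^2))"
        unfolding r(2) using s w by (simp add: field_simps power2_eq_square)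
      then show ?thesis by (simp only: real_sqrt_mult real_sqrt_divide real_sqrt_one)
    qed
    finally show ?thesis by (simp add: normal_density_def)
  qed
  then have "(\<integral>\<^sup>+x. ennreal (sqrt (normal_density m \<sigma> x * normal_density k \<tau> x)) \<partial>lborel) = (\<integral>\<^sup>+x. ennreal ?c * ennreal (normal_density l r x) \<partial>lborel)"
    using s w by (intro nn_integral_cong) (simp add: ennreal_mult)
  also have "\<dots> = ennreal ?c" using r by (simp add: nn_integral_cmult nn_integral_normal_density)
  finally show ?thesis by (simp add: w_def)
qed

text \<open>Write r = sqrt p exp (-q). On [0, 1] one has sqrt p >= p, and exp (-q) >= 1 - q, so 1 -
  r <= (1 - p) + q. The root is given up in exchange for an expression rational in the
  scales.\<close>

lemma normal_affinity_bounds: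
  fixes \<sigma> \<tau> m k :: real
  assumes s: "\<sigma> > 0" "\<tau> > 0"
  defines "r \<equiv> sqrt (2 * \<sigma> * \<tau> / (\<sigma>\<^sup>2 + \<tau>\<^sup>2)) * exp (- (m - k)\<^sup>2 / (4 * (\<sigma>\<^sup>2 + \<tau>\<^sup>2)))"
  shows "0 \<le> r" "r \<le> 1" "1 - r \<le> (\<sigma> - \<tau>)\<^sup>2 / (\<sigma>\<^sup>2 + \<tau>\<^sup>2) + (m - k)\<^sup>2 / (4 * (\<sigma>\<^sup>2 + \<tau>\<^sup>2))"
proof -
  define w where "w = \<sigma>\<^sup>2 + \<tau>\<^sup>2"
  define p where "p = 2 * \<sigma> * \<tau> / w"
  define q where "q = (m - k)\<^sup>2 / (4 * w)"
  have w: "w > 0" using s by (simp add: w_def add_pos_pos)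
  have p: "0 \<le> p" "1 - p = (\<sigma> - \<tau>)\<^sup>2 / w"
    using s w by (auto simp: p_def field_simps w_def power2_eq_square)
  have "0 \<le> (\<sigma> - \<tau>)\<^sup>2 / w" using w by simp
  then have p1: "p \<le> 1" unfolding p(2)[symmetric] by simp
  have q: "0 \<le> q" using w by (simp add: q_def)
  have r: "r = sqrt p * exp (- q)" by (simp add: r_def p_def q_def w_def)
  show "0 \<le> r" using p by (simp add: r)
  show "r \<le> 1" unfolding r using p p1 q by (intro mult_le_one) auto
  have sp: "sqrt p \<ge> p" using p p1 by (intro real_le_rsqrt) (auto simp: power2_eq_square mult_le_one intro: mult_left_le)
  have e: "exp (-q) \<ge> 1 - q" using exp_ge_add_one_self[of "-q"] by simp
  have "r \<ge> p * exp (-q)" unfolding r using sp by (intro mult_right_mono) auto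
  also have "p * exp (-q) \<ge> p * (1 - q)" using e p by (intro mult_left_mono) auto
  finally have "1 - r \<le> (1 - p) + p * q" by (simp add: algebra_simps)
  also have "p * q \<le> q" using p1 q by (simp add: mult_left_le_one_le p)
  finally show "1 - r \<le> (\<sigma> - \<tau>)\<^sup>2 / (\<sigma>\<^sup>2 + \<tau>\<^sup>2) + (m - k)\<^sup>2 / (4 * (\<sigma>\<^sup>2 + \<tau>\<^sup>2))"
    using p(2) by (simp add: q_def w_def)
qed

subsection \<open>Inverse gamma and normal moments\<close>

definition inv_gamma_density :: "real \<Rightarrow> real \<Rightarrow> real \<Rightarrow> real" where
  "inv_gamma_density \<alpha> \<beta> x =
     (if x > 0 then \<beta> powr \<alpha> / Gamma \<alpha> * x powr (-\<alpha> - 1) * exp (-\<beta> / x) else 0)"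

lemma inv_gamma_density_measurable [measurable]: "inv_gamma_density \<alpha> \<beta> \<in> borel_measurable borel"
  unfolding inv_gamma_density_def[abs_def] by measurable

lemma inv_gamma_density_nonneg: "\<alpha> > 0 \<Longrightarrow> 0 \<le> inv_gamma_density \<alpha> \<beta> x"
  by (auto simp: inv_gamma_density_def Gamma_real_nonneg)

text \<open>The substitution t |-> \<open>\<beta>\<close> / t maps the open half line onto itself
  and carries the Gamma integral to this one.\<close>

lemma nn_integral_inv_gamma_density:
  assumes a: "\<alpha> > 0" and b: "\<beta> > 0"
  shows "(\<integral>\<^sup>+x. ennreal (inv_gamma_density \<alpha> \<beta> x) \<partial>lborel) = 1"
proof -
  let ?f = "\<lambda>s::real. s powr (\<alpha> - 1) / exp s"
  let ?S = "{0<..} :: real set"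
  have Gp: "Gamma \<alpha> > 0" using a by (rule Gamma_real_pos)
  \<comment> \<open>The Gamma integral is available on \<open>{0..}\<close>; the point 0 is removed
    because the substitution is singular there.\<close>
  have "(?f has_integral Gamma \<alpha>) {0<..}"
    by (subst has_integral_spike_set_eq[of _ "{0..}"])
       (auto intro: negligible_subset[of "{0}"] Gamma_integral_real[OF a])
  then have f: "?f absolutely_integrable_on ?S" "integral ?S ?f = Gamma \<alpha>"
    by (auto simp: integral_unique absolutely_integrable_on_def)
  have img: "(\<lambda>t. \<beta> / t) ` ?S = ?S"
    using b by (auto simp: image_iff intro!: bexI[of _ "\<beta> / _"] divide_pos_pos)
  have "(\<lambda>x. \<bar>- \<beta> / x^2\<bar> * ?f (\<beta> / x)) absolutely_integrable_on ?S \<and> integral ?S (\<lambda>x. \<bar>- \<beta> / x^2\<bar> * ?f (\<beta> / x)) = Gamma \<alpha>"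
    using f b by (subst has_absolute_integral_change_of_variables_1'[where g="\<lambda>t. \<beta> / t"])
      (auto intro!: derivative_eq_intros simp: img inj_on_def power2_eq_square field_simps)
  then have "((\<lambda>x. \<bar>- \<beta> / x^2\<bar> * ?f (\<beta> / x)) has_integral Gamma \<alpha>) ?S"
    by (metis absolutely_integrable_on_def has_integral_integral)
  then have "((\<lambda>x. 1 / Gamma \<alpha> * (\<bar>- \<beta> / x^2\<bar> * ?f (\<beta> / x))) has_integral (1 / Gamma \<alpha> * Gamma \<alpha>)) ?S"
    by (rule has_integral_mult_right)
  moreover have "1 / Gamma \<alpha> * (\<bar>- \<beta> / x\<^sup>2\<bar> * ((\<beta> / x) powr (\<alpha> - 1) / exp (\<beta> / x))) = inv_gamma_density \<alpha> \<beta> x" if "x \<in> ?S" for x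
  proof -
      have x: "x > 0" using that by simp
      have "\<bar>- \<beta> / x\<^sup>2\<bar> * (\<beta> / x) powr (\<alpha> - 1) = (\<beta> * \<beta> powr (\<alpha> - 1)) * (1 / x\<^sup>2 / x powr (\<alpha> - 1))"
        using x b by (simp add: powr_divide)
      also have "\<beta> * \<beta> powr (\<alpha> - 1) = \<beta> powr \<alpha>" using b by (simp add: powr_diff)
      also have "1 / x\<^sup>2 / x powr (\<alpha> - 1) = x powr (-\<alpha> - 1)"
        using x by (simp add: powr_diff powr_minus field_simps power2_eq_square)
      finally show ?thesis using x by (simp add: inv_gamma_density_def exp_minus field_simps)
  qed
  ultimately have "((inv_gamma_density \<alpha> \<beta>) has_integral (1 / Gamma \<alpha> * Gamma \<alpha>)) ?S"
    using has_integral_cong[of ?S "\<lambda>x. 1 / Gamma \<alpha> * (\<bar>- \<beta> / x^2\<bar> * ?f (\<beta> / x))" "inv_gamma_density \<alpha> \<beta>"] by blast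
  then have "((inv_gamma_density \<alpha> \<beta>) has_integral 1) ?S" using Gp by simp
  then have "(\<integral>\<^sup>+x. indicator ?S x * ennreal (inv_gamma_density \<alpha> \<beta> x) \<partial>lborel) = ennreal 1"
    using nn_integral_has_integral_lebesgue[of ?S "inv_gamma_density \<alpha> \<beta>" 1] inv_gamma_density_nonneg[OF a]
    by (simp add: ennreal_mult' ennreal_indicator)
  moreover have "(\<integral>\<^sup>+x. indicator ?S x * ennreal (inv_gamma_density \<alpha> \<beta> x) \<partial>lborel) = (\<integral>\<^sup>+x. ennreal (inv_gamma_density \<alpha> \<beta> x) \<partial>lborel)"
    by (rule nn_integral_cong) (auto simp: inv_gamma_density_def indicator_def)
  ultimately show ?thesis by simp
qed

text \<open>Multiplication by x lowers the shape by one, so every moment reduces to the total mass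
  of another inverse gamma density.\<close>

lemma inv_gamma_density_times:
  assumes "\<alpha> > 1" "\<beta> > 0"
  shows "inv_gamma_density \<alpha> \<beta> x * x = \<beta> / (\<alpha> - 1) * inv_gamma_density (\<alpha> - 1) \<beta> x"
proof -
  have "Gamma \<alpha> = (\<alpha> - 1) * Gamma (\<alpha> - 1)" using Gamma_plus1[of "\<alpha> - 1"] assms
    by (auto simp: nonpos_Ints_def)
  moreover have "Gamma (\<alpha> - 1) > 0" using assms by (simp add: Gamma_real_pos)
  ultimately show ?thesis using assms
    by (auto simp: inv_gamma_density_def powr_diff powr_minus powr_add)
qed

lemma nn_integral_inv_gamma_mean:
  assumes "\<alpha> > 1" "\<beta> > 0"
  shows "(\<integral>\<^sup>+x. ennreal (inv_gamma_density \<alpha> \<beta> x) * ennreal x \<partial>lborel) = ennreal (\<beta> / (\<alpha> - 1))"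
proof -
  have "(\<integral>\<^sup>+x. ennreal (inv_gamma_density \<alpha> \<beta> x) * ennreal x \<partial>lborel) =
    (\<integral>\<^sup>+x. ennreal (\<beta> / (\<alpha> - 1)) * ennreal (inv_gamma_density (\<alpha> - 1) \<beta> x) \<partial>lborel)"
    using assms inv_gamma_density_times[OF assms] inv_gamma_density_nonneg
    by (intro nn_integral_cong) (simp flip: ennreal_mult' ennreal_mult'')
  then show ?thesis using assms by (simp add: nn_integral_cmult nn_integral_inv_gamma_density)
qed

lemma nn_integral_inv_gamma_variance:
  assumes a: "\<alpha> > 2" and b: "\<beta> > 0"
  defines "m \<equiv> \<beta> / (\<alpha> - 1)"
  shows "(\<integral>\<^sup>+x. ennreal (inv_gamma_density \<alpha> \<beta> x) * ennreal ((x - m)\<^sup>2) \<partial>lborel) = ennreal (m\<^sup>2 / (\<alpha> - 2))"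
proof -
  let ?g = "\<lambda>\<alpha>. inv_gamma_density \<alpha> \<beta>"
  have I: "has_bochner_integral lborel (?g c) 1" if "c > 0" for c
    using that b nn_integral_inv_gamma_density[of c \<beta>] inv_gamma_density_nonneg[of c \<beta>]
    by (intro has_bochner_integral_nn_integral) (auto intro: AE_I2)
  have "?g \<alpha> x * (x - m)\<^sup>2 = (\<beta> / (\<alpha> - 1) * (\<beta> / (\<alpha> - 2))) * ?g (\<alpha> - 2) x - 2 * m * (\<beta> / (\<alpha> - 1)) * ?g (\<alpha> - 1) x + m\<^sup>2 * ?g \<alpha> x" for x
  proof -
    have 1: "?g \<alpha> x * x = \<beta> / (\<alpha> - 1) * ?g (\<alpha> - 1) x" using inv_gamma_density_times[of \<alpha>] a b by simp
    have 2: "?g (\<alpha> - 1) x * x = \<beta> / (\<alpha> - 2) * ?g (\<alpha> - 2) x" using inv_gamma_density_times[of "\<alpha> - 1"] a b by simp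
    have "?g \<alpha> x * (x - m)\<^sup>2 = (?g \<alpha> x * x) * x - 2 * m * (?g \<alpha> x * x) + m\<^sup>2 * ?g \<alpha> x"
      by (simp add: power2_eq_square algebra_simps)
    also have "(?g \<alpha> x * x) * x = \<beta> / (\<alpha> - 1) * (?g (\<alpha> - 1) x * x)" unfolding 1 by simp
    finally show ?thesis unfolding 1 2 by simp
  qed
  moreover have "has_bochner_integral lborel (\<lambda>x. (\<beta> / (\<alpha> - 1) * (\<beta> / (\<alpha> - 2))) * ?g (\<alpha> - 2) x - 2 * m * (\<beta> / (\<alpha> - 1)) * ?g (\<alpha> - 1) x + m\<^sup>2 * ?g \<alpha> x)
     ((\<beta> / (\<alpha> - 1) * (\<beta> / (\<alpha> - 2))) * 1 - 2 * m * (\<beta> / (\<alpha> - 1)) * 1 + m\<^sup>2 * 1)"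
    using a by (intro has_bochner_integral_add has_bochner_integral_diff has_bochner_integral_mult_right I) auto
  moreover have "(\<beta> / (\<alpha> - 1) * (\<beta> / (\<alpha> - 2))) * 1 - 2 * m * (\<beta> / (\<alpha> - 1)) * 1 + m\<^sup>2 * 1 = m\<^sup>2 / (\<alpha> - 2)"
  proof -
    have "m + m / (\<alpha> - 2) = (m * (\<alpha> - 1)) / (\<alpha> - 2)" using a by (simp add: field_simps)
    also have "m * (\<alpha> - 1) = \<beta>" using a by (simp add: m_def)
    finally have "\<beta> / (\<alpha> - 2) = m + m / (\<alpha> - 2)" by simp
    then show ?thesis by (simp add: m_def[symmetric] power2_eq_square algebra_simps)
  qed
  ultimately have H: "has_bochner_integral lborel (\<lambda>x. ?g \<alpha> x * (x - m)\<^sup>2) (m\<^sup>2 / (\<alpha> - 2))" by simp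
  have "(\<integral>\<^sup>+x. ennreal (?g \<alpha> x) * ennreal ((x - m)\<^sup>2) \<partial>lborel) = (\<integral>\<^sup>+x. ennreal (?g \<alpha> x * (x - m)\<^sup>2) \<partial>lborel)"
    by (simp add: ennreal_mult'')
  also have "\<dots> = ennreal (m\<^sup>2 / (\<alpha> - 2))"
    using a inv_gamma_density_nonneg[of \<alpha> \<beta>] by (subst nn_integral_eq_integral)
      (auto simp: has_bochner_integral_iff[THEN iffD1, OF H])
  finally show ?thesis .
qed

text \<open>For a fixed shape the inverse gamma laws form a scale family. In the sampler only the
  scale depends on the state, so a single variable can drive the \<open>A\<close>-update of both
  coupled chains.\<close>

lemma nn_integral_inv_gamma_scale:
  assumes a: "\<alpha> > 0" and b: "\<beta> > 0" and [measurable]: "h \<in> borel_measurable borel"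
  shows "(\<integral>\<^sup>+x. ennreal (inv_gamma_density \<alpha> \<beta> x) * h x \<partial>lborel) =
         (\<integral>\<^sup>+w. ennreal (inv_gamma_density \<alpha> 1 w) * h (\<beta> * w) \<partial>lborel)"
proof -
  have *: "\<beta> * inv_gamma_density \<alpha> \<beta> (\<beta> * w) = inv_gamma_density \<alpha> 1 w" for w
    using b by (auto simp: inv_gamma_density_def powr_mult powr_diff powr_minus zero_less_mult_iff field_simps)
  have "(\<integral>\<^sup>+x. ennreal (inv_gamma_density \<alpha> \<beta> x) * h x \<partial>lborel) = \<bar>\<beta>\<bar> * (\<integral>\<^sup>+w. ennreal (inv_gamma_density \<alpha> \<beta> (0 + \<beta> * w)) * h (0 + \<beta> * w) \<partial>lborel)"
    using b by (intro nn_integral_real_affine) auto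
  also have "\<dots> = (\<integral>\<^sup>+w. ennreal (\<beta> * inv_gamma_density \<alpha> \<beta> (\<beta> * w)) * h (\<beta> * w) \<partial>lborel)"
    using b by (subst nn_integral_cmult[symmetric]) (auto simp: ennreal_mult' mult.assoc)
  finally show ?thesis by (simp add: *)
qed

section \<open>Standard normal noise and its moments\<close>

lemma nn_integral_normal_density_standardize:
  assumes s: "\<sigma> > 0" and [measurable]: "h \<in> borel_measurable borel"
  shows "(\<integral>\<^sup>+x. ennreal (normal_density m \<sigma> x) * h x \<partial>lborel) =
         (\<integral>\<^sup>+z. ennreal (std_normal_density z) * h (m + \<sigma> * z) \<partial>lborel)"
proof -
  have *: "\<sigma> * normal_density m \<sigma> (m + \<sigma> * w) = std_normal_density w" for w
    using s by (simp add: normal_density_def real_sqrt_mult power_mult_distrib)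
  have "(\<integral>\<^sup>+x. ennreal (normal_density m \<sigma> x) * h x \<partial>lborel) = \<bar>\<sigma>\<bar> * (\<integral>\<^sup>+w. ennreal (normal_density m \<sigma> (m + \<sigma> * w)) * h (m + \<sigma> * w) \<partial>lborel)"
    using s by (intro nn_integral_real_affine) auto
  also have "\<dots> = (\<integral>\<^sup>+w. ennreal (\<sigma> * normal_density m \<sigma> (m + \<sigma> * w)) * h (m + \<sigma> * w) \<partial>lborel)"
    using s by (subst nn_integral_cmult[symmetric]) (auto simp: ennreal_mult' mult.assoc)
  finally show ?thesis by (simp add: *)
qed

definition std_normal :: "real measure" where
  "std_normal = density lborel (\<lambda>x. ennreal (std_normal_density x))"

lemma space_std_normal [simp]: "space std_normal = UNIV" and sets_std_normal [simp, measurable_cong]: "sets std_normal = sets borel"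
  by (auto simp: std_normal_def)

lemma prob_space_std_normal: "prob_space std_normal"
  unfolding std_normal_def by (rule prob_space_normal_density) simp

lemma std_normal_moments:
  "integrable std_normal (\<lambda>z. z)" "(\<integral>z. z \<partial>std_normal) = 0"
  "integrable std_normal (\<lambda>z. z\<^sup>2)" "(\<integral>z. z\<^sup>2 \<partial>std_normal) = 1"
  "integrable std_normal (\<lambda>z. (z\<^sup>2 - 1)\<^sup>2)" "(\<integral>z. (z\<^sup>2 - 1)\<^sup>2 \<partial>std_normal) = 2"
proof -
  let ?d = std_normal_density
  have h1: "has_bochner_integral lborel (\<lambda>x. ?d x * x) 0" using std_normal_moment_odd[of 0] by simp
  have h2: "has_bochner_integral lborel (\<lambda>x. ?d x * x\<^sup>2) 1" using std_normal_moment_even[of 1] by (simp add: fact_numeral)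
  have h4: "has_bochner_integral lborel (\<lambda>x. ?d x * x^4) 3" using std_normal_moment_even[of 2] by (simp add: fact_numeral)
  have h0: "has_bochner_integral lborel ?d 1" by (simp add: has_bochner_integral_iff)
  have h5: "has_bochner_integral lborel (\<lambda>x. ?d x * (x\<^sup>2 - 1)\<^sup>2) 2"
  proof -
    have "?d x * (x\<^sup>2 - 1)\<^sup>2 = ?d x * x^4 - 2 * (?d x * x\<^sup>2) + ?d x" for x
      by (simp add: power2_eq_square power4_eq_xxxx algebra_simps)
    moreover have "has_bochner_integral lborel (\<lambda>x. ?d x * x^4 - 2 * (?d x * x\<^sup>2) + ?d x) (3 - 2 * 1 + 1)"
      by (intro has_bochner_integral_add has_bochner_integral_diff has_bochner_integral_mult_right h0 h2 h4)
    ultimately show ?thesis by simp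
  qed
  have c: "has_bochner_integral std_normal f r \<longleftrightarrow> has_bochner_integral lborel (\<lambda>x. ?d x * f x) r" if "f \<in> borel_measurable borel" for f :: "real \<Rightarrow> real" and r
    using that unfolding std_normal_def has_bochner_integral_iff
    by (simp add: integrable_density integral_density)
  show "integrable std_normal (\<lambda>z. z)" "(\<integral>z. z \<partial>std_normal) = 0"
  "integrable std_normal (\<lambda>z. z\<^sup>2)" "(\<integral>z. z\<^sup>2 \<partial>std_normal) = 1"
  "integrable std_normal (\<lambda>z. (z\<^sup>2 - 1)\<^sup>2)" "(\<integral>z. (z\<^sup>2 - 1)\<^sup>2 \<partial>std_normal) = 2"
    using h1 h2 h5 unfolding c[symmetric, of "\<lambda>x. x", simplified] c[symmetric, of "\<lambda>x. x^2", simplified] c[symmetric, of "\<lambda>x. (x^2-1)^2", simplified]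
    by (simp_all add: has_bochner_integral_iff)
qed

lemma PiM_normal_density_eq_distr:
  assumes s: "\<sigma> > 0" and fin: "finite I"
  shows "PiM I (\<lambda>i. density lborel (\<lambda>x. ennreal (normal_density (m i) \<sigma> x))) =
     distr (PiM I (\<lambda>_. std_normal)) (PiM I (\<lambda>_. lborel)) (\<lambda>z. \<lambda>i\<in>I. m i + \<sigma> * z i)"
proof -
  let ?N = "\<lambda>i. density lborel (\<lambda>x. ennreal (normal_density (m i) \<sigma> x))"
  interpret product_sigma_finite ?N
    unfolding product_sigma_finite_def using s prob_space_normal_density prob_space_imp_sigma_finite by blast
  interpret S: product_sigma_finite "\<lambda>_. std_normal"
    unfolding product_sigma_finite_def using prob_space_std_normal prob_space_imp_sigma_finite by blast
  have [measurable]: "(\<lambda>z. \<lambda>i\<in>I. m i + \<sigma> * z i) \<in> measurable (PiM I (\<lambda>_. std_normal)) (PiM I (\<lambda>_. lborel))"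
    by (rule measurable_restrict) measurable
  have "emeasure (?N i) B = emeasure std_normal ((\<lambda>z. m i + \<sigma> * z) -` B)" if [measurable]: "B \<in> sets borel" for i B
  proof -
    have [measurable]: "(\<lambda>z. m i + \<sigma> * z) -` B \<in> sets borel"
      using measurable_sets[of "\<lambda>z. m i + \<sigma> * z" borel borel B] by simp
    have "emeasure (?N i) B = (\<integral>\<^sup>+x. ennreal (normal_density (m i) \<sigma> x) * indicator B x \<partial>lborel)"
      by (simp add: emeasure_density)
    also have "\<dots> = (\<integral>\<^sup>+z. ennreal (std_normal_density z) * indicator B (m i + \<sigma> * z) \<partial>lborel)"
      by (rule nn_integral_normal_density_standardize[OF s]) simp
    also have "\<dots> = emeasure std_normal ((\<lambda>z. m i + \<sigma> * z) -` B)"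
      unfolding std_normal_def by (subst emeasure_density) (auto intro!: nn_integral_cong simp: indicator_def)
    finally show ?thesis .
  qed note * = this
  show ?thesis
  proof (rule PiM_eqI[OF fin, symmetric])
    show "sets (distr (PiM I (\<lambda>_. std_normal)) (PiM I (\<lambda>_. lborel)) (\<lambda>z. \<lambda>i\<in>I. m i + \<sigma> * z i)) = sets (PiM I ?N)"
      by (simp, intro sets_PiM_cong) auto
    fix A assume "\<And>i. i \<in> I \<Longrightarrow> A i \<in> sets (?N i)"
    then have A[measurable]: "\<And>i. i \<in> I \<Longrightarrow> A i \<in> sets borel" by simp
    have A2: "(\<lambda>z. m i + \<sigma> * z) -` A i \<in> sets borel" if "i \<in> I" for i
      using measurable_sets[of "\<lambda>z. m i + \<sigma> * z" borel borel "A i"] A[OF that] by simp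
    have "emeasure (distr (PiM I (\<lambda>_. std_normal)) (PiM I (\<lambda>_. lborel)) (\<lambda>z. \<lambda>i\<in>I. m i + \<sigma> * z i)) (Pi\<^sub>E I A) =
      emeasure (PiM I (\<lambda>_. std_normal)) (Pi\<^sub>E I (\<lambda>i. (\<lambda>z. m i + \<sigma> * z) -` A i))"
      using fin A by (subst emeasure_distr) (auto intro!: sets_PiM_I_finite arg_cong2[where f=emeasure] simp: space_PiM PiE_iff)
    also have "\<dots> = (\<Prod>i\<in>I. emeasure (?N i) (A i))"
      using A A2 fin by (subst S.emeasure_PiM) (auto intro!: prod.cong simp: *)
    finally show "emeasure (distr (PiM I (\<lambda>_. std_normal)) (PiM I (\<lambda>_. lborel)) (\<lambda>z. \<lambda>i\<in>I. m i + \<sigma> * z i)) (Pi\<^sub>E I A) = (\<Prod>i\<in>I. emeasure (?N i) (A i))" .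
  qed
qed

lemma nn_integral_PiM_sum_squared:
  fixes g :: "'i \<Rightarrow> 'a \<Rightarrow> real"
  assumes P: "prob_space P" and fin: "finite I"
    and i1: "\<And>i. i \<in> I \<Longrightarrow> integrable P (g i)" and m0: "\<And>i. i \<in> I \<Longrightarrow> (\<integral>x. g i x \<partial>P) = 0"
    and i2: "\<And>i. i \<in> I \<Longrightarrow> integrable P (\<lambda>x. (g i x)\<^sup>2)"
  shows "(\<integral>\<^sup>+z. ennreal ((\<Sum>i\<in>I. g i (z i))\<^sup>2) \<partial>PiM I (\<lambda>_. P)) = ennreal (\<Sum>i\<in>I. \<integral>x. (g i x)\<^sup>2 \<partial>P)"
proof -
  interpret P: prob_space P by fact
  interpret product_sigma_finite "\<lambda>_. P"
    unfolding product_sigma_finite_def using P prob_space_imp_sigma_finite by blast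
  let ?M = "PiM I (\<lambda>_. P)"
  have cross: "has_bochner_integral ?M (\<lambda>z. g i (z i) * g j (z j)) (if i = j then \<integral>x. (g i x)\<^sup>2 \<partial>P else 0)"
    if ij: "i \<in> I" "j \<in> I" for i j
  proof -
    \<comment> \<open>The product of two coordinates is written as a product over all of
      \<open>I\<close>, with factor 1 elsewhere, so that the product integral formula applies. One
      formula covers i = j, where both factors sit at the same index, and i distinct from j, where a
      centred factor makes the product vanish.\<close>
    define \<phi> where "\<phi> = (\<lambda>k x. (if k = i then g i x else 1) * (if k = j then g j x else 1))"
    have int: "integrable P (\<phi> k)" for k
      unfolding \<phi>_def using i1 i2 ij by (cases "k = i"; cases "k = j") (auto simp: power2_eq_square)
    have eq: "(\<Prod>k\<in>I. \<phi> k (z k)) = g i (z i) * g j (z j)" for z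
      unfolding \<phi>_def prod.distrib using ij fin by (simp add: if_distrib[of "\<lambda>f. f _"] prod.delta cong: if_cong)
    have "(\<Prod>k\<in>I. integral\<^sup>L P (\<phi> k)) = (if i = j then \<integral>x. (g i x)\<^sup>2 \<partial>P else 0)"
    proof (cases "i = j")
      case True
      have "(\<Prod>k\<in>I. integral\<^sup>L P (\<phi> k)) = (\<Prod>k\<in>I. if k = i then \<integral>x. (g i x)\<^sup>2 \<partial>P else 1)"
        by (rule prod.cong) (auto simp: \<phi>_def True power2_eq_square P.prob_space)
      then show ?thesis using True ij fin by simp
    next
      case False
      have "integral\<^sup>L P (\<phi> i) = 0" using False m0[OF ij(1)] by (simp add: \<phi>_def)
      then show ?thesis using False ij fin by (auto intro!: prod_zero)
    qed
    then show ?thesis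
      using product_integrable_prod[of I \<phi>, OF fin int] product_integral_prod[of I \<phi>, OF fin int]
      by (simp add: eq has_bochner_integral_iff)
  qed
  have "has_bochner_integral ?M (\<lambda>z. \<Sum>i\<in>I. \<Sum>j\<in>I. g i (z i) * g j (z j)) (\<Sum>i\<in>I. \<Sum>j\<in>I. if i = j then \<integral>x. (g i x)\<^sup>2 \<partial>P else 0)"
    by (intro has_bochner_integral_sum cross)
  moreover have "(\<Sum>i\<in>I. g i (z i))\<^sup>2 = (\<Sum>i\<in>I. \<Sum>j\<in>I. g i (z i) * g j (z j))" for z
    by (simp add: power2_eq_square sum_product)
  ultimately have "has_bochner_integral ?M (\<lambda>z. (\<Sum>i\<in>I. g i (z i))\<^sup>2) (\<Sum>i\<in>I. \<integral>x. (g i x)\<^sup>2 \<partial>P)"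
    using fin by (simp add: sum.delta)
  then show ?thesis
    by (subst nn_integral_eq_integral) (auto simp: has_bochner_integral_iff)
qed

subsection \<open>The Gibbs kernel\<close>

lemma normal_density_measurable_param [measurable]:
  fixes f g h :: "'a \<Rightarrow> real"
  assumes [measurable]: "f \<in> borel_measurable M" "g \<in> borel_measurable M" "h \<in> borel_measurable M"
  shows "(\<lambda>x. normal_density (f x) (g x) (h x)) \<in> borel_measurable M"
  unfolding normal_density_def by measurable

lemma inv_gamma_density_measurable_param [measurable]:
  fixes f h :: "'a \<Rightarrow> real"
  assumes [measurable]: "f \<in> borel_measurable M" "h \<in> borel_measurable M"
  shows "(\<lambda>x. inv_gamma_density \<alpha> (f x) (h x)) \<in> borel_measurable M"
  unfolding inv_gamma_density_def by measurable

text \<open>The scale comes from an arbitrary state. A negative square root gives the density for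
  the absolute value, and scale 0 gives the zero function by division by zero. The mass is therefore
  1 or 0, which is enough for a sub-probability kernel.\<close>

lemma nn_integral_normal_density_le_one: "(\<integral>\<^sup>+x. ennreal (normal_density m \<sigma> x) \<partial>lborel) \<le> 1"
proof -
  have "normal_density m \<sigma> = normal_density m \<bar>\<sigma>\<bar>" by (simp add: normal_density_def fun_eq_iff)
  then show ?thesis using nn_integral_normal_density[of "\<bar>\<sigma>\<bar>" m]
    by (cases "\<sigma> = 0") (auto simp: normal_density_def)
qed

locale gibbs_model =
  fixes V a b0 :: real and Y :: "nat \<Rightarrow> nat \<Rightarrow> real" and n :: nat
  assumes V: "V > 0" and a: "a > 0" and b0: "b0 > 0" and n: "n \<ge> 2"
begin

abbreviation Lam :: "(nat \<Rightarrow> real) measure" where "Lam \<equiv> PiM {..<n} (\<lambda>_. lborel)"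

definition ss :: "(nat \<Rightarrow> real) \<Rightarrow> real" where "ss \<theta> = (\<Sum>i<n. (\<theta> i - vmean n \<theta>)\<^sup>2)"
definition shape :: real where "shape = a + (real n - 1) / 2"
definition cm :: "real \<Rightarrow> real \<Rightarrow> nat \<Rightarrow> real" where "cm A \<mu> i = (\<mu> * V + Y n i * A) / (V + A)"
definition cs :: "real \<Rightarrow> real" where "cs A = sqrt (A * V / (V + A))"
definition dmu :: "real \<Rightarrow> (nat \<Rightarrow> real) \<Rightarrow> real \<Rightarrow> real" where
  "dmu A \<theta> \<mu> = normal_density (vmean n \<theta>) (sqrt (A / real n)) \<mu>"
definition dth :: "real \<Rightarrow> real \<Rightarrow> (nat \<Rightarrow> real) \<Rightarrow> real" where
  "dth A \<mu> \<theta> = (\<Prod>i<n. normal_density (cm A \<mu> i) (cs A) (\<theta> i))"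
definition dA :: "(nat \<Rightarrow> real) \<Rightarrow> real \<Rightarrow> real" where
  "dA \<theta> = inv_gamma_density shape (b0 + (1/2) * ss \<theta>)"

lemma real_n: "real n \<ge> 2" using n by simp
lemma shape_pos: "shape > 0" using a real_n by (auto simp: shape_def add_pos_nonneg)
lemma ss_nonneg: "0 \<le> ss \<theta>" by (simp add: ss_def sum_nonneg)

lemma component_measurable: "i \<in> {..<n} \<Longrightarrow> (\<lambda>\<theta>. \<theta> i) \<in> borel_measurable Lam"
  using measurable_component_singleton[of i "{..<n}" "\<lambda>_. lborel"] by simp

lemma vmean_measurable [measurable]: "vmean n \<in> borel_measurable Lam"
  unfolding vmean_def[abs_def] using component_measurable by (intro borel_measurable_divide borel_measurable_sum) auto
lemma ss_measurable [measurable]: "ss \<in> borel_measurable Lam"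
  unfolding ss_def[abs_def] using component_measurable by (intro borel_measurable_sum borel_measurable_power borel_measurable_diff) auto
lemma cm_measurable [measurable (raw)]:
  assumes [measurable]: "f \<in> borel_measurable M" "g \<in> borel_measurable M"
  shows "(\<lambda>x. cm (f x) (g x) i) \<in> borel_measurable M"
  unfolding cm_def by measurable
lemma cs_measurable [measurable]: "cs \<in> borel_measurable borel"
  unfolding cs_def[abs_def] by measurable
lemma dmu_measurable [measurable (raw)]:
  assumes [measurable]: "f \<in> borel_measurable M" "g \<in> measurable M Lam" "h \<in> borel_measurable M"
  shows "(\<lambda>x. dmu (f x) (g x) (h x)) \<in> borel_measurable M"
  unfolding dmu_def by measurable
lemma dth_measurable [measurable (raw)]:
  assumes [measurable]: "f \<in> borel_measurable M" "h \<in> borel_measurable M" and g: "g \<in> measurable M Lam"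
  shows "(\<lambda>x. dth (f x) (h x) (g x)) \<in> borel_measurable M"
  unfolding dth_def using measurable_compose[OF g component_measurable]
  by (intro borel_measurable_prod normal_density_measurable_param) auto
lemma dA_measurable [measurable (raw)]:
  assumes [measurable]: "g \<in> measurable M Lam" "h \<in> borel_measurable M"
  shows "(\<lambda>x. dA (g x) (h x)) \<in> borel_measurable M"
  unfolding dA_def by measurable

lemma dmu_nonneg [simp]: "0 \<le> dmu A \<theta> \<mu>" and dth_nonneg [simp]: "0 \<le> dth A \<mu> \<theta>" and dA_nonneg [simp]: "0 \<le> dA \<theta> A"
  using shape_pos by (auto simp: dmu_def dth_def dA_def intro!: prod_nonneg inv_gamma_density_nonneg)

lemma sigma_finite_Lam: "sigma_finite_measure Lam"
proof -
  interpret product_sigma_finite "\<lambda>_. lborel :: real measure" by (simp add: product_sigma_finite_def sigma_finite_lborel)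
  show ?thesis by (rule sigma_finite) simp
qed

lemma normal_meas_eq: "normal_meas (vmean n \<theta>) (A / real n) = density lborel (\<lambda>\<mu>. ennreal (dmu A \<theta> \<mu>))"
  by (simp add: normal_meas_def dmu_def)

lemma PiM_normal_meas_eq:
  "PiM {..<n} (\<lambda>i. normal_meas ((\<mu> * V + Y n i * A) / (V + A)) (A * V / (V + A))) = density Lam (\<lambda>\<theta>. ennreal (dth A \<mu> \<theta>))"
  unfolding normal_meas_def dth_def cm_def cs_def
  by (rule PiM_density) (auto simp: sigma_finite_lborel)

lemma inv_gamma_meas_eq:
  "inv_gamma_meas (a + (real n - 1) / 2) (b0 + (1/2) * (\<Sum>i<n. (\<theta> i - vmean n \<theta>)\<^sup>2)) = density lborel (\<lambda>A. ennreal (dA \<theta> A))"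
  unfolding inv_gamma_meas_def dA_def inv_gamma_density_def shape_def ss_def ..

lemma nn_integral_dA: "(\<integral>\<^sup>+A. ennreal (dA \<theta> A) \<partial>lborel) = 1"
  unfolding dA_def using shape_pos ss_nonneg[of \<theta>] b0 by (intro nn_integral_inv_gamma_density) auto

lemma nn_integral_dmu: "A > 0 \<Longrightarrow> (\<integral>\<^sup>+\<mu>. ennreal (dmu A \<theta> \<mu>) \<partial>lborel) = 1"
  unfolding dmu_def using n by (intro nn_integral_normal_density) auto

lemma nn_integral_dth_eq: "(\<integral>\<^sup>+\<theta>. ennreal (dth A \<mu> \<theta>) \<partial>Lam) = (\<Prod>i<n. \<integral>\<^sup>+x. ennreal (normal_density (cm A \<mu> i) (cs A) x) \<partial>lborel)"
proof -
  interpret product_sigma_finite "\<lambda>_. lborel :: real measure" by (simp add: product_sigma_finite_def sigma_finite_lborel)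
  show ?thesis unfolding dth_def
    by (subst product_nn_integral_prod[symmetric]) (auto simp: prod_ennreal)
qed

lemma cs_pos: "A > 0 \<Longrightarrow> cs A > 0" using V by (simp add: cs_def)

lemma nn_integral_dth: "A > 0 \<Longrightarrow> (\<integral>\<^sup>+\<theta>. ennreal (dth A \<mu> \<theta>) \<partial>Lam) = 1"
  unfolding nn_integral_dth_eq using cs_pos by (simp add: nn_integral_normal_density)

lemma nn_integral_dth_le: "(\<integral>\<^sup>+\<theta>. ennreal (dth A \<mu> \<theta>) \<partial>Lam) \<le> 1"
  unfolding nn_integral_dth_eq by (rule prod_le_1) (auto simp: nn_integral_normal_density_le_one)

lemma space_Lam_ne: "space Lam \<noteq> {}" by (simp add: space_PiM PiE_eq_empty_iff)

abbreviation S :: "(real \<times> real \<times> (nat \<Rightarrow> real)) measure" where "S \<equiv> state_space n"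

lemma sets_S [measurable_cong]: "sets S = sets (borel \<Otimes>\<^sub>M borel \<Otimes>\<^sub>M Lam)"
  unfolding state_space_def by (intro sets_pair_measure_cong) auto

lemma kernel_mu [measurable]: "(\<lambda>x. density lborel (\<lambda>\<mu>. ennreal (dmu (fst x) (snd (snd x)) \<mu>))) \<in> measurable S (subprob_algebra lborel)"
proof -
  have "(\<lambda>x. density lborel (\<lambda>y. (\<lambda>p. ennreal (dmu (fst (fst p)) (snd (snd (fst p))) (snd p))) (x, y))) \<in> measurable S (subprob_algebra lborel)"
    by (rule measurable_density_kernel) (auto simp: dmu_def sigma_finite_lborel nn_integral_normal_density_le_one)
  then show ?thesis by simp
qed

lemma kernel_th [measurable]: "(\<lambda>p. density Lam (\<lambda>\<theta>. ennreal (dth (fst (fst p)) (snd p) \<theta>))) \<in> measurable (S \<Otimes>\<^sub>M lborel) (subprob_algebra Lam)"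
proof -
  have "(\<lambda>x. density Lam (\<lambda>y. (\<lambda>p. ennreal (dth (fst (fst (fst p))) (snd (fst p)) (snd p))) (x, y))) \<in> measurable (S \<Otimes>\<^sub>M lborel) (subprob_algebra Lam)"
    by (rule measurable_density_kernel) (auto simp: sigma_finite_Lam nn_integral_dth_le space_Lam_ne)
  then show ?thesis by simp
qed

lemma kernel_A [measurable]: "(\<lambda>\<theta>. density lborel (\<lambda>A. ennreal (dA \<theta> A))) \<in> measurable Lam (subprob_algebra lborel)"
proof -
  have "(\<lambda>x. density lborel (\<lambda>y. (\<lambda>p. ennreal (dA (fst p) (snd p))) (x, y))) \<in> measurable Lam (subprob_algebra lborel)"
    by (rule measurable_density_kernel) (auto simp: sigma_finite_lborel nn_integral_dA)
  then show ?thesis by simp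
qed

text \<open>The inner binds of \<open>gibbs_step\<close>, with the values already drawn packed into
  one argument, which is the form in which \<open>measurable_bind\<close> establishes joint
  measurability.\<close>

definition kern3 where "kern3 q = (density lborel (\<lambda>A. ennreal (dA (snd q) A)) \<bind> (\<lambda>A'. return S (A', fst q, snd q)))"
definition kern2 where "kern2 p = (density Lam (\<lambda>\<theta>. ennreal (dth (fst (fst p)) (snd p) \<theta>)) \<bind> (\<lambda>\<theta>'. kern3 (snd p, \<theta>')))"

lemma gibbs_step_eq:
  "gibbs_step V a b0 Y n x = density lborel (\<lambda>\<mu>. ennreal (dmu (fst x) (snd (snd x)) \<mu>)) \<bind> (\<lambda>\<mu>'. kern2 (x, \<mu>'))"
  unfolding gibbs_step_def Let_def kern2_def kern3_def normal_meas_eq PiM_normal_meas_eq inv_gamma_meas_eq by simp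

lemma kern3_measurable [measurable]: "kern3 \<in> measurable (lborel \<Otimes>\<^sub>M Lam) (subprob_algebra S)"
  unfolding kern3_def[abs_def]
proof (rule measurable_bind[where N=lborel])
  show "(\<lambda>q. density lborel (\<lambda>A. ennreal (dA (snd q) A))) \<in> measurable (lborel \<Otimes>\<^sub>M Lam) (subprob_algebra lborel)"
    by (rule measurable_compose[OF measurable_snd kernel_A])
qed measurable

lemma kern2_measurable [measurable]: "kern2 \<in> measurable (S \<Otimes>\<^sub>M lborel) (subprob_algebra S)"
  unfolding kern2_def[abs_def] by (rule measurable_bind[where N=Lam]) measurable

lemma gibbs_step_measurable [measurable]: "gibbs_step V a b0 Y n \<in> measurable S (subprob_algebra S)"
  unfolding gibbs_step_eq[abs_def] by (rule measurable_bind[where N=lborel]) measurable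

lemma nn_integral_kern3:
  assumes [measurable]: "h \<in> borel_measurable S" and q: "\<theta> \<in> space Lam"
  shows "(\<integral>\<^sup>+y. h y \<partial>kern3 (\<mu>, \<theta>)) = (\<integral>\<^sup>+A'. ennreal (dA \<theta> A') * h (A', \<mu>, \<theta>) \<partial>lborel)"
proof -
  have [measurable]: "(\<lambda>A'. (A', \<mu>, \<theta>)) \<in> measurable lborel S" using q by measurable
  have "(\<integral>\<^sup>+y. h y \<partial>kern3 (\<mu>, \<theta>)) = (\<integral>\<^sup>+A'. (\<integral>\<^sup>+y. h y \<partial>return S (A', \<mu>, \<theta>)) \<partial>density lborel (\<lambda>A. ennreal (dA \<theta> A)))"
    unfolding kern3_def by (subst nn_integral_bind[where B=S]) auto
  also have "\<dots> = (\<integral>\<^sup>+A'. h (A', \<mu>, \<theta>) \<partial>density lborel (\<lambda>A. ennreal (dA \<theta> A)))"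
    using q by (intro nn_integral_cong nn_integral_return) (auto simp: state_space_def space_pair_measure)
  also have "\<dots> = (\<integral>\<^sup>+A'. ennreal (dA \<theta> A') * h (A', \<mu>, \<theta>) \<partial>lborel)"
    using q by (subst nn_integral_density) auto
  finally show ?thesis .
qed

lemma measurable_S_tuple [measurable (raw)]:
  assumes [measurable]: "f \<in> borel_measurable M" "g \<in> borel_measurable M" "h \<in> measurable M Lam"
  shows "(\<lambda>x. (f x, g x, h x)) \<in> measurable M S"
  by measurable

lemma nn_integral_gibbs_step:
  assumes h[measurable]: "h \<in> borel_measurable S" and x: "x \<in> space S"
  shows "(\<integral>\<^sup>+y. h y \<partial>gibbs_step V a b0 Y n x) =
    (\<integral>\<^sup>+\<mu>. ennreal (dmu (fst x) (snd (snd x)) \<mu>) *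
      (\<integral>\<^sup>+\<theta>. ennreal (dth (fst x) \<mu> \<theta>) * (\<integral>\<^sup>+A'. ennreal (dA \<theta> A') * h (A', \<mu>, \<theta>) \<partial>lborel) \<partial>Lam) \<partial>lborel)"
proof -
  have [measurable]: "x \<in> space S" by fact
  have th: "snd (snd x) \<in> space Lam" using x by (auto simp: state_space_def space_pair_measure)
  note [measurable] = th
  interpret L: sigma_finite_measure Lam by (rule sigma_finite_Lam)
  have K2: "(\<integral>\<^sup>+y. h y \<partial>kern2 (x, \<mu>)) = (\<integral>\<^sup>+\<theta>. ennreal (dth (fst x) \<mu> \<theta>) * (\<integral>\<^sup>+A'. ennreal (dA \<theta> A') * h (A', \<mu>, \<theta>) \<partial>lborel) \<partial>Lam)" for \<mu>
  proof -
    have "(\<integral>\<^sup>+y. h y \<partial>kern2 (x, \<mu>)) = (\<integral>\<^sup>+\<theta>. (\<integral>\<^sup>+y. h y \<partial>kern3 (\<mu>, \<theta>)) \<partial>density Lam (\<lambda>\<theta>. ennreal (dth (fst x) \<mu> \<theta>)))"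
      unfolding kern2_def by (subst nn_integral_bind[where B=S]) auto
    also have "\<dots> = (\<integral>\<^sup>+\<theta>. (\<integral>\<^sup>+A'. ennreal (dA \<theta> A') * h (A', \<mu>, \<theta>) \<partial>lborel) \<partial>density Lam (\<lambda>\<theta>. ennreal (dth (fst x) \<mu> \<theta>)))"
      by (intro nn_integral_cong nn_integral_kern3) auto
    also have "\<dots> = (\<integral>\<^sup>+\<theta>. ennreal (dth (fst x) \<mu> \<theta>) * (\<integral>\<^sup>+A'. ennreal (dA \<theta> A') * h (A', \<mu>, \<theta>) \<partial>lborel) \<partial>Lam)"
      by (subst nn_integral_density) measurable
    finally show ?thesis .
  qed
  have [measurable]: "(\<lambda>\<mu>. \<integral>\<^sup>+\<theta>. ennreal (dth (fst x) \<mu> \<theta>) * (\<integral>\<^sup>+A'. ennreal (dA \<theta> A') * h (A', \<mu>, \<theta>) \<partial>lborel) \<partial>Lam) \<in> borel_measurable borel"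
    by measurable
  have "(\<integral>\<^sup>+y. h y \<partial>gibbs_step V a b0 Y n x) = (\<integral>\<^sup>+\<mu>. (\<integral>\<^sup>+y. h y \<partial>kern2 (x, \<mu>)) \<partial>density lborel (\<lambda>\<mu>. ennreal (dmu (fst x) (snd (snd x)) \<mu>)))"
    unfolding gibbs_step_eq using x by (subst nn_integral_bind[where B=S]) auto
  then show ?thesis unfolding K2
    by (subst (asm) nn_integral_density) auto
qed

text \<open>The Markov operator of the sampler on test functions. It acts backwards in time: in
  \<open>(T ^^ k) h\<close> the outermost application is the first step of the chain.\<close>

definition T :: "(real \<times> real \<times> (nat \<Rightarrow> real) \<Rightarrow> ennreal) \<Rightarrow> real \<times> real \<times> (nat \<Rightarrow> real) \<Rightarrow> ennreal" where
  "T h x = (\<integral>\<^sup>+y. h y \<partial>gibbs_step V a b0 Y n x)"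

lemma T_measurable [measurable]: "h \<in> borel_measurable S \<Longrightarrow> T h \<in> borel_measurable S"
  unfolding T_def[abs_def] by (rule measurable_compose[OF gibbs_step_measurable nn_integral_measurable_subprob_algebra])

lemma T_pow_measurable: "h \<in> borel_measurable S \<Longrightarrow> (T ^^ k) h \<in> borel_measurable S"
  by (induction k) auto

lemma sets_chain_law: "sets (chain_law V a b0 Y n x0 k) = sets S"
proof (induction k)
  case (Suc k)
  have sp: "space (chain_law V a b0 Y n x0 k) = space S" using Suc by (rule sets_eq_imp_space_eq)
  show ?case unfolding chain_law.simps
    by (rule sets_bind) (use sp in \<open>auto simp: sets_kernel[OF gibbs_step_measurable] state_space_def space_pair_measure space_Lam_ne\<close>)
qed simp

lemma nn_integral_chain_law:
  assumes x0: "x0 \<in> space S" and h: "h \<in> borel_measurable S"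
  shows "(\<integral>\<^sup>+y. h y \<partial>chain_law V a b0 Y n x0 k) = (T ^^ k) h x0"
  using h
proof (induction k arbitrary: h)
  case 0 then show ?case using x0 by (simp add: nn_integral_return)
next
  case (Suc k)
  have "gibbs_step V a b0 Y n \<in> measurable (chain_law V a b0 Y n x0 k) (subprob_algebra S)"
    using gibbs_step_measurable by (simp add: measurable_cong_sets[OF sets_chain_law refl])
  then have "(\<integral>\<^sup>+y. h y \<partial>chain_law V a b0 Y n x0 (Suc k)) = (\<integral>\<^sup>+y. T h y \<partial>chain_law V a b0 Y n x0 k)"
    unfolding T_def chain_law.simps by (rule nn_integral_bind[OF Suc.prems])
  also have "\<dots> = (T ^^ k) (T h) x0" using Suc by simp
  finally show ?case by (simp add: funpow_swap1)
qed

lemma T_mono: "(\<And>y. y \<in> space S \<Longrightarrow> h y \<le> g y) \<Longrightarrow> x \<in> space S \<Longrightarrow> T h x \<le> T g x"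
  unfolding T_def using sets_eq_imp_space_eq[OF sets_kernel[OF gibbs_step_measurable]]
  by (intro nn_integral_mono) auto

lemma T_pow_le_one: "h \<in> borel_measurable S \<Longrightarrow> (\<And>y. y \<in> space S \<Longrightarrow> h y \<le> 1) \<Longrightarrow> x \<in> space S \<Longrightarrow> (T ^^ k) h x \<le> 1"
proof (induction k arbitrary: x)
  case (Suc k)
  interpret K: subprob_space "gibbs_step V a b0 Y n x" using subprob_space_kernel[OF gibbs_step_measurable Suc.prems(3)] .
  have "T ((T ^^ k) h) x \<le> T (\<lambda>_. 1) x" by (rule T_mono) (use Suc in auto)
  also have "\<dots> \<le> 1" unfolding T_def by (simp add: K.emeasure_space_le_1)
  finally show ?case by simp
qed auto

text \<open>Mass can be lost: at \<open>A = 0\<close> the normal density for mu is the zero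
  function. Conservation of mass is therefore proved together with positivity of \<open>A\<close>,
  which one step preserves because the inverse gamma density lives on the positive half
  line.\<close>

lemma emeasure_chain_law_space:
  assumes x0: "x0 \<in> space S" and A: "fst x0 > 0"
  shows "emeasure (chain_law V a b0 Y n x0 k) (space S) = 1"
proof -
  define p :: "real \<times> real \<times> (nat \<Rightarrow> real) \<Rightarrow> ennreal" where "p = (\<lambda>x. indicator {0<..} (fst x))"
  have [measurable]: "p \<in> borel_measurable S" unfolding p_def by measurable
  have step: "T p x = 1" if x: "x \<in> space S" and "fst x > 0" for x
  proof -
    have "(\<integral>\<^sup>+A'. ennreal (dA \<theta> A') * p (A', \<mu>, \<theta>) \<partial>lborel) = (\<integral>\<^sup>+A'. ennreal (dA \<theta> A') \<partial>lborel)" for \<mu> \<theta>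
      by (rule nn_integral_cong) (auto simp: p_def dA_def inv_gamma_density_def indicator_def)
    then show ?thesis using that unfolding T_def
      by (subst nn_integral_gibbs_step) (auto simp: nn_integral_dA nn_integral_dth nn_integral_dmu)
  qed
  have ge: "p x \<le> (T ^^ k) p x" if "x \<in> space S" for x k using that
  proof (induction k arbitrary: x)
    case (Suc k)
    have "p x \<le> T p x" using step[OF Suc.prems] by (auto simp: p_def indicator_def)
    also have "\<dots> \<le> T ((T ^^ k) p) x" by (rule T_mono) (use Suc in auto)
    finally show ?case by simp
  qed simp
  have "1 \<le> (T ^^ k) p x0" using ge[OF x0, of k] A by (simp add: p_def)
  also have "(T ^^ k) p x0 = (\<integral>\<^sup>+y. p y \<partial>chain_law V a b0 Y n x0 k)" by (rule nn_integral_chain_law[symmetric]) (auto simp: x0)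
  also have "\<dots> \<le> (\<integral>\<^sup>+y. 1 \<partial>chain_law V a b0 Y n x0 k)" by (rule nn_integral_mono) (auto simp: p_def indicator_def)
  also have "\<dots> = emeasure (chain_law V a b0 Y n x0 k) (space S)"
    by (simp add: sets_eq_imp_space_eq[OF sets_chain_law])
  finally have 1: "1 \<le> emeasure (chain_law V a b0 Y n x0 k) (space S)" .
  have "(\<integral>\<^sup>+y. 1 \<partial>chain_law V a b0 Y n x0 k) \<le> 1"
    using T_pow_le_one[of "\<lambda>_. 1" x0 k] x0 by (subst nn_integral_chain_law) auto
  then have "emeasure (chain_law V a b0 Y n x0 k) (space S) \<le> 1" by (simp add: sets_eq_imp_space_eq[OF sets_chain_law])
  with 1 show ?thesis by (rule antisym[rotated])
qed

end

subsection \<open>Smoothing in total variation\<close>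

lemma sqrt_diff_sq_le:
  fixes x y :: real
  assumes "x > 0" "y > 0"
  shows "(sqrt x - sqrt y)\<^sup>2 / ((sqrt x)\<^sup>2 + (sqrt y)\<^sup>2) \<le> ((x - y) / (x + y))\<^sup>2"
proof -
  have e: "x - y = (sqrt x - sqrt y) * (sqrt x + sqrt y)" using assms by (simp add: algebra_simps)
  have "x + y \<le> (sqrt x + sqrt y)\<^sup>2" using assms by (simp add: power2_sum)
  then have "(sqrt x - sqrt y)\<^sup>2 * (x + y) \<le> (x - y)\<^sup>2"
    unfolding e power_mult_distrib by (intro mult_left_mono) auto
  then have "(sqrt x - sqrt y)\<^sup>2 / (x + y) \<le> (x - y)\<^sup>2 / (x + y)\<^sup>2"
  proof -
    have w: "x + y > 0" using assms by simp
    have "(sqrt x - sqrt y)\<^sup>2 / (x + y) = (sqrt x - sqrt y)\<^sup>2 * (x + y) / (x + y)\<^sup>2"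
      using w by (simp add: power2_eq_square)
    also have "\<dots> \<le> (x - y)\<^sup>2 / (x + y)\<^sup>2"
      using \<open>(sqrt x - sqrt y)\<^sup>2 * (x + y) \<le> (x - y)\<^sup>2\<close> by (intro divide_right_mono) auto
    finally show ?thesis .
  qed
  then show ?thesis using assms by (simp add: power_divide)
qed

lemma sqrt_prod: "sqrt (\<Prod>i\<in>I. f i) = (\<Prod>i\<in>I. sqrt (f i))"
  by (induction I rule: infinite_finite_induct) (auto simp: real_sqrt_mult)

context gibbs_model
begin

text \<open>The shrinkage weight: given mu, the full conditional of each theta puts this weight on
  the observation and the rest on mu, and its variance is V times the weight.\<close>

definition alpha :: "real \<Rightarrow> real" where "alpha A = A / (V + A)"
abbreviation "\<Delta> \<equiv> Delta Y n"
abbreviation "Yb \<equiv> Ybar Y n"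

lemma cs_alpha: "cs A = sqrt (V * alpha A)" by (simp add: cs_def alpha_def mult.commute)

lemma cm_alpha: "A > 0 \<Longrightarrow> cm A \<mu> i = \<mu> + alpha A * (Y n i - \<mu>)"
  using V by (simp add: cm_def alpha_def field_simps)

lemma alpha_pos: "A > 0 \<Longrightarrow> 0 < alpha A" and alpha_less: "A > 0 \<Longrightarrow> alpha A < 1"
  using V by (auto simp: alpha_def)

lemma alpha_diff: "A > 0 \<Longrightarrow> A' > 0 \<Longrightarrow> alpha A - alpha A' = V * (A - A') / ((V + A) * (V + A'))"
  using V by (simp add: alpha_def field_simps)

lemma alpha_mono: "0 < A \<Longrightarrow> A \<le> A' \<Longrightarrow> alpha A \<le> alpha A'"
  using V by (simp add: alpha_def field_simps)

lemma alpha_lipschitz: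
  assumes "A > 0" "A' > 0" shows "\<bar>alpha A - alpha A'\<bar> \<le> \<bar>A - A'\<bar> / V"
proof -
  have "V * V \<le> (V + A) * (V + A')" using V assms by (intro mult_mono) auto
  then have "V * \<bar>A - A'\<bar> / ((V + A) * (V + A')) \<le> V * \<bar>A - A'\<bar> / (V * V)"
    using V assms by (intro divide_left_mono) (auto intro!: mult_pos_pos)
  then show ?thesis using V assms by (simp add: alpha_diff abs_mult abs_divide)
qed

lemma sum_dev: "(\<Sum>i<n. (Y n i - t)\<^sup>2) = \<Delta> + real n * (t - Yb)\<^sup>2"
proof -
  have s: "(\<Sum>i<n. Y n i) = real n * Yb" using n by (simp add: Ybar_def)
  have "(\<Sum>i<n. (Y n i - t)\<^sup>2) = (\<Sum>i<n. (Y n i - Yb)\<^sup>2 + 2 * (Yb - t) * (Y n i - Yb) + (Yb - t)\<^sup>2)"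
    by (rule sum.cong) (auto simp: power2_eq_square algebra_simps)
  also have "\<dots> = \<Delta> + 2 * (Yb - t) * (\<Sum>i<n. Y n i - Yb) + real n * (Yb - t)\<^sup>2"
    by (simp add: sum.distrib Delta_def sum_distrib_left)
  also have "(\<Sum>i<n. Y n i - Yb) = 0" by (simp add: sum_subtractf s)
  finally show ?thesis by (simp add: power2_commute)
qed

lemma Delta_nonneg: "0 \<le> \<Delta>" by (simp add: Delta_def sum_nonneg)

text \<open>The law of mu has variance A / n. A shift of its mean is magnified by sqrt n, whereas
  its scale changes only by the relative change of A, at no cost in n.\<close>

lemma nn_integral_dmu_diff:
  assumes A: "A > 0" "A' > 0"
  shows "(\<integral>\<^sup>+\<mu>. ennreal \<bar>dmu A \<theta> \<mu> - dmu A' \<theta>' \<mu>\<bar> \<partial>lborel)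
     \<le> ennreal (3 * (\<bar>A - A'\<bar> / (A + A') + sqrt (real n) * \<bar>vmean n \<theta> - vmean n \<theta>'\<bar> / (2 * sqrt (A + A'))))"
proof -
  define s t where "s = sqrt (A / real n)" and "t = sqrt (A' / real n)"
  have st: "s > 0" "t > 0" using A n by (auto simp: s_def t_def)
  have st2: "s\<^sup>2 + t\<^sup>2 = (A + A') / real n" using A by (simp add: s_def t_def add_divide_distrib)
  let ?m = "vmean n \<theta> - vmean n \<theta>'"
  define k where "k = (s - t)\<^sup>2 / (s\<^sup>2 + t\<^sup>2) + ?m\<^sup>2 / (4 * (s\<^sup>2 + t\<^sup>2))"
  have k0: "0 \<le> k" by (simp add: k_def)
  have aff: "(\<integral>\<^sup>+\<mu>. ennreal (sqrt (dmu A \<theta> \<mu> * dmu A' \<theta>' \<mu>)) \<partial>lborel) \<ge> ennreal (1 - k)"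
    unfolding dmu_def s_def[symmetric] t_def[symmetric] nn_integral_sqrt_normal_density[OF st]
    using normal_affinity_bounds(3)[OF st, of "vmean n \<theta>" "vmean n \<theta>'"] by (intro ennreal_leI) (simp add: k_def)
  have "(\<integral>\<^sup>+\<mu>. ennreal \<bar>dmu A \<theta> \<mu> - dmu A' \<theta>' \<mu>\<bar> \<partial>lborel) \<le> ennreal (3 * sqrt k)"
    by (rule nn_integral_abs_diff_le_affinity[OF _ _ _ _ _ _ aff k0]) (use A n in \<open>auto simp: dmu_def nn_integral_normal_density\<close>)
  also have "\<dots> \<le> ennreal (3 * (\<bar>A - A'\<bar> / (A + A') + sqrt (real n) * \<bar>?m\<bar> / (2 * sqrt (A + A'))))"
  proof (intro ennreal_leI mult_left_mono)
    have 1: "(s - t)\<^sup>2 / (s\<^sup>2 + t\<^sup>2) \<le> (\<bar>A - A'\<bar> / (A + A'))\<^sup>2"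
    proof -
      have "(A / real n - A' / real n) / (A / real n + A' / real n) = (A - A') / (A + A')"
        using n by (simp flip: add_divide_distrib diff_divide_distrib)
      then show ?thesis using sqrt_diff_sq_le[of "A / real n" "A' / real n"] A n by (simp add: s_def t_def power_divide)
    qed
    have 2: "?m\<^sup>2 / (4 * (s\<^sup>2 + t\<^sup>2)) = (sqrt (real n) * \<bar>?m\<bar> / (2 * sqrt (A + A')))\<^sup>2"
      unfolding st2 using A by (simp add: power_mult_distrib power_divide)
    have "sqrt k \<le> sqrt ((\<bar>A - A'\<bar> / (A + A'))\<^sup>2) + sqrt ((sqrt (real n) * \<bar>?m\<bar> / (2 * sqrt (A + A')))\<^sup>2)"
      unfolding k_def 2 by (rule order_trans[OF _ sqrt_add_le_add_sqrt]) (use 1 in auto)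
    then show "sqrt k \<le> \<bar>A - A'\<bar> / (A + A') + sqrt (real n) * \<bar>?m\<bar> / (2 * sqrt (A + A'))"
      using A by simp
  qed simp
  finally show ?thesis .
qed

text \<open>Both sides share the same mu. The affinity defects of the n coordinates add up to
  \<open>k\<close>, of order n (A - A')^2, so the distance is of order sqrt n |A - A'|. Since the
  squared deviations of the data from mu sum to Delta + n (mu - Yb)^2, the bound still grows with
  mu.\<close>

lemma nn_integral_dth_diff:
  fixes \<mu> :: real
  assumes A: "A > 0" "A' > 0"
  defines "k \<equiv> real n * ((alpha A - alpha A') / (alpha A + alpha A'))\<^sup>2
     + (alpha A - alpha A')\<^sup>2 * (\<Delta> + real n * (\<mu> - Yb)\<^sup>2) / (4 * V * (alpha A + alpha A'))"
  shows "(\<integral>\<^sup>+\<theta>. ennreal \<bar>dth A \<mu> \<theta> - dth A' \<mu> \<theta>\<bar> \<partial>Lam) \<le> ennreal (3 * sqrt k)"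
proof -
  interpret product_sigma_finite "\<lambda>_. lborel :: real measure" by (simp add: product_sigma_finite_def sigma_finite_lborel)
  define s t where "s = cs A" and "t = cs A'"
  have al: "alpha A > 0" "alpha A' > 0" using A alpha_pos by auto
  have st: "s > 0" "t > 0" using A cs_pos by (auto simp: s_def t_def)
  have st2: "s\<^sup>2 + t\<^sup>2 = V * (alpha A + alpha A')" using A V al by (simp add: s_def t_def cs_alpha distrib_left)
  define r where "r = (\<lambda>i. sqrt (2 * s * t / (s\<^sup>2 + t\<^sup>2)) * exp (- (cm A \<mu> i - cm A' \<mu> i)\<^sup>2 / (4 * (s\<^sup>2 + t\<^sup>2))))"
  have k0: "0 \<le> k" using V al Delta_nonneg by (simp add: k_def)
  have "(\<integral>\<^sup>+\<theta>. ennreal (sqrt (dth A \<mu> \<theta> * dth A' \<mu> \<theta>)) \<partial>Lam) =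
     (\<integral>\<^sup>+\<theta>. (\<Prod>i<n. ennreal (sqrt (normal_density (cm A \<mu> i) s (\<theta> i) * normal_density (cm A' \<mu> i) t (\<theta> i)))) \<partial>Lam)"
    unfolding dth_def s_def t_def by (simp add: prod.distrib[symmetric] sqrt_prod prod_ennreal del: real_sqrt_mult)
  also have "\<dots> = (\<Prod>i<n. ennreal (r i))"
    unfolding r_def by (subst product_nn_integral_prod) (auto simp: nn_integral_sqrt_normal_density[OF st] simp del: real_sqrt_mult)
  also have "\<dots> = ennreal (\<Prod>i<n. r i)"
    using normal_affinity_bounds(1)[OF st] by (intro prod_ennreal) (simp add: r_def)
  also have "\<dots> \<ge> ennreal (1 - k)"
  proof (rule ennreal_leI)
    have "(\<Sum>i<n. 1 - r i) \<le> (\<Sum>i<n. (s - t)\<^sup>2 / (s\<^sup>2 + t\<^sup>2) + (cm A \<mu> i - cm A' \<mu> i)\<^sup>2 / (4 * (s\<^sup>2 + t\<^sup>2)))"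
      unfolding r_def by (intro sum_mono normal_affinity_bounds(3)[OF st])
    also have "\<dots> = real n * ((s - t)\<^sup>2 / (s\<^sup>2 + t\<^sup>2)) + (\<Sum>i<n. (cm A \<mu> i - cm A' \<mu> i)\<^sup>2) / (4 * (s\<^sup>2 + t\<^sup>2))"
      by (simp add: sum.distrib sum_divide_distrib)
    also have "(\<Sum>i<n. (cm A \<mu> i - cm A' \<mu> i)\<^sup>2) = (\<Sum>i<n. (alpha A - alpha A')\<^sup>2 * (Y n i - \<mu>)\<^sup>2)"
      using A by (intro sum.cong) (auto simp: cm_alpha power_mult_distrib[symmetric] algebra_simps)
    also have "\<dots> = (alpha A - alpha A')\<^sup>2 * (\<Delta> + real n * (\<mu> - Yb)\<^sup>2)"
      by (simp add: sum_distrib_left[symmetric] sum_dev)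
    also have "real n * ((s - t)\<^sup>2 / (s\<^sup>2 + t\<^sup>2)) \<le> real n * ((alpha A - alpha A') / (alpha A + alpha A'))\<^sup>2"
    proof (rule mult_left_mono)
      have "(V * alpha A - V * alpha A') / (V * alpha A + V * alpha A') = (alpha A - alpha A') / (alpha A + alpha A')"
        using V by (simp flip: distrib_left right_diff_distrib)
      then show "(s - t)\<^sup>2 / (s\<^sup>2 + t\<^sup>2) \<le> ((alpha A - alpha A') / (alpha A + alpha A'))\<^sup>2"
        using sqrt_diff_sq_le[of "V * alpha A" "V * alpha A'"] V al by (simp add: s_def t_def cs_alpha del: real_sqrt_mult)
    qed simp
    finally have "(\<Sum>i<n. 1 - r i) \<le> k" by (simp add: k_def st2 mult.assoc)
    then show "1 - k \<le> (\<Prod>i<n. r i)"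
      using prod_ge_one_minus_sum[of "{..<n}" r] normal_affinity_bounds(1,2)[OF st] by (force simp: r_def)
  qed
  finally have aff: "ennreal (1 - k) \<le> (\<integral>\<^sup>+\<theta>. ennreal (sqrt (dth A \<mu> \<theta> * dth A' \<mu> \<theta>)) \<partial>Lam)" .
  show ?thesis
    by (rule nn_integral_abs_diff_le_affinity[OF _ _ _ _ _ _ aff k0]) (auto simp: nn_integral_dth A)
qed

lemma nn_integral_dmu_dev:
  assumes A: "A > 0"
  shows "(\<integral>\<^sup>+\<mu>. ennreal (dmu A \<theta> \<mu>) * ennreal ((\<mu> - c)\<^sup>2) \<partial>lborel) = ennreal (A / real n + (vmean n \<theta> - c)\<^sup>2)"
proof -
  let ?m = "vmean n \<theta>" let ?s = "sqrt (A / real n)"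
  have s: "?s > 0" "?s\<^sup>2 = A / real n" using A n by auto
  let ?d = "normal_density ?m ?s"
  have 0: "has_bochner_integral lborel ?d 1" using s by (simp add: has_bochner_integral_iff)
  have 1: "has_bochner_integral lborel (\<lambda>x. ?d x * (x - ?m)) 0" using normal_moment_odd[OF s(1), of ?m 0] by simp
  have 2: "has_bochner_integral lborel (\<lambda>x. ?d x * (x - ?m)\<^sup>2) (A / real n)" using normal_moment_even[OF s(1), of ?m 1] s by simp
  have "?d x * (x - c)\<^sup>2 = ?d x * (x - ?m)\<^sup>2 + 2 * (?m - c) * (?d x * (x - ?m)) + (?m - c)\<^sup>2 * ?d x" for x
    by (simp add: power2_eq_square algebra_simps)
  moreover have "has_bochner_integral lborel (\<lambda>x. ?d x * (x - ?m)\<^sup>2 + 2 * (?m - c) * (?d x * (x - ?m)) + (?m - c)\<^sup>2 * ?d x)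
     (A / real n + 2 * (?m - c) * 0 + (?m - c)\<^sup>2 * 1)"
    by (intro has_bochner_integral_add has_bochner_integral_mult_right 0 1 2)
  ultimately have "has_bochner_integral lborel (\<lambda>x. ?d x * (x - c)\<^sup>2) (A / real n + (?m - c)\<^sup>2)" by simp
  then have "(\<integral>\<^sup>+\<mu>. ennreal (?d \<mu> * (\<mu> - c)\<^sup>2) \<partial>lborel) = ennreal (A / real n + (?m - c)\<^sup>2)"
    by (subst nn_integral_eq_integral) (auto simp: has_bochner_integral_iff)
  then show ?thesis by (simp add: dmu_def ennreal_mult'')
qed

text \<open>The last stage of a step, A given theta, is the same kernel for both states and costs
  nothing. The theta stage is compared at a common mu, then the mu stage is changed. The cost of the
  theta stage grows with (mu - Yb)^2 and is averaged over the law of mu started from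
  \<open>x\<close>; there \<open>u\<close> and the bound \<open>hi\<close> enter.\<close>

lemma T_smoothing:
  assumes h[measurable]: "h \<in> borel_measurable S" and h1: "\<And>y. y \<in> space S \<Longrightarrow> h y \<le> 1"
    and x: "x \<in> space S" and y: "y \<in> space S"
    and lo: "0 < lo" "lo \<le> fst x" "lo \<le> fst y" "fst x \<le> hi"
    and u: "\<bar>vmean n (snd (snd x)) - Yb\<bar> \<le> 1"
    and M: "\<Delta> \<le> M * real n"
    and K: "1 / (4 * (alpha lo)\<^sup>2) + (M + 1) / (8 * V * alpha lo) \<le> K\<^sup>2" "0 \<le> K"
  shows "T h x \<le> T h y + ennreal ((3 / (2 * lo) + 3 / (2 * sqrt (2 * lo)) + 3 * K * (2 + hi) / V) * sqrt (real n) *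
     (\<bar>fst x - fst y\<bar> + \<bar>vmean n (snd (snd x)) - vmean n (snd (snd y))\<bar>))"
proof -
  define A A' \<theta> \<theta>' where "A = fst x" and "A' = fst y" and "\<theta> = snd (snd x)" and "\<theta>' = snd (snd y)"
  have A: "A > 0" "A' > 0" "lo \<le> A" "lo \<le> A'" "A \<le> hi" using lo by (auto simp: A_def A'_def)
  interpret L: sigma_finite_measure Lam by (rule sigma_finite_Lam)
  have th[measurable]: "\<theta> \<in> space Lam" "\<theta>' \<in> space Lam" using x y by (auto simp: state_space_def space_pair_measure \<theta>_def \<theta>'_def)
  have al: "alpha lo > 0" "alpha lo \<le> alpha A" "alpha lo \<le> alpha A'"
    using alpha_pos[OF lo(1)] alpha_mono[OF lo(1)] A by auto
  define J where "J = (\<lambda>\<mu> \<theta>. \<integral>\<^sup>+A'. ennreal (dA \<theta> A') * h (A', \<mu>, \<theta>) \<partial>lborel)"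
  define H where "H = (\<lambda>A \<mu>. \<integral>\<^sup>+\<theta>. ennreal (dth A \<mu> \<theta>) * J \<mu> \<theta> \<partial>Lam)"
  have [measurable]: "(\<lambda>p. J (fst p) (snd p)) \<in> borel_measurable (borel \<Otimes>\<^sub>M Lam)" unfolding J_def by measurable
  have [measurable]: "J \<mu> \<in> borel_measurable Lam" for \<mu>
    using measurable_compose[of "\<lambda>\<theta>. (\<mu>, \<theta>)" Lam "borel \<Otimes>\<^sub>M Lam" "\<lambda>p. J (fst p) (snd p)" borel] by simp
  have [measurable]: "H A \<in> borel_measurable borel" for A
    unfolding H_def by measurable
  have sp: "(A', \<mu>, \<theta>) \<in> space S" if "\<theta> \<in> space Lam" for A' \<mu> \<theta> using that by (auto simp: state_space_def space_pair_measure)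
  have J1: "J \<mu> \<theta> \<le> 1" if "\<theta> \<in> space Lam" for \<mu> \<theta>
  proof -
    have "J \<mu> \<theta> \<le> (\<integral>\<^sup>+A'. ennreal (dA \<theta> A') * 1 \<partial>lborel)"
      unfolding J_def using h1 sp[OF that] by (intro nn_integral_mono mult_left_mono) auto
    then show ?thesis by (simp add: nn_integral_dA)
  qed
  have H1: "H A \<mu> \<le> 1" if "A > 0" for A \<mu>
  proof -
    have "H A \<mu> \<le> (\<integral>\<^sup>+\<theta>. ennreal (dth A \<mu> \<theta>) * 1 \<partial>Lam)"
      unfolding H_def using J1 by (intro nn_integral_mono mult_left_mono) auto
    then show ?thesis using that by (simp add: nn_integral_dth)
  qed
  have Tx: "T h x = (\<integral>\<^sup>+\<mu>. ennreal (dmu A \<theta> \<mu>) * H A \<mu> \<partial>lborel)"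
    unfolding T_def H_def J_def A_def \<theta>_def by (rule nn_integral_gibbs_step[OF h x])
  have Ty: "T h y = (\<integral>\<^sup>+\<mu>. ennreal (dmu A' \<theta>' \<mu>) * H A' \<mu> \<partial>lborel)"
    unfolding T_def H_def J_def A'_def \<theta>'_def by (rule nn_integral_gibbs_step[OF h y])
  have "M * real n \<ge> 0" using M Delta_nonneg by linarith
  then have M0: "M \<ge> 0" using n by (simp add: zero_le_mult_iff)
  let ?d = "\<bar>A - A'\<bar>"
  \<comment> \<open>The cost of the theta stage per unit of
    \<open>3 / 2 + (\<mu> - Yb)\<^sup>2 / 2\<close>: linear in the change of A and of order sqrt
    n.\<close>
  define c where "c = 3 * sqrt (real n) * ?d * K / V"
  have c: "0 \<le> c" using K V by (simp add: c_def)
  have HH: "H A \<mu> \<le> H A' \<mu> + ennreal (c * (3 / 2 + (\<mu> - Yb)\<^sup>2 / 2))" for \<mu>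
  proof -
    define k where "k = real n * ((alpha A - alpha A') / (alpha A + alpha A'))\<^sup>2
     + (alpha A - alpha A')\<^sup>2 * (\<Delta> + real n * (\<mu> - Yb)\<^sup>2) / (4 * V * (alpha A + alpha A'))"
    have "H A \<mu> \<le> H A' \<mu> + (\<integral>\<^sup>+\<theta>. ennreal \<bar>dth A \<mu> \<theta> - dth A' \<mu> \<theta>\<bar> \<partial>Lam)"
      unfolding H_def by (rule nn_integral_le_add_abs_diff) (use J1 in auto)
    also have "\<dots> \<le> H A' \<mu> + ennreal (3 * sqrt k)"
      unfolding k_def by (intro add_left_mono nn_integral_dth_diff A)
    also have "3 * sqrt k \<le> c * (3 / 2 + (\<mu> - Yb)\<^sup>2 / 2)"
    proof -
      define e where "e = (alpha A - alpha A')\<^sup>2"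
      define v where "v = (\<mu> - Yb)\<^sup>2"
      have v: "0 \<le> v" and e: "0 \<le> e" by (auto simp: v_def e_def)
      have "e = \<bar>alpha A - alpha A'\<bar>\<^sup>2" by (simp add: e_def)
      also have "\<dots> \<le> (?d / V)\<^sup>2" using alpha_lipschitz[OF A(1,2)] by (intro power_mono) auto
      finally have eb: "e \<le> (?d / V)\<^sup>2" .
      have "((alpha A - alpha A') / (alpha A + alpha A'))\<^sup>2 = e / (alpha A + alpha A')\<^sup>2" by (simp add: e_def power_divide)
      also have "\<dots> \<le> e / (2 * alpha lo)\<^sup>2" using al e by (intro divide_left_mono power_mono mult_pos_pos) auto
      finally have 1: "((alpha A - alpha A') / (alpha A + alpha A'))\<^sup>2 \<le> e * (1 / (4 * (alpha lo)\<^sup>2))" by (simp add: power_mult_distrib)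
      have "e * (\<Delta> + real n * v) / (4 * V * (alpha A + alpha A')) \<le> e * (real n * ((M + 1) * (1 + v))) / (4 * V * (2 * alpha lo))"
      proof (rule frac_le)
        have "\<Delta> + real n * v \<le> real n * (M + v)" using M by (simp add: algebra_simps)
        also have "\<dots> \<le> real n * ((M + 1) * (1 + v))" using M0 v by (intro mult_left_mono) (auto simp: algebra_simps)
        finally show "e * (\<Delta> + real n * v) \<le> e * (real n * ((M + 1) * (1 + v)))" using e by (intro mult_left_mono)
        show "0 \<le> e * (real n * ((M + 1) * (1 + v)))" using e M0 v by simp
        show "0 < 4 * V * (2 * alpha lo)" using V al by simp
        show "4 * V * (2 * alpha lo) \<le> 4 * V * (alpha A + alpha A')" using V al by (intro mult_left_mono) auto
      qed
      also have "\<dots> = e * (real n * ((M + 1) / (8 * V * alpha lo) * (1 + v)))" by (simp add: field_simps)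
      finally have 2: "e * (\<Delta> + real n * v) / (4 * V * (alpha A + alpha A')) \<le> e * (real n * ((M + 1) / (8 * V * alpha lo) * (1 + v)))" .
      have "k \<le> real n * (e * (1 / (4 * (alpha lo)\<^sup>2) * (1 + v))) + e * (real n * ((M + 1) / (8 * V * alpha lo) * (1 + v)))"
        unfolding k_def v_def[symmetric] e_def[symmetric]
      proof (intro add_mono 2 mult_left_mono)
        show "((alpha A - alpha A') / (alpha A + alpha A'))\<^sup>2 \<le> e * (1 / (4 * (alpha lo)\<^sup>2) * (1 + v))"
        proof -
          have "e * (1 / (4 * (alpha lo)\<^sup>2)) * 1 \<le> e * (1 / (4 * (alpha lo)\<^sup>2)) * (1 + v)"
            using e v by (intro mult_left_mono) auto
          then show ?thesis using 1 by (simp only: mult.assoc mult_1_right)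
        qed
      qed auto
      also have "\<dots> = real n * (e * ((1 / (4 * (alpha lo)\<^sup>2) + (M + 1) / (8 * V * alpha lo)) * (1 + v)))"
        by (simp add: algebra_simps)
      also have "\<dots> \<le> real n * ((?d / V)\<^sup>2 * (K\<^sup>2 * (1 + v)))"
        using K e eb v M0 V al by (intro mult_left_mono mult_mono mult_right_mono) auto
      also have "\<dots> = (sqrt (real n) * (?d / V) * K)\<^sup>2 * (1 + v)" by (simp add: power_mult_distrib power_divide)
      finally have "sqrt k \<le> sqrt ((sqrt (real n) * (?d / V) * K)\<^sup>2 * (1 + v))" by (rule real_sqrt_le_mono)
      also have "\<dots> = sqrt (real n) * (?d / V) * K * sqrt (1 + v)" using K V by (simp add: real_sqrt_mult abs_mult)
      \<comment> \<open>The root is linearized by the arithmetic-geometric mean, so that only the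
        second moment of mu is needed.\<close>
      also have "\<dots> \<le> sqrt (real n) * (?d / V) * K * (3 / 2 + v / 2)"
      proof (rule mult_left_mono)
        have "sqrt (1 + v) \<le> (1 + (1 + v)) / 2" using arith_geo_mean_sqrt[of 1 "1 + v"] v by simp
        then show "sqrt (1 + v) \<le> 3 / 2 + v / 2" by simp
      qed (use K V in simp)
      finally show ?thesis by (simp add: c_def v_def)
    qed
    finally show ?thesis using c by (simp add: add_left_mono ennreal_leI)
  qed
  have "T h x \<le> (\<integral>\<^sup>+\<mu>. ennreal (dmu A \<theta> \<mu>) * H A' \<mu> + (ennreal (c * 3 / 2) * ennreal (dmu A \<theta> \<mu>) + ennreal (c / 2) * (ennreal (dmu A \<theta> \<mu>) * ennreal ((\<mu> - Yb)\<^sup>2))) \<partial>lborel)"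
    unfolding Tx
  proof (rule nn_integral_mono)
    fix \<mu>
    have "ennreal (dmu A \<theta> \<mu>) * H A \<mu> \<le> ennreal (dmu A \<theta> \<mu>) * (H A' \<mu> + ennreal (c * (3 / 2 + (\<mu> - Yb)\<^sup>2 / 2)))"
      by (intro mult_left_mono HH) auto
    also have "ennreal (c * (3 / 2 + (\<mu> - Yb)\<^sup>2 / 2)) = ennreal (c * 3 / 2) + ennreal (c / 2) * ennreal ((\<mu> - Yb)\<^sup>2)"
      using c by (simp add: ennreal_mult'[symmetric] ennreal_plus[symmetric] algebra_simps del: ennreal_plus)
    finally show "ennreal (dmu A \<theta> \<mu>) * H A \<mu> \<le> ennreal (dmu A \<theta> \<mu>) * H A' \<mu> + (ennreal (c * 3 / 2) * ennreal (dmu A \<theta> \<mu>) + ennreal (c / 2) * (ennreal (dmu A \<theta> \<mu>) * ennreal ((\<mu> - Yb)\<^sup>2)))"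
      by (simp add: algebra_simps)
  qed
  also have "\<dots> = (\<integral>\<^sup>+\<mu>. ennreal (dmu A \<theta> \<mu>) * H A' \<mu> \<partial>lborel) + (ennreal (c * 3 / 2) + ennreal (c / 2) * ennreal (A / real n + (vmean n \<theta> - Yb)\<^sup>2))"
    using A by (simp add: nn_integral_add nn_integral_cmult nn_integral_dmu nn_integral_dmu_dev)
  also have "ennreal (c * 3 / 2) + ennreal (c / 2) * ennreal (A / real n + (vmean n \<theta> - Yb)\<^sup>2) \<le> ennreal (c * (2 + hi))"
  proof -
    have "(vmean n \<theta> - Yb)\<^sup>2 \<le> 1" using u by (simp add: abs_square_le_1 \<theta>_def)
    moreover have "A / real n \<le> hi" using A n by (smt (verit) divide_le_eq_1 le_divide_eq_1 mult_left_le of_nat_1 of_nat_le_iff one_le_numeral order_trans divide_le_eq mult_le_cancel_left1)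
    ultimately have "c * 3 / 2 + c / 2 * (A / real n + (vmean n \<theta> - Yb)\<^sup>2) \<le> c * 3 / 2 + c / 2 * (hi + 1)"
      using c by (intro add_left_mono mult_left_mono) auto
    also have "\<dots> \<le> c * (2 + hi)" using c A by (simp add: field_simps)
    finally show ?thesis using c A by (simp add: ennreal_mult'[symmetric] ennreal_plus[symmetric] del: ennreal_plus)
  qed
  also have "(\<integral>\<^sup>+\<mu>. ennreal (dmu A \<theta> \<mu>) * H A' \<mu> \<partial>lborel) \<le> T h y + (\<integral>\<^sup>+\<mu>. ennreal \<bar>dmu A \<theta> \<mu> - dmu A' \<theta>' \<mu>\<bar> \<partial>lborel)"
    unfolding Ty by (rule nn_integral_le_add_abs_diff) (use H1 A in auto)
  also have "(\<integral>\<^sup>+\<mu>. ennreal \<bar>dmu A \<theta> \<mu> - dmu A' \<theta>' \<mu>\<bar> \<partial>lborel)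
     \<le> ennreal (3 * (?d / (A + A') + sqrt (real n) * \<bar>vmean n \<theta> - vmean n \<theta>'\<bar> / (2 * sqrt (A + A'))))"
    by (rule nn_integral_dmu_diff[OF A(1,2)])
  finally have main: "T h x \<le> T h y + ennreal (3 * (?d / (A + A') + sqrt (real n) * \<bar>vmean n \<theta> - vmean n \<theta>'\<bar> / (2 * sqrt (A + A')))) + ennreal (c * (2 + hi))"
    by (simp add: add_right_mono add_left_mono)
  let ?e = "\<bar>vmean n \<theta> - vmean n \<theta>'\<bar>"
  have n1: "1 \<le> sqrt (real n)" using n by simp
  have fac: "s * (k * d + k * e) = k * s * (d + e)" for s k d e :: real by (simp add: algebra_simps)
  have 1: "?d / (A + A') \<le> sqrt (real n) * (?d / (2 * lo))"
  proof -
    have "?d / (A + A') \<le> ?d / (2 * lo)" using A lo by (intro divide_left_mono) auto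
    also have "\<dots> \<le> sqrt (real n) * (?d / (2 * lo))" using n1 lo mult_right_mono[OF n1, of "?d / (2 * lo)"] by simp
    finally show ?thesis .
  qed
  have 2: "sqrt (real n) * ?e / (2 * sqrt (A + A')) \<le> sqrt (real n) * ?e / (2 * sqrt (2 * lo))"
    using A lo by (intro divide_left_mono mult_left_mono real_sqrt_le_mono mult_pos_pos) auto
  have "3 * (?d / (A + A') + sqrt (real n) * ?e / (2 * sqrt (A + A'))) + c * (2 + hi)
     \<le> 3 * (sqrt (real n) * (?d / (2 * lo)) + sqrt (real n) * ?e / (2 * sqrt (2 * lo))) + c * (2 + hi)"
    using 1 2 by simp
  also have "\<dots> = sqrt (real n) * ((3 / (2 * lo) + 3 * K * (2 + hi) / V) * ?d + 3 / (2 * sqrt (2 * lo)) * ?e)"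
    by (simp add: c_def algebra_simps)
  also have "\<dots> \<le> sqrt (real n) * ((3 / (2 * lo) + 3 / (2 * sqrt (2 * lo)) + 3 * K * (2 + hi) / V) * ?d + (3 / (2 * lo) + 3 / (2 * sqrt (2 * lo)) + 3 * K * (2 + hi) / V) * ?e)"
  proof -
    have "0 \<le> 3 / (2 * lo)" "0 \<le> 3 * K * (2 + hi) / V" "0 \<le> 3 / (2 * sqrt (2 * lo))" using lo K V A by auto
    then show ?thesis by (intro mult_left_mono add_mono mult_right_mono) auto
  qed
  finally have "3 * (?d / (A + A') + sqrt (real n) * ?e / (2 * sqrt (A + A'))) + c * (2 + hi)
    \<le> (3 / (2 * lo) + 3 / (2 * sqrt (2 * lo)) + 3 * K * (2 + hi) / V) * sqrt (real n) * (?d + ?e)" unfolding fac .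
  then show ?thesis
    using c A unfolding A_def[symmetric] A'_def[symmetric] \<theta>_def[symmetric] \<theta>'_def[symmetric]
    by (intro order_trans[OF main]) (simp add: add.assoc ennreal_plus[symmetric] add_left_mono ennreal_leI del: ennreal_plus)
qed

end

subsection \<open>Common-noise coupling\<close>

text \<open>Jensen's inequality, by integrating |f| <= f^2 / (2 v) + v / 2.\<close>

lemma (in prob_space) nn_integral_abs_le_of_square:
  fixes f :: "'a \<Rightarrow> real"
  assumes [measurable]: "f \<in> borel_measurable M" and v: "v > 0"
    and le: "(\<integral>\<^sup>+x. ennreal ((f x)\<^sup>2) \<partial>M) \<le> ennreal (v\<^sup>2)"
  shows "(\<integral>\<^sup>+x. ennreal \<bar>f x\<bar> \<partial>M) \<le> ennreal v"
proof -
  have "(\<integral>\<^sup>+x. ennreal \<bar>f x\<bar> \<partial>M) \<le> (\<integral>\<^sup>+x. ennreal (1 / (2 * v)) * ennreal ((f x)\<^sup>2) + ennreal (v / 2) \<partial>M)"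
  proof (rule nn_integral_mono)
    fix x
    have "0 \<le> (\<bar>f x\<bar> - v)\<^sup>2 / (2 * v)" using v by simp
    also have "\<dots> = 1 / (2 * v) * (f x)\<^sup>2 + v / 2 - \<bar>f x\<bar>" using v by (simp add: power2_diff field_simps power2_eq_square)
    finally show "ennreal \<bar>f x\<bar> \<le> ennreal (1 / (2 * v)) * ennreal ((f x)\<^sup>2) + ennreal (v / 2)"
      using v by (simp add: ennreal_mult'[symmetric] ennreal_plus[symmetric] ennreal_leI del: ennreal_plus)
  qed
  also have "\<dots> = ennreal (1 / (2 * v)) * (\<integral>\<^sup>+x. ennreal ((f x)\<^sup>2) \<partial>M) + ennreal (v / 2)"
    by (simp add: nn_integral_add nn_integral_cmult emeasure_space_1)
  also have "\<dots> \<le> ennreal (1 / (2 * v)) * ennreal (v\<^sup>2) + ennreal (v / 2)"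
    using le by (intro add_right_mono mult_left_mono) auto
  also have "\<dots> = ennreal v"
    using v by (simp add: ennreal_mult'[symmetric] ennreal_plus[symmetric] power2_eq_square del: ennreal_plus)
  finally show ?thesis .
qed

lemma nn_integral_pair_fst:
  assumes Q: "prob_space N" and [measurable]: "f \<in> borel_measurable M"
  shows "(\<integral>\<^sup>+\<xi>. f (fst \<xi>) \<partial>(M \<Otimes>\<^sub>M N)) = (\<integral>\<^sup>+x. f x \<partial>M)"
proof -
  interpret Q: prob_space N by fact
  have "(\<integral>\<^sup>+\<xi>. f (fst \<xi>) \<partial>(M \<Otimes>\<^sub>M N)) = (\<integral>\<^sup>+x. \<integral>\<^sup>+y. f (fst (x, y)) \<partial>N \<partial>M)"
    by (rule Q.nn_integral_fst[symmetric]) measurable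
  then show ?thesis by (simp add: Q.emeasure_space_1)
qed

lemma nn_integral_pair_snd:
  assumes P: "prob_space M" and Q: "prob_space N" and [measurable]: "f \<in> borel_measurable N"
  shows "(\<integral>\<^sup>+\<xi>. f (snd \<xi>) \<partial>(M \<Otimes>\<^sub>M N)) = (\<integral>\<^sup>+x. f x \<partial>N)"
proof -
  interpret P: prob_space M by fact
  interpret Q: prob_space N by fact
  have "(\<integral>\<^sup>+\<xi>. f (snd \<xi>) \<partial>(M \<Otimes>\<^sub>M N)) = (\<integral>\<^sup>+x. \<integral>\<^sup>+y. f (snd (x, y)) \<partial>N \<partial>M)"
    by (rule Q.nn_integral_fst[symmetric]) measurable
  then show ?thesis by (simp add: P.emeasure_space_1)
qed

lemma nn_integral_pair_times:
  fixes f g :: "_ \<Rightarrow> ennreal"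
  assumes Q: "prob_space N" and [measurable]: "f \<in> borel_measurable M" "g \<in> borel_measurable N"
  shows "(\<integral>\<^sup>+\<xi>. f (fst \<xi>) * g (snd \<xi>) \<partial>(M \<Otimes>\<^sub>M N)) = (\<integral>\<^sup>+x. f x \<partial>M) * (\<integral>\<^sup>+x. g x \<partial>N)"
proof -
  interpret Q: prob_space N by fact
  have "(\<integral>\<^sup>+\<xi>. f (fst \<xi>) * g (snd \<xi>) \<partial>(M \<Otimes>\<^sub>M N)) = (\<integral>\<^sup>+x. \<integral>\<^sup>+y. f (fst (x, y)) * g (snd (x, y)) \<partial>N \<partial>M)"
    by (rule Q.nn_integral_fst[symmetric]) measurable
  then show ?thesis by (simp add: nn_integral_cmult nn_integral_multc)
qed

context gibbs_model
begin

definition Pn :: "(nat \<Rightarrow> real) measure" where "Pn = PiM {..<n} (\<lambda>_. std_normal)"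
definition W :: "real measure" where "W = density lborel (\<lambda>w. ennreal (inv_gamma_density shape 1 w))"
definition noise :: "(real \<times> (nat \<Rightarrow> real) \<times> real) measure" where "noise = std_normal \<Otimes>\<^sub>M (Pn \<Otimes>\<^sub>M W)"

lemma sets_W [simp, measurable_cong]: "sets W = sets borel" and space_W [simp]: "space W = UNIV" by (auto simp: W_def)
lemma sets_Pn [simp, measurable_cong]: "sets Pn = sets Lam" unfolding Pn_def by (intro sets_PiM_cong) auto
lemma space_Pn: "space Pn = space Lam" by (rule sets_eq_imp_space_eq) simp

lemma prob_W: "prob_space W"
  unfolding W_def using shape_pos by (intro prob_spaceI) (auto simp: emeasure_density nn_integral_inv_gamma_density)

lemma prob_Pn: "prob_space Pn"
  unfolding Pn_def by (intro prob_space_PiM prob_space_std_normal)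

lemma prob_PnW: "prob_space (Pn \<Otimes>\<^sub>M W)"
  by (rule prob_space_pair[OF prob_Pn prob_W])

lemma prob_noise: "prob_space noise"
  unfolding noise_def by (rule prob_space_pair[OF prob_space_std_normal prob_PnW])

text \<open>\<open>F x\<close> is one step of the sampler from \<open>x\<close> as a function of noise whose law does not depend on \<open>x\<close>, so that
  running two chains with the same noise couples them.\<close>
definition Fmu :: "real \<times> real \<times> (nat \<Rightarrow> real) \<Rightarrow> real \<Rightarrow> real" where
  "Fmu x z0 = vmean n (snd (snd x)) + sqrt (fst x / real n) * z0"
definition Fth :: "real \<Rightarrow> real \<Rightarrow> (nat \<Rightarrow> real) \<Rightarrow> nat \<Rightarrow> real" where
  "Fth A \<mu> z = (\<lambda>i\<in>{..<n}. cm A \<mu> i + cs A * z i)"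
definition F :: "real \<times> real \<times> (nat \<Rightarrow> real) \<Rightarrow> real \<times> (nat \<Rightarrow> real) \<times> real \<Rightarrow> real \<times> real \<times> (nat \<Rightarrow> real)" where
  "F x \<xi> = (let \<mu> = Fmu x (fst \<xi>); \<theta> = Fth (fst x) \<mu> (fst (snd \<xi>)) in ((b0 + 1/2 * ss \<theta>) * snd (snd \<xi>), \<mu>, \<theta>))"

lemma Fmu_measurable [measurable]: "Fmu x \<in> borel_measurable borel" unfolding Fmu_def[abs_def] by measurable

lemma Fth_measurable [measurable (raw)]:
  assumes [measurable]: "f \<in> borel_measurable M" and g: "g \<in> measurable M Lam"
  shows "(\<lambda>x. Fth A (f x) (g x)) \<in> measurable M Lam"
  unfolding Fth_def
proof (rule measurable_restrict)
  fix i assume "i \<in> {..<n}"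
  from measurable_compose[OF g component_measurable[OF this]] have [measurable]: "(\<lambda>x. g x i) \<in> borel_measurable M" .
  have "(\<lambda>x. cm A (f x) i + cs A * g x i) \<in> borel_measurable M" by measurable
  then show "(\<lambda>x. cm A (f x) i + cs A * g x i) \<in> measurable M lborel" by simp
qed

lemma F_measurable [measurable]: "F x \<in> measurable noise S"
  unfolding F_def[abs_def] Let_def noise_def by measurable

lemma dth_distr:
  assumes A: "A > 0"
  shows "density Lam (\<lambda>\<theta>. ennreal (dth A \<mu> \<theta>)) = distr Pn Lam (Fth A \<mu>)"
proof -
  have "density Lam (\<lambda>\<theta>. ennreal (dth A \<mu> \<theta>)) = PiM {..<n} (\<lambda>i. density lborel (\<lambda>x. ennreal (normal_density (cm A \<mu> i) (cs A) x)))"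
    unfolding dth_def by (rule PiM_density[symmetric]) (auto simp: sigma_finite_lborel)
  also have "\<dots> = distr Pn Lam (Fth A \<mu>)"
    unfolding Pn_def Fth_def[abs_def] by (rule PiM_normal_density_eq_distr[OF cs_pos[OF A]]) simp
  finally show ?thesis .
qed

lemma T_coupling:
  assumes h[measurable]: "h \<in> borel_measurable S" and x: "x \<in> space S" and A: "fst x > 0"
  shows "T h x = (\<integral>\<^sup>+\<xi>. h (F x \<xi>) \<partial>noise)"
proof -
  interpret L: sigma_finite_measure Lam by (rule sigma_finite_Lam)
  interpret W: prob_space W by (rule prob_W)
  interpret PW: prob_space "Pn \<Otimes>\<^sub>M W" by (rule prob_PnW)
  let ?A = "fst x"
  define J where "J = (\<lambda>\<mu> \<theta>. \<integral>\<^sup>+A'. ennreal (dA \<theta> A') * h (A', \<mu>, \<theta>) \<partial>lborel)"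
  have Jm[measurable]: "(\<lambda>p. J (fst p) (snd p)) \<in> borel_measurable (borel \<Otimes>\<^sub>M Lam)" unfolding J_def by measurable
  have J_meas[measurable]: "J \<mu> \<in> borel_measurable Lam" for \<mu>
    using measurable_compose[of "\<lambda>\<theta>. (\<mu>, \<theta>)" Lam "borel \<Otimes>\<^sub>M Lam" "\<lambda>p. J (fst p) (snd p)" borel] by simp
  have J: "J \<mu> \<theta> = (\<integral>\<^sup>+w. h ((b0 + 1/2 * ss \<theta>) * w, \<mu>, \<theta>) \<partial>W)" if [measurable]: "\<theta> \<in> space Lam" for \<mu> \<theta>
  proof -
    have "J \<mu> \<theta> = (\<integral>\<^sup>+w. ennreal (inv_gamma_density shape 1 w) * h ((b0 + 1/2 * ss \<theta>) * w, \<mu>, \<theta>) \<partial>lborel)"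
      unfolding J_def dA_def using shape_pos b0 ss_nonneg[of \<theta>] by (subst nn_integral_inv_gamma_scale) auto
    also have "\<dots> = (\<integral>\<^sup>+w. h ((b0 + 1/2 * ss \<theta>) * w, \<mu>, \<theta>) \<partial>W)"
      unfolding W_def by (subst nn_integral_density) auto
    finally show ?thesis .
  qed
  define H where "H = (\<lambda>\<mu>. \<integral>\<^sup>+\<theta>. ennreal (dth ?A \<mu> \<theta>) * J \<mu> \<theta> \<partial>Lam)"
  have [measurable]: "H \<in> borel_measurable borel" unfolding H_def by measurable
  have Fsp: "Fth ?A \<mu> z \<in> space Lam" for \<mu> z by (auto simp: Fth_def space_PiM)
  have H: "H \<mu> = (\<integral>\<^sup>+z. J \<mu> (Fth ?A \<mu> z) \<partial>Pn)" for \<mu>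
  proof -
    have "H \<mu> = (\<integral>\<^sup>+\<theta>. J \<mu> \<theta> \<partial>density Lam (\<lambda>\<theta>. ennreal (dth ?A \<mu> \<theta>)))"
      unfolding H_def by (subst nn_integral_density) auto
    also have "\<dots> = (\<integral>\<^sup>+z. J \<mu> (Fth ?A \<mu> z) \<partial>Pn)"
      unfolding dth_distr[OF A] by (subst nn_integral_distr) auto
    finally show ?thesis .
  qed
  have "T h x = (\<integral>\<^sup>+\<mu>. ennreal (dmu ?A (snd (snd x)) \<mu>) * H \<mu> \<partial>lborel)"
    unfolding T_def H_def J_def by (rule nn_integral_gibbs_step[OF h x])
  also have "\<dots> = (\<integral>\<^sup>+z. ennreal (std_normal_density z) * H (Fmu x z) \<partial>lborel)"
    unfolding dmu_def Fmu_def using A n by (subst nn_integral_normal_density_standardize) auto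
  also have "\<dots> = (\<integral>\<^sup>+z0. H (Fmu x z0) \<partial>std_normal)"
    unfolding std_normal_def by (subst nn_integral_density) auto
  also have "\<dots> = (\<integral>\<^sup>+z0. \<integral>\<^sup>+z. \<integral>\<^sup>+w. h (F x (z0, z, w)) \<partial>W \<partial>Pn \<partial>std_normal)"
    unfolding H by (simp add: J[OF Fsp] F_def Let_def)
  also have "\<dots> = (\<integral>\<^sup>+z0. \<integral>\<^sup>+q. h (F x (z0, q)) \<partial>(Pn \<Otimes>\<^sub>M W) \<partial>std_normal)"
  proof (rule nn_integral_cong)
    fix z0
    have [measurable]: "(\<lambda>q. h (F x (z0, q))) \<in> borel_measurable (Pn \<Otimes>\<^sub>M W)"
      using measurable_compose[OF _ F_measurable, of "\<lambda>q. (z0, q)"] by (simp add: noise_def)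
    show "(\<integral>\<^sup>+z. \<integral>\<^sup>+w. h (F x (z0, z, w)) \<partial>W \<partial>Pn) = (\<integral>\<^sup>+q. h (F x (z0, q)) \<partial>(Pn \<Otimes>\<^sub>M W))"
      by (rule W.nn_integral_fst) simp
  qed
  also have "\<dots> = (\<integral>\<^sup>+\<xi>. h (F x \<xi>) \<partial>noise)"
    unfolding noise_def by (rule PW.nn_integral_fst) (simp add: noise_def[symmetric])
  finally show ?thesis .
qed

text \<open>The noise enters \<open>F\<close> only through the statistics below, each of which is of order \<open>1 / sqrt n\<close>; on the
  event that all are small the coupled chains stay near the posterior mode.\<close>
definition s0 where "s0 \<xi> = fst \<xi> / sqrt (real n)" for \<xi> :: "real \<times> (nat \<Rightarrow> real) \<times> real"
definition s1 where "s1 \<xi> = (\<Sum>i<n. fst (snd \<xi>) i) / real n" for \<xi> :: "real \<times> (nat \<Rightarrow> real) \<times> real"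
definition s2 where "s2 \<xi> = (\<Sum>i<n. (fst (snd \<xi>) i)\<^sup>2 - 1) / real n" for \<xi> :: "real \<times> (nat \<Rightarrow> real) \<times> real"
definition s3 where "s3 \<xi> = (\<Sum>i<n. (Y n i - Yb) * fst (snd \<xi>) i) / real n" for \<xi> :: "real \<times> (nat \<Rightarrow> real) \<times> real"
definition s4 where "s4 \<xi> = snd (snd \<xi>) * (shape - 1) - 1" for \<xi> :: "real \<times> (nat \<Rightarrow> real) \<times> real"
definition fluct where "fluct \<xi> = (s0 \<xi>)\<^sup>2 + (s1 \<xi>)\<^sup>2 + (s2 \<xi>)\<^sup>2 + (s3 \<xi>)\<^sup>2 + (s4 \<xi>)\<^sup>2"

lemma one_plus_s2: "1 + s2 \<xi> = (\<Sum>i<n. (fst (snd \<xi>) i)\<^sup>2) / real n"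
  using n by (simp add: s2_def sum_subtractf diff_divide_distrib)

lemma vmean_Fth:
  assumes A: "A > 0"
  shows "vmean n (Fth A \<mu> z) = (1 - alpha A) * \<mu> + alpha A * Yb + cs A * ((\<Sum>i<n. z i) / real n)"
proof -
  have s: "(\<Sum>i<n. Y n i) = real n * Yb" using n by (simp add: Ybar_def)
  have "(\<Sum>i<n. Fth A \<mu> z i) = (\<Sum>i<n. (1 - alpha A) * \<mu> + alpha A * Y n i + cs A * z i)"
    using A by (intro sum.cong) (auto simp: Fth_def cm_alpha algebra_simps)
  also have "\<dots> = real n * ((1 - alpha A) * \<mu>) + alpha A * (real n * Yb) + cs A * (\<Sum>i<n. z i)"
    by (simp add: sum.distrib sum_distrib_left[symmetric] s)
  finally show ?thesis unfolding vmean_def using n by (simp add: add_divide_distrib)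
qed

lemma vmean_F:
  assumes A: "fst x > 0"
  shows "vmean n (snd (snd (F x \<xi>))) - Yb = (1 - alpha (fst x)) * (vmean n (snd (snd x)) - Yb)
     + (1 - alpha (fst x)) * sqrt (fst x) * s0 \<xi> + cs (fst x) * s1 \<xi>"
proof -
  have "Fmu x (fst \<xi>) = vmean n (snd (snd x)) + sqrt (fst x) * s0 \<xi>"
    using n by (simp add: Fmu_def s0_def real_sqrt_divide)
  then show ?thesis by (simp add: F_def Let_def vmean_Fth[OF A] s1_def algebra_simps)
qed

text \<open>The centred coordinate of the new theta is alpha (Y_i - Yb) + cs (z_i - s1): mu is
  common to all coordinates and drops out. Hence the next A depends on the old state through A
  alone, which makes the coupled recursion triangular.\<close>

lemma ss_F:
  assumes A: "fst x > 0"
  shows "ss (snd (snd (F x \<xi>))) = (alpha (fst x))\<^sup>2 * \<Delta> + 2 * alpha (fst x) * cs (fst x) * (real n * s3 \<xi>)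
    + (cs (fst x))\<^sup>2 * (real n * (1 + s2 \<xi> - (s1 \<xi>)\<^sup>2))"
proof -
  let ?A = "fst x" let ?\<mu> = "Fmu x (fst \<xi>)" let ?z = "fst (snd \<xi>)" let ?al = "alpha ?A" let ?c = "cs ?A"
  define m where "m = s1 \<xi>"
  have m: "(\<Sum>i<n. ?z i) = real n * m" using n by (simp add: m_def s1_def)
  have s: "(\<Sum>i<n. Y n i) = real n * Yb" using n by (simp add: Ybar_def)
  have vm: "vmean n (Fth ?A ?\<mu> ?z) = (1 - ?al) * ?\<mu> + ?al * Yb + ?c * m"
    by (simp add: vmean_Fth[OF A] m_def s1_def)
  have "ss (Fth ?A ?\<mu> ?z) = (\<Sum>i<n. (?al * (Y n i - Yb) + ?c * (?z i - m))\<^sup>2)"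
    unfolding ss_def vm using A by (intro sum.cong) (auto simp: Fth_def cm_alpha algebra_simps)
  also have "\<dots> = (\<Sum>i<n. ?al\<^sup>2 * (Y n i - Yb)\<^sup>2 + 2 * ?al * ?c * ((Y n i - Yb) * ?z i) - 2 * ?al * ?c * m * (Y n i - Yb)
     + ?c\<^sup>2 * (?z i)\<^sup>2 - 2 * ?c\<^sup>2 * m * ?z i + ?c\<^sup>2 * m\<^sup>2)"
    by (rule sum.cong) (auto simp: power2_eq_square algebra_simps)
  also have "\<dots> = ?al\<^sup>2 * \<Delta> + 2 * ?al * ?c * (\<Sum>i<n. (Y n i - Yb) * ?z i) - 2 * ?al * ?c * m * (\<Sum>i<n. Y n i - Yb)
     + ?c\<^sup>2 * (\<Sum>i<n. (?z i)\<^sup>2) - 2 * ?c\<^sup>2 * m * (\<Sum>i<n. ?z i) + real n * (?c\<^sup>2 * m\<^sup>2)"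
    by (simp add: sum.distrib sum_subtractf sum_distrib_left[symmetric] Delta_def)
  also have "(\<Sum>i<n. Y n i - Yb) = 0" by (simp add: sum_subtractf s)
  also have "(\<Sum>i<n. (?z i)\<^sup>2) = real n * (1 + s2 \<xi>)" using n by (simp add: one_plus_s2)
  also have "(\<Sum>i<n. (Y n i - Yb) * ?z i) = real n * s3 \<xi>" using n by (simp add: s3_def)
  finally show ?thesis unfolding m by (simp add: F_def Let_def m_def power2_eq_square algebra_simps)
qed

section \<open>Measurability and second moments of the noise statistics\<close>

lemma component_noise: "i < n \<Longrightarrow> (\<lambda>\<xi>. fst (snd \<xi>) i) \<in> borel_measurable noise"
  unfolding noise_def
  using measurable_compose[OF measurable_compose[OF measurable_snd measurable_fst] component_measurable, of i std_normal W]
  by (simp cong: measurable_cong_sets)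

lemma noise_fst_meas [measurable]: "fst \<in> borel_measurable noise" and noise_snd_meas [measurable]: "(\<lambda>\<xi>. snd (snd \<xi>)) \<in> borel_measurable noise"
  unfolding noise_def by measurable

lemma s_measurable [measurable]: "s0 \<in> borel_measurable noise" "s1 \<in> borel_measurable noise" "s2 \<in> borel_measurable noise"
  "s3 \<in> borel_measurable noise" "s4 \<in> borel_measurable noise" "fluct \<in> borel_measurable noise"
proof -
  show [measurable]: "s0 \<in> borel_measurable noise" "s1 \<in> borel_measurable noise" "s2 \<in> borel_measurable noise"
  "s3 \<in> borel_measurable noise" "s4 \<in> borel_measurable noise"
    unfolding s0_def[abs_def] s1_def[abs_def] s2_def[abs_def] s3_def[abs_def] s4_def[abs_def]
    by (auto intro!: borel_measurable_divide borel_measurable_sum borel_measurable_diff borel_measurable_power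
          borel_measurable_times component_noise noise_fst_meas noise_snd_meas)
  show "fluct \<in> borel_measurable noise" unfolding fluct_def[abs_def] by measurable
qed

lemma nn_integral_noise_0: "f \<in> borel_measurable borel \<Longrightarrow> (\<integral>\<^sup>+\<xi>. f (fst \<xi>) \<partial>noise) = (\<integral>\<^sup>+z. f z \<partial>std_normal)"
  unfolding noise_def by (rule nn_integral_pair_fst[OF prob_PnW]) simp

lemma nn_integral_noise_times:
  fixes f :: "(nat \<Rightarrow> real) \<Rightarrow> ennreal" and g :: "real \<Rightarrow> ennreal"
  assumes [measurable]: "f \<in> borel_measurable Lam" "g \<in> borel_measurable borel"
  shows "(\<integral>\<^sup>+\<xi>. f (fst (snd \<xi>)) * g (snd (snd \<xi>)) \<partial>noise) = (\<integral>\<^sup>+z. f z \<partial>Pn) * (\<integral>\<^sup>+w. g w \<partial>W)"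
  unfolding noise_def
  by (subst nn_integral_pair_snd[OF prob_space_std_normal prob_PnW, where f="\<lambda>p. f (fst p) * g (snd p)"])
     (auto simp: nn_integral_pair_times[OF prob_W])

lemma nn_integral_noise_1: "f \<in> borel_measurable Lam \<Longrightarrow> (\<integral>\<^sup>+\<xi>. f (fst (snd \<xi>)) \<partial>noise) = (\<integral>\<^sup>+z. f z \<partial>Pn)"
  using nn_integral_noise_times[of f "\<lambda>_. 1"] prob_space.emeasure_space_1[OF prob_W] by simp

lemma nn_integral_noise_2: "f \<in> borel_measurable borel \<Longrightarrow> (\<integral>\<^sup>+\<xi>. f (snd (snd \<xi>)) \<partial>noise) = (\<integral>\<^sup>+z. f z \<partial>W)"
  using nn_integral_noise_times[of "\<lambda>_. 1" f] prob_space.emeasure_space_1[OF prob_Pn] by simp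

lemma nn_integral_Pn_sum_squared:
  fixes g :: "nat \<Rightarrow> real \<Rightarrow> real"
  assumes "\<And>i. i < n \<Longrightarrow> integrable std_normal (g i)" "\<And>i. i < n \<Longrightarrow> (\<integral>x. g i x \<partial>std_normal) = 0"
    "\<And>i. i < n \<Longrightarrow> integrable std_normal (\<lambda>x. (g i x)\<^sup>2)" and [measurable]: "\<And>i. i < n \<Longrightarrow> g i \<in> borel_measurable borel"
  shows "(\<integral>\<^sup>+\<xi>. ennreal (((\<Sum>i<n. g i (fst (snd \<xi>) i)) / real n)\<^sup>2) \<partial>noise) = ennreal ((\<Sum>i<n. \<integral>x. (g i x)\<^sup>2 \<partial>std_normal) / (real n)\<^sup>2)"
proof -
  have [measurable]: "(\<lambda>z. \<Sum>i<n. g i (z i)) \<in> borel_measurable Lam"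
    using component_measurable by (intro borel_measurable_sum) (auto intro!: measurable_compose[OF _ assms(4)])
  have "(\<integral>\<^sup>+\<xi>. ennreal (((\<Sum>i<n. g i (fst (snd \<xi>) i)) / real n)\<^sup>2) \<partial>noise) = (\<integral>\<^sup>+z. ennreal (((\<Sum>i<n. g i (z i)) / real n)\<^sup>2) \<partial>Pn)"
    by (rule nn_integral_noise_1) measurable
  also have "\<dots> = (\<integral>\<^sup>+z. ennreal (1 / (real n)\<^sup>2) * ennreal ((\<Sum>i<n. g i (z i))\<^sup>2) \<partial>Pn)"
    by (simp add: ennreal_mult'[symmetric] power_divide)
  also have "\<dots> = ennreal (1 / (real n)\<^sup>2) * (\<integral>\<^sup>+z. ennreal ((\<Sum>i<n. g i (z i))\<^sup>2) \<partial>Pn)"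
    by (rule nn_integral_cmult) measurable
  also have "(\<integral>\<^sup>+z. ennreal ((\<Sum>i<n. g i (z i))\<^sup>2) \<partial>Pn) = ennreal (\<Sum>i<n. \<integral>x. (g i x)\<^sup>2 \<partial>std_normal)"
    unfolding Pn_def by (rule nn_integral_PiM_sum_squared[OF prob_space_std_normal]) (use assms in auto)
  finally show ?thesis by (simp add: ennreal_mult'[symmetric])
qed

lemma noise_s0: "(\<integral>\<^sup>+\<xi>. ennreal ((s0 \<xi>)\<^sup>2) \<partial>noise) = ennreal (1 / real n)"
proof -
  have "(\<integral>\<^sup>+\<xi>. ennreal ((s0 \<xi>)\<^sup>2) \<partial>noise) = (\<integral>\<^sup>+z. ennreal ((z / sqrt (real n))\<^sup>2) \<partial>std_normal)"
    unfolding s0_def by (rule nn_integral_noise_0) measurable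
  also have "\<dots> = (\<integral>\<^sup>+z. ennreal (1 / real n * z\<^sup>2) \<partial>std_normal)"
    by (simp add: power_divide)
  also have "\<dots> = ennreal (1 / real n)"
    by (subst nn_integral_eq_integral) (auto simp: std_normal_moments)
  finally show ?thesis .
qed

lemma noise_s1: "(\<integral>\<^sup>+\<xi>. ennreal ((s1 \<xi>)\<^sup>2) \<partial>noise) = ennreal (1 / real n)"
proof -
  have "(\<integral>\<^sup>+\<xi>. ennreal ((s1 \<xi>)\<^sup>2) \<partial>noise) = ennreal ((\<Sum>i<n. \<integral>z. z\<^sup>2 \<partial>std_normal) / (real n)\<^sup>2)"
    unfolding s1_def by (rule nn_integral_Pn_sum_squared) (simp_all add: std_normal_moments)
  then show ?thesis unfolding std_normal_moments(4) by (simp add: power2_eq_square[of "real n"])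
qed

lemma noise_s2: "(\<integral>\<^sup>+\<xi>. ennreal ((s2 \<xi>)\<^sup>2) \<partial>noise) = ennreal (2 / real n)"
proof -
  interpret prob_space std_normal by (rule prob_space_std_normal)
  have "(\<integral>\<^sup>+\<xi>. ennreal ((s2 \<xi>)\<^sup>2) \<partial>noise) = ennreal ((\<Sum>i<n. \<integral>z. (z\<^sup>2 - 1)\<^sup>2 \<partial>std_normal) / (real n)\<^sup>2)"
    unfolding s2_def by (rule nn_integral_Pn_sum_squared) (simp_all add: std_normal_moments prob_space[simplified])
  then show ?thesis unfolding std_normal_moments(6) by (simp add: power2_eq_square[of "real n"])
qed

lemma noise_s3: "(\<integral>\<^sup>+\<xi>. ennreal ((s3 \<xi>)\<^sup>2) \<partial>noise) = ennreal (\<Delta> / (real n)\<^sup>2)"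
proof -
  have "(\<integral>\<^sup>+\<xi>. ennreal ((s3 \<xi>)\<^sup>2) \<partial>noise) = ennreal ((\<Sum>i<n. \<integral>z. ((Y n i - Yb) * z)\<^sup>2 \<partial>std_normal) / (real n)\<^sup>2)"
    unfolding s3_def by (rule nn_integral_Pn_sum_squared) (simp_all add: std_normal_moments power_mult_distrib)
  then show ?thesis by (simp add: std_normal_moments power_mult_distrib Delta_def)
qed

lemma noise_s4: assumes "shape > 2" shows "(\<integral>\<^sup>+\<xi>. ennreal ((s4 \<xi>)\<^sup>2) \<partial>noise) = ennreal (1 / (shape - 2))"
proof -
  have "(\<integral>\<^sup>+\<xi>. ennreal ((s4 \<xi>)\<^sup>2) \<partial>noise) = (\<integral>\<^sup>+w. ennreal ((w * (shape - 1) - 1)\<^sup>2) \<partial>W)"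
    unfolding s4_def by (rule nn_integral_noise_2) measurable
  also have "\<dots> = (\<integral>\<^sup>+w. ennreal ((shape - 1)\<^sup>2) * ennreal ((w - 1 / (shape - 1))\<^sup>2) \<partial>W)"
    using assms by (intro nn_integral_cong) (simp add: ennreal_mult'[symmetric] power_mult_distrib[symmetric] field_simps)
  also have "\<dots> = ennreal ((shape - 1)\<^sup>2) * (\<integral>\<^sup>+w. ennreal (inv_gamma_density shape 1 w) * ennreal ((w - 1 / (shape - 1))\<^sup>2) \<partial>lborel)"
    unfolding W_def by (simp add: nn_integral_cmult nn_integral_density)
  also have "\<dots> = ennreal (1 / (shape - 2))"
    using assms by (simp add: nn_integral_inv_gamma_variance ennreal_mult'[symmetric] power_divide)
  finally show ?thesis .
qed

lemma noise_w: assumes "shape > 2" shows "(\<integral>\<^sup>+w. ennreal w \<partial>W) = ennreal (1 / (shape - 1))"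
  unfolding W_def using nn_integral_inv_gamma_mean[of shape 1] assms by (subst nn_integral_density) auto

lemma nn_integral_fluct:
  assumes "shape > 2"
  shows "(\<integral>\<^sup>+\<xi>. ennreal (fluct \<xi>) \<partial>noise) = ennreal (4 / real n + \<Delta> / (real n)\<^sup>2 + 1 / (shape - 2))"
proof -
  have "(\<integral>\<^sup>+\<xi>. ennreal (fluct \<xi>) \<partial>noise) = ennreal (1 / real n) + ennreal (1 / real n) + ennreal (2 / real n) + ennreal (\<Delta> / (real n)\<^sup>2) + ennreal (1 / (shape - 2))"
    unfolding fluct_def using noise_s0 noise_s1 noise_s2 noise_s3 noise_s4[OF assms] by (simp add: nn_integral_add)
  then show ?thesis using assms Delta_nonneg by (simp add: ennreal_plus[symmetric] del: ennreal_plus)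
qed

end

subsection \<open>Contraction near the fixed point\<close>

text \<open>The cross term of \<open>ss_F\<close> is proportional to alpha^(3/2), since
  \<open>cs\<close> is the root of V alpha. That power is Lipschitz on the unit interval; the
  constant 2 in place of 3/2 comes from a cheap estimate.\<close>

lemma mult_sqrt_diff_le:
  fixes x y :: real
  assumes "0 < x" "x \<le> 1" "0 < y" "y \<le> 1"
  shows "\<bar>x * sqrt x - y * sqrt y\<bar> \<le> 2 * \<bar>x - y\<bar>"
proof -
  define p q where "p = sqrt x" and "q = sqrt y"
  have pq: "0 < p" "p \<le> 1" "0 < q" "q \<le> 1" "x = p * p" "y = q * q" using assms by (auto simp: p_def q_def)
  have "x * p - y * q = (p - q) * (p * p + p * q + q * q)" unfolding pq by (simp add: algebra_simps)
  then have "\<bar>x * p - y * q\<bar> = \<bar>p - q\<bar> * (p * p + p * q + q * q)" using pq by (simp add: abs_mult)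
  also have "\<dots> \<le> \<bar>p - q\<bar> * (2 * (p + q))"
  proof (rule mult_left_mono)
    have "p * p \<le> p" "q * q \<le> q" "p * q \<le> p" using pq by (simp_all add: mult_left_le)
    from add_mono[OF add_mono[OF this(1,3)] this(2)] pq(1,3) show "p * p + p * q + q * q \<le> 2 * (p + q)" by simp
  qed simp
  also have "\<dots> = 2 * \<bar>(p - q) * (p + q)\<bar>" using pq by (simp add: abs_mult)
  also have "(p - q) * (p + q) = x - y" unfolding pq by (simp add: algebra_simps)
  finally show ?thesis by (simp add: p_def q_def)
qed

lemma sqrt_diff_le:
  fixes x y l :: real
  assumes "0 < l" "l \<le> x" "l \<le> y"
  shows "\<bar>sqrt x - sqrt y\<bar> \<le> \<bar>x - y\<bar> / (2 * sqrt l)"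
proof -
  have "x - y = (sqrt x - sqrt y) * (sqrt x + sqrt y)" using assms by (simp add: algebra_simps)
  then have "\<bar>x - y\<bar> = \<bar>sqrt x - sqrt y\<bar> * (sqrt x + sqrt y)" using assms by (simp add: abs_mult)
  also have "\<dots> \<ge> \<bar>sqrt x - sqrt y\<bar> * (2 * sqrt l)"
    using add_mono[OF real_sqrt_le_mono[OF assms(2)] real_sqrt_le_mono[OF assms(3)]] by (intro mult_left_mono) auto
  finally show ?thesis using assms by (simp add: field_simps)
qed

locale gibbs_regime = gibbs_model +
  fixes \<delta> M :: real
  assumes \<delta>: "\<delta> > 0" and D_lower: "V + \<delta> \<le> Delta Y n / (real n - 1)" and D_upper: "Delta Y n / (real n - 1) \<le> M"
begin

text \<open>\<open>As\<close> is the fixed point of \<open>phi\<close>, which is the large-\<open>n\<close> limit of the mean update of \<open>A\<close>. The radius \<open>eps\<close> keeps the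
  slope of \<open>phi\<close> below \<open>1 - eta\<close>, the weight \<open>wt\<close> lets this gain absorb the influence \<open>Ku\<close> of \<open>A\<close> on the mean of
  \<open>\<theta>\<close>, and noise below \<open>kap\<close> keeps a step inside \<open>G\<close>.\<close>
definition D where "D = \<Delta> / (real n - 1)"
definition As where "As = D - V"
definition lo where "lo = \<delta> / 2"
definition hi where "hi = 2 * M"
definition eps where "eps = \<delta>\<^sup>2 / (16 * M)"
definition eta where "eta = \<delta>\<^sup>2 / (4 * M\<^sup>2)"
definition Ku where "Ku = 1 / V + 1 / (2 * sqrt lo) + sqrt hi / V + 1 / (2 * sqrt V * sqrt (alpha lo))"
definition wt where "wt = eta / (4 * Ku)"
definition rho where "rho = max (1 - eta / 4) (1 - alpha lo)"
definition kap where "kap = min 1 (min (eta * eps / (6 * M + 4 * (1 + 2 * sqrt V + 2 * V))) (alpha lo / (sqrt hi + sqrt V)))"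
definition tau where "tau = real n / (2 * a + real n - 3)"
definition vm :: "real \<times> real \<times> (nat \<Rightarrow> real) \<Rightarrow> real" where "vm x = vmean n (snd (snd x))"
definition dd where "dd x y = \<bar>fst x - fst y\<bar> + wt * \<bar>vm x - vm y\<bar>"
definition G where "G = {x \<in> space S. \<bar>fst x - As\<bar> \<le> eps \<and> \<bar>vm x - Yb\<bar> \<le> 1}"
definition phi where "phi A = (alpha A)\<^sup>2 * D + V * alpha A"

lemma D_bounds: "V + \<delta> \<le> D" "D \<le> M" using D_lower D_upper by (auto simp: D_def)
lemma M_pos: "M > 0" "\<delta> < M" "V < M" "D > 0" using D_bounds \<delta> V by linarith+
lemma As_ge: "As \<ge> \<delta>" using D_bounds by (simp add: As_def)

lemma eps_pos: "eps > 0" using \<delta> M_pos by (simp add: eps_def)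
lemma eps_le: "eps \<le> \<delta> / 16"
proof -
  have "\<delta>\<^sup>2 / (16 * M) \<le> (\<delta> * M) / (16 * M)" using \<delta> M_pos by (intro divide_right_mono) (auto simp: power2_eq_square)
  then show ?thesis using M_pos by (simp add: eps_def)
qed
lemma eta_pos: "eta > 0" using \<delta> M_pos by (simp add: eta_def)
lemma eta_le: "eta \<le> 1 / 4"
proof -
  have "\<delta>\<^sup>2 / (4 * M\<^sup>2) \<le> M\<^sup>2 / (4 * M\<^sup>2)" using \<delta> M_pos by (intro divide_right_mono power_mono) auto
  then show ?thesis using M_pos by (simp add: eta_def)
qed
lemma lo_pos: "lo > 0" using \<delta> by (simp add: lo_def)
lemma alpha_lo_pos: "alpha lo > 0" by (rule alpha_pos[OF lo_pos])
lemma hi_pos: "hi > 0" using M_pos by (simp add: hi_def)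
lemma Ku_pos: "Ku > 0"
  unfolding Ku_def using V lo_pos hi_pos alpha_lo_pos by (intro add_pos_pos divide_pos_pos mult_pos_pos) auto
lemma wt_pos: "wt > 0" using eta_pos Ku_pos by (simp add: wt_def)
lemma rho_bounds: "0 < rho" "rho < 1" "1 - eta / 4 \<le> rho" "1 - alpha lo \<le> rho"
  using eta_pos eta_le alpha_lo_pos by (auto simp: rho_def)
lemma kap_pos: "kap > 0"
proof -
  have "6 * M + 4 * (1 + 2 * sqrt V + 2 * V) > 0" "sqrt hi + sqrt V > 0"
    using M_pos V hi_pos by (auto intro!: add_pos_pos mult_pos_pos)
  then show ?thesis unfolding kap_def using eta_pos eps_pos alpha_lo_pos by auto
qed
lemma kap_le_1: "kap \<le> 1" by (simp add: kap_def)
lemma kap_A: "kap * (6 * M + 4 * (1 + 2 * sqrt V + 2 * V)) \<le> eta * eps"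
proof -
  have p: "6 * M + 4 * (1 + 2 * sqrt V + 2 * V) > 0" using M_pos V by (intro add_pos_pos mult_pos_pos) auto
  have "kap \<le> eta * eps / (6 * M + 4 * (1 + 2 * sqrt V + 2 * V))" by (simp add: kap_def)
  then show ?thesis using p by (simp add: pos_le_divide_eq)
qed
lemma kap_u: "kap * (sqrt hi + sqrt V) \<le> alpha lo"
proof -
  have p: "sqrt hi + sqrt V > 0" using hi_pos V by (intro add_pos_pos) auto
  have "kap \<le> alpha lo / (sqrt hi + sqrt V)" by (simp add: kap_def)
  then show ?thesis using p by (simp add: pos_le_divide_eq)
qed

lemma near_bounds:
  assumes "\<bar>A - As\<bar> \<le> eps"
  shows "A > 0" "lo \<le> A" "A \<le> hi" "alpha lo \<le> alpha A" "V + A \<ge> D - eps" "V + A \<ge> V"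
proof -
  have "As \<le> M - V" using D_bounds by (simp add: As_def)
  then have A: "A \<ge> \<delta> / 2" "A \<le> M - V + \<delta> / 16" using assms As_ge eps_le \<delta> by linarith+
  then show "A > 0" "lo \<le> A" "A \<le> hi" using \<delta> M_pos V by (auto simp: lo_def hi_def)
  then show "alpha lo \<le> alpha A" using alpha_mono[OF lo_pos] by simp
  show "V + A \<ge> D - eps" using assms by (simp add: As_def)
  show "V + A \<ge> V" using A \<delta> by simp

qed

text \<open>The first quantity is the difference quotient of \<open>phi\<close>. At A = A' = As it
  equals V (2 As + V) / D^2 = 1 - (As / D)^2, at most 1 - delta^2 / M^2. \<open>eta\<close> claims a
  quarter of this gain; the rest is room for moving within distance \<open>eps\<close> of the fixed
  point.\<close>

lemma slope_le:
  assumes A: "\<bar>A - As\<bar> \<le> eps" and A': "\<bar>A' - As\<bar> \<le> eps"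
  shows "V / ((V + A) * (V + A')) * ((alpha A + alpha A') * D + V) \<le> 1 - eta"
    "V / ((V + A) * (V + A')) \<le> 1 / V"
proof -
  have De: "D - eps > 0" using eps_le D_bounds V \<delta> by linarith
  have al: "alpha B * D \<le> As + eps" if "\<bar>B - As\<bar> \<le> eps" for B
  proof -
    have "alpha B \<le> alpha (As + eps)" using that near_bounds(1)[OF that] by (intro alpha_mono) auto
    also have "\<dots> = (As + eps) / (D + eps)" by (simp add: alpha_def As_def)
    finally have "alpha B * D \<le> (As + eps) / (D + eps) * D" using M_pos by (intro mult_right_mono) auto
    also have "\<dots> \<le> As + eps"
      using eps_pos M_pos As_ge \<delta> by (simp add: divide_le_eq mult_left_mono)
    finally show ?thesis .
  qed
  have vv: "V * ((alpha A + alpha A') * D + V) \<le> (1 - eta) * (D - eps)\<^sup>2"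
  proof -
    have "V * ((alpha A + alpha A') * D + V) \<le> V * (2 * (As + eps) + V)"
      using V al[OF A] al[OF A'] by (intro mult_left_mono) (auto simp: distrib_right)
    also have "\<dots> = D\<^sup>2 - As\<^sup>2 + 2 * eps * V" by (simp add: As_def power2_eq_square algebra_simps)
    also have "\<dots> \<le> D\<^sup>2 - \<delta>\<^sup>2 + 2 * eps * M"
    proof -
      have "\<delta>\<^sup>2 \<le> As\<^sup>2" using As_ge \<delta> by (intro power_mono) auto
      moreover have "eps * V \<le> eps * M" using eps_pos M_pos by (intro mult_left_mono) auto
      ultimately show ?thesis by linarith
    qed
    \<comment> \<open>Of the gain delta^2, a quarter pays for \<open>eta * D\<^sup>2\<close> and an
      eighth for each of the two \<open>eps\<close> terms; this is the origin of the 16 in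
      \<open>eps\<close>.\<close>
    also have "\<dots> \<le> D\<^sup>2 - eta * D\<^sup>2 - 2 * eps * D"
    proof -
      have "eta * D\<^sup>2 \<le> eta * M\<^sup>2" using eta_pos D_bounds M_pos by (intro mult_left_mono power_mono) auto
      moreover have "eta * M\<^sup>2 = \<delta>\<^sup>2 / 4" using M_pos by (simp add: eta_def)
      moreover have "eps * D \<le> eps * M" using eps_pos D_bounds by (intro mult_left_mono) auto
      moreover have "eps * M = \<delta>\<^sup>2 / 16" using M_pos by (simp add: eps_def)
      moreover have "0 \<le> \<delta>\<^sup>2" by simp
      ultimately show ?thesis by linarith
    qed
    also have "\<dots> \<le> (1 - eta) * (D - eps)\<^sup>2"
    proof -
      have "(1 - eta) * (D - eps)\<^sup>2 - (D\<^sup>2 - eta * D\<^sup>2 - 2 * eps * D) = (1 - eta) * eps\<^sup>2 + 2 * eta * (eps * D)"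
        by (simp add: power2_eq_square algebra_simps)
      moreover have "(1 - eta) * eps\<^sup>2 + 2 * eta * (eps * D) \<ge> 0"
        using eta_pos eta_le eps_pos M_pos by (intro add_nonneg_nonneg mult_nonneg_nonneg) auto
      ultimately show ?thesis by linarith
    qed
    finally show ?thesis .
  qed
  have p: "(D - eps)\<^sup>2 \<le> (V + A) * (V + A')"
    unfolding power2_eq_square using near_bounds(5)[OF A] near_bounds(5)[OF A'] De by (intro mult_mono) auto
  have pos: "0 < (V + A) * (V + A')" using near_bounds(1)[OF A] near_bounds(1)[OF A'] V by simp
  have "V * ((alpha A + alpha A') * D + V) \<le> (1 - eta) * ((V + A) * (V + A'))"
    by (rule order_trans[OF vv mult_left_mono[OF p]]) (use eta_le in auto)
  then show "V / ((V + A) * (V + A')) * ((alpha A + alpha A') * D + V) \<le> 1 - eta"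
    using pos by (simp add: pos_divide_le_eq)
  have "V * V \<le> (V + A) * (V + A')" using near_bounds(6)[OF A] near_bounds(6)[OF A'] V by (intro mult_mono) auto
  then show "V / ((V + A) * (V + A')) \<le> 1 / V" using pos V by (simp add: pos_divide_le_eq field_simps)
qed

lemma phi_As: "phi As = As"
proof -
  have a1: "alpha As = As / D" by (simp add: alpha_def As_def)
  have "phi As = As * (As + V) / D" unfolding phi_def a1 using M_pos by (simp add: power2_eq_square field_simps)
  then show ?thesis using M_pos by (simp add: As_def)
qed

lemma phi_lipschitz:
  assumes A: "\<bar>A - As\<bar> \<le> eps" and A': "\<bar>A' - As\<bar> \<le> eps"
  shows "\<bar>phi A - phi A'\<bar> \<le> (1 - eta) * \<bar>A - A'\<bar>"
proof -
  have p: "A > 0" "A' > 0" using near_bounds(1) A A' by auto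
  have al: "alpha A > 0" "alpha A' > 0" using p alpha_pos by auto
  have "phi A - phi A' = (alpha A - alpha A') * ((alpha A + alpha A') * D + V)"
    by (simp add: phi_def power2_eq_square algebra_simps)
  also have "\<dots> = (V / ((V + A) * (V + A')) * ((alpha A + alpha A') * D + V)) * (A - A')"
    using p by (simp add: alpha_diff)
  finally have e: "\<bar>phi A - phi A'\<bar> = \<bar>V / ((V + A) * (V + A')) * ((alpha A + alpha A') * D + V)\<bar> * \<bar>A - A'\<bar>"
    by (simp only: abs_mult)
  have "0 \<le> V / ((V + A) * (V + A')) * ((alpha A + alpha A') * D + V)" using p V al M_pos by simp
  then show ?thesis unfolding e abs_of_nonneg[OF \<open>0 \<le> V / ((V + A) * (V + A')) * ((alpha A + alpha A') * D + V)\<close>]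
    using slope_le(1)[OF A A'] by (intro mult_right_mono) auto
qed

text \<open>With common noise every term of the difference of \<open>ss\<close> is Lipschitz in
  alpha, so the change of alpha factors out. What multiplies it separates into a function of the
  normals and the inverse gamma variable, which are independent.\<close>

lemma F_diff_A:
  assumes A: "fst x > 0" "fst y > 0"
  shows "\<bar>fst (F x \<xi>) - fst (F y \<xi>)\<bar> \<le> real n / 2 * \<bar>alpha (fst x) - alpha (fst y)\<bar> *
    (((alpha (fst x) + alpha (fst y)) * (\<Delta> / real n) + 4 * sqrt V * \<bar>s3 \<xi>\<bar> + V * (1 + \<bar>s2 \<xi>\<bar>)) * \<bar>snd (snd \<xi>)\<bar>)"
proof -
  define p q where "p = alpha (fst x)" and "q = alpha (fst y)"
  define k where "k = 1 + s2 \<xi> - (s1 \<xi>)\<^sup>2"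
  let ?w = "snd (snd \<xi>)"
  have pq: "0 < p" "p < 1" "0 < q" "q < 1" using A alpha_pos alpha_less by (auto simp: p_def q_def)
  \<comment> \<open>\<open>k\<close> is the empirical variance of the normals, hence nonnegative;
    dropping the square of \<open>s1\<close> gives the upper bound.\<close>
  have k: "0 \<le> k" "k \<le> 1 + \<bar>s2 \<xi>\<bar>"
  proof -
    let ?z = "fst (snd \<xi>)"
    have "0 \<le> (\<Sum>i<n. (?z i - s1 \<xi>)\<^sup>2)" by (rule sum_nonneg) simp
    also have "\<dots> = (\<Sum>i<n. (?z i)\<^sup>2 - 2 * s1 \<xi> * ?z i + (s1 \<xi>)\<^sup>2)" by (rule sum.cong) (auto simp: power2_eq_square algebra_simps)
    also have "\<dots> = (\<Sum>i<n. (?z i)\<^sup>2) - 2 * s1 \<xi> * (\<Sum>i<n. ?z i) + real n * (s1 \<xi>)\<^sup>2"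
      by (simp add: sum.distrib sum_subtractf sum_distrib_left[symmetric])
    also have "(\<Sum>i<n. ?z i) = real n * s1 \<xi>" using n by (simp add: s1_def)
    also have "(\<Sum>i<n. (?z i)\<^sup>2) = real n * (1 + s2 \<xi>)" using n by (simp add: one_plus_s2)
    finally have "0 \<le> real n * k" by (simp add: k_def power2_eq_square algebra_simps)
    then show "0 \<le> k" using n by (simp add: zero_le_mult_iff)
    show "k \<le> 1 + \<bar>s2 \<xi>\<bar>" unfolding k_def using zero_le_power2[of "s1 \<xi>"] abs_ge_self[of "s2 \<xi>"] by linarith
  qed
  have c: "cs (fst x) = sqrt V * sqrt p" "cs (fst y) = sqrt V * sqrt q" "(cs (fst x))\<^sup>2 = V * p" "(cs (fst y))\<^sup>2 = V * q"
    using pq V by (auto simp: cs_alpha p_def q_def real_sqrt_mult power_mult_distrib)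
  have d: "ss (snd (snd (F x \<xi>))) - ss (snd (snd (F y \<xi>))) = real n * ((p - q) * ((p + q) * (\<Delta> / real n)) + 2 * sqrt V * s3 \<xi> * (p * sqrt p - q * sqrt q) + (p - q) * (V * k))"
  proof -
    define dn where "dn = \<Delta> / real n"
    have dn: "\<Delta> = real n * dn" using n by (simp add: dn_def)
    show ?thesis
      unfolding ss_F[OF A(1)] ss_F[OF A(2)] c(3,4) k_def[symmetric] dn_def[symmetric] dn
      unfolding p_def[symmetric] q_def[symmetric] c(1,2)
      by (simp add: power2_eq_square algebra_simps)
  qed
  have "\<bar>(p - q) * ((p + q) * (\<Delta> / real n)) + 2 * sqrt V * s3 \<xi> * (p * sqrt p - q * sqrt q) + (p - q) * (V * k)\<bar>
    \<le> \<bar>p - q\<bar> * ((p + q) * (\<Delta> / real n)) + 2 * sqrt V * \<bar>s3 \<xi>\<bar> * (2 * \<bar>p - q\<bar>) + \<bar>p - q\<bar> * (V * (1 + \<bar>s2 \<xi>\<bar>))"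
  proof (rule order_trans[OF abs_triangle_ineq add_mono[OF order_trans[OF abs_triangle_ineq add_mono]]])
    have "0 \<le> (p + q) * (\<Delta> / real n)" using pq Delta_nonneg by simp
    then show "\<bar>(p - q) * ((p + q) * (\<Delta> / real n))\<bar> \<le> \<bar>p - q\<bar> * ((p + q) * (\<Delta> / real n))"
      by (simp only: abs_mult[of "p - q"] abs_of_nonneg)
    have "\<bar>2 * sqrt V * s3 \<xi> * (p * sqrt p - q * sqrt q)\<bar> = 2 * sqrt V * \<bar>s3 \<xi>\<bar> * \<bar>p * sqrt p - q * sqrt q\<bar>"
      using V by (simp add: abs_mult)
    also have "\<dots> \<le> 2 * sqrt V * \<bar>s3 \<xi>\<bar> * (2 * \<bar>p - q\<bar>)"
      using mult_sqrt_diff_le[of p q] pq V by (intro mult_left_mono) auto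
    finally show "\<bar>2 * sqrt V * s3 \<xi> * (p * sqrt p - q * sqrt q)\<bar> \<le> 2 * sqrt V * \<bar>s3 \<xi>\<bar> * (2 * \<bar>p - q\<bar>)" .
    have "\<bar>(p - q) * (V * k)\<bar> = \<bar>p - q\<bar> * (V * k)" using k V by (simp add: abs_mult)
    also have "\<dots> \<le> \<bar>p - q\<bar> * (V * (1 + \<bar>s2 \<xi>\<bar>))" using k V by (intro mult_left_mono) auto
    finally show "\<bar>(p - q) * (V * k)\<bar> \<le> \<bar>p - q\<bar> * (V * (1 + \<bar>s2 \<xi>\<bar>))" .
  qed
  also have "\<dots> = \<bar>p - q\<bar> * ((p + q) * (\<Delta> / real n) + 4 * sqrt V * \<bar>s3 \<xi>\<bar> + V * (1 + \<bar>s2 \<xi>\<bar>))" by (simp add: algebra_simps)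
  finally have b: "\<bar>ss (snd (snd (F x \<xi>))) - ss (snd (snd (F y \<xi>)))\<bar> \<le> real n * (\<bar>p - q\<bar> * ((p + q) * (\<Delta> / real n) + 4 * sqrt V * \<bar>s3 \<xi>\<bar> + V * (1 + \<bar>s2 \<xi>\<bar>)))"
    unfolding d abs_mult[of "real n"] by (simp add: mult_left_mono)
  have "fst (F x \<xi>) - fst (F y \<xi>) = (ss (snd (snd (F x \<xi>))) - ss (snd (snd (F y \<xi>)))) * (1 / 2 * ?w)"
    by (simp add: F_def Let_def algebra_simps)
  then have "\<bar>fst (F x \<xi>) - fst (F y \<xi>)\<bar> = \<bar>ss (snd (snd (F x \<xi>))) - ss (snd (snd (F y \<xi>)))\<bar> * \<bar>1 / 2 * ?w\<bar>"
    by (simp only: abs_mult)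
  also have "\<bar>1 / 2 * ?w\<bar> = 1 / 2 * \<bar>?w\<bar>" by simp
  finally have "\<bar>fst (F x \<xi>) - fst (F y \<xi>)\<bar> = \<bar>ss (snd (snd (F x \<xi>))) - ss (snd (snd (F y \<xi>)))\<bar> * (1 / 2 * \<bar>?w\<bar>)" .
  also have "\<dots> \<le> real n * (\<bar>p - q\<bar> * ((p + q) * (\<Delta> / real n) + 4 * sqrt V * \<bar>s3 \<xi>\<bar> + V * (1 + \<bar>s2 \<xi>\<bar>))) * (1 / 2 * \<bar>?w\<bar>)"
    by (rule mult_right_mono[OF b]) simp
  finally show ?thesis by (simp add: p_def q_def mult_ac)
qed

text \<open>Besides being shrunk, the mean feels a change of A through the coefficients of the old
  deviation and of the noises \<open>s0\<close> and \<open>s1\<close>. The bound on the old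
  deviation contained in \<open>G\<close> makes the first of these effects linear in |A -
  B|.\<close>

lemma F_diff_vm:
  assumes x: "x \<in> G" and y: "y \<in> G"
  shows "\<bar>vm (F x \<xi>) - vm (F y \<xi>)\<bar> \<le> (1 - alpha lo) * \<bar>vm x - vm y\<bar> +
     \<bar>fst x - fst y\<bar> * (1 / V + (1 / (2 * sqrt lo) + sqrt hi / V) * \<bar>s0 \<xi>\<bar> + 1 / (2 * sqrt V * sqrt (alpha lo)) * \<bar>s1 \<xi>\<bar>)"
proof -
  define A B p q u v where "A = fst x" and "B = fst y" and "p = alpha A" and "q = alpha B" and "u = vm x - Yb" and "v = vm y - Yb"
  have nA: "\<bar>A - As\<bar> \<le> eps" "\<bar>B - As\<bar> \<le> eps" and v: "\<bar>v\<bar> \<le> 1"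
    using x y by (auto simp: G_def A_def B_def v_def)
  note bA = near_bounds[OF nA(1)] and bB = near_bounds[OF nA(2)]
  have pq: "p < 1" "q < 1" "alpha lo \<le> p" "alpha lo \<le> q" using bA bB alpha_less by (auto simp: p_def q_def)
  let ?d = "\<bar>A - B\<bar>"
  have dpq: "\<bar>p - q\<bar> \<le> ?d / V" unfolding p_def q_def by (rule alpha_lipschitz[OF bA(1) bB(1)])
  have "vm (F x \<xi>) - vm (F y \<xi>) = (1 - p) * (u - v) + (q - p) * v + ((1 - p) * (sqrt A - sqrt B) + (q - p) * sqrt B) * s0 \<xi> + (cs A - cs B) * s1 \<xi>"
    using vmean_F[of x \<xi>] vmean_F[of y \<xi>] bA(1) bB(1)
    by (simp add: vm_def A_def[symmetric] B_def[symmetric] p_def[symmetric] q_def[symmetric] u_def v_def algebra_simps)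
  then have "\<bar>vm (F x \<xi>) - vm (F y \<xi>)\<bar> \<le> \<bar>(1 - p) * (u - v)\<bar> + \<bar>(q - p) * v\<bar> + \<bar>((1 - p) * (sqrt A - sqrt B) + (q - p) * sqrt B) * s0 \<xi>\<bar> + \<bar>(cs A - cs B) * s1 \<xi>\<bar>"
    by linarith
  also have "\<dots> \<le> (1 - alpha lo) * \<bar>vm x - vm y\<bar> + ?d / V + (?d / (2 * sqrt lo) + ?d / V * sqrt hi) * \<bar>s0 \<xi>\<bar> + ?d / (2 * sqrt V * sqrt (alpha lo)) * \<bar>s1 \<xi>\<bar>"
  proof (intro add_mono)
    have "\<bar>(1 - p) * (u - v)\<bar> = (1 - p) * \<bar>vm x - vm y\<bar>" using pq by (simp add: abs_mult u_def v_def)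
    also have "\<dots> \<le> (1 - alpha lo) * \<bar>vm x - vm y\<bar>" using pq by (intro mult_right_mono) auto
    finally show "\<bar>(1 - p) * (u - v)\<bar> \<le> (1 - alpha lo) * \<bar>vm x - vm y\<bar>" .
    have "\<bar>(q - p) * v\<bar> \<le> \<bar>p - q\<bar> * 1" unfolding abs_mult using v by (intro mult_mono) auto
    then show "\<bar>(q - p) * v\<bar> \<le> ?d / V" using dpq by simp
    have "\<bar>(1 - p) * (sqrt A - sqrt B) + (q - p) * sqrt B\<bar> \<le> \<bar>1 - p\<bar> * \<bar>sqrt A - sqrt B\<bar> + \<bar>q - p\<bar> * sqrt B"
      using bB(1) by (intro order_trans[OF abs_triangle_ineq]) (simp add: abs_mult)
    also have "\<dots> \<le> 1 * (?d / (2 * sqrt lo)) + ?d / V * sqrt hi"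
      using pq dpq bB sqrt_diff_le[OF lo_pos bA(2) bB(2)] V alpha_lo_pos by (intro add_mono mult_mono) auto
    finally show "\<bar>((1 - p) * (sqrt A - sqrt B) + (q - p) * sqrt B) * s0 \<xi>\<bar> \<le> (?d / (2 * sqrt lo) + ?d / V * sqrt hi) * \<bar>s0 \<xi>\<bar>"
      unfolding abs_mult by (intro mult_right_mono) auto
    have "cs A - cs B = sqrt V * (sqrt p - sqrt q)" by (simp add: cs_alpha p_def q_def real_sqrt_mult algebra_simps)
    then have "\<bar>cs A - cs B\<bar> = sqrt V * \<bar>sqrt p - sqrt q\<bar>" using V by (simp add: abs_mult)
    also have "\<dots> \<le> sqrt V * (?d / V / (2 * sqrt (alpha lo)))"
    proof (rule mult_left_mono)
      have "\<bar>sqrt p - sqrt q\<bar> \<le> \<bar>p - q\<bar> / (2 * sqrt (alpha lo))" by (rule sqrt_diff_le[OF alpha_lo_pos pq(3,4)])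
      also have "\<dots> \<le> ?d / V / (2 * sqrt (alpha lo))" using dpq alpha_lo_pos by (intro divide_right_mono) auto
      finally show "\<bar>sqrt p - sqrt q\<bar> \<le> ?d / V / (2 * sqrt (alpha lo))" .
    qed (use V in simp)
    also have "\<dots> = ?d / (2 * sqrt V * sqrt (alpha lo))"
    proof -
      have "sqrt V * (t / V / r) = t / (sqrt V * r)" for t r :: real
      proof -
        have "sqrt V * (t / V / r) = (sqrt V / V) * (t / r)" by simp
        also have "sqrt V / V = inverse (sqrt V)" using V by (simp add: sqrt_divide_self_eq)
        finally show ?thesis by (simp add: field_class.field_divide_inverse mult_ac)
      qed
      from this[of ?d "2 * sqrt (alpha lo)"] show ?thesis by (simp only: mult.left_commute[of "sqrt V"] mult.assoc)
    qed
    finally show "\<bar>(cs A - cs B) * s1 \<xi>\<bar> \<le> ?d / (2 * sqrt V * sqrt (alpha lo)) * \<bar>s1 \<xi>\<bar>"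
      unfolding abs_mult by (intro mult_right_mono) auto
  qed
  also have "\<dots> = (1 - alpha lo) * \<bar>vm x - vm y\<bar> +
     ?d * (1 / V + (1 / (2 * sqrt lo) + sqrt hi / V) * \<bar>s0 \<xi>\<bar> + 1 / (2 * sqrt V * sqrt (alpha lo)) * \<bar>s1 \<xi>\<bar>)"
    by (simp add: distrib_left distrib_right)
  finally show ?thesis by (simp add: A_def B_def)
qed

end

text \<open>How large n has to be. \<open>tau\<close> is n/2 times the mean of the inverse gamma
  noise. \<open>large1\<close> lets the expected noise consume at most half of the contraction gain
  \<open>eta\<close>; \<open>large2\<close> and \<open>large3\<close> keep the deterministic bias of
  the update of A, due to the shape, to \<open>b0\<close> and to n - 1 in place of n, below
  \<open>kap\<close>.\<close>

locale gibbs_regime_large = gibbs_regime +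
  assumes n10: "n \<ge> 10"
    and large1: "tau * (1 - eta + (4 * sqrt V * sqrt (M / real n) + V * sqrt (2 / real n)) / V) \<le> 1 - eta / 2"
    and large2: "\<bar>tau - 1\<bar> \<le> kap" and large3: "(2 * b0 + M) / real n \<le> kap"
begin

lemma shape_gt: "shape > 2" using a n10 by (simp add: shape_def field_simps)

lemma Delta_le: "\<Delta> / real n \<le> D" "\<Delta> = (real n - 1) * D" "\<Delta> \<le> M * real n"
proof -
  show e: "\<Delta> = (real n - 1) * D" using n10 by (simp add: D_def)
  then have "\<Delta> / real n = D - D / real n" using n10 by (simp add: field_simps)
  then show 1: "\<Delta> / real n \<le> D" using M_pos by simp
  then have "\<Delta> / real n \<le> M" using D_bounds by linarith
  then show "\<Delta> \<le> M * real n" using n10 by (simp add: divide_le_eq)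
qed

lemma fluct_le: "(\<integral>\<^sup>+\<xi>. ennreal (fluct \<xi>) \<partial>noise) \<le> ennreal ((8 + M) / real n)"
  unfolding nn_integral_fluct[OF shape_gt]
proof (rule ennreal_leI)
  have "\<Delta> / (real n)\<^sup>2 \<le> M / real n"
    using Delta_le(3) n10 by (simp add: field_simps power2_eq_square)
  moreover have "1 / (shape - 2) \<le> 4 / real n"
    using a n10 by (simp add: shape_def field_simps)
  ultimately show "4 / real n + \<Delta> / (real n)\<^sup>2 + 1 / (shape - 2) \<le> (8 + M) / real n"
    by (simp add: add_divide_distrib)
qed

text \<open>\<open>phi\<close> maps the interval of radius \<open>eps\<close> about
  \<open>As\<close> into the one of radius (1 - eta) eps, so a perturbation up to eta eps is
  harmless. For the mean, shrinkage by at least \<open>alpha lo\<close> leaves that much room for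
  noise. \<open>kap\<close> is chosen to respect both margins.\<close>

lemma F_in_G:
  assumes x: "x \<in> G" and \<xi>: "\<xi> \<in> space noise" and fl: "fluct \<xi> \<le> kap\<^sup>2"
  shows "F x \<xi> \<in> G"
proof -
  define A p c where "A = fst x" and "p = alpha A" and "c = 1 + 2 * sqrt V + 2 * V"
  have nA: "\<bar>A - As\<bar> \<le> eps" and u: "\<bar>vm x - Yb\<bar> \<le> 1" using x by (auto simp: G_def A_def)
  note bA = near_bounds[OF nA]
  have p: "0 < p" "p < 1" "alpha lo \<le> p" using bA alpha_less alpha_pos by (auto simp: p_def)
  have sb: "\<bar>s0 \<xi>\<bar> \<le> kap" "\<bar>s1 \<xi>\<bar> \<le> kap" "\<bar>s2 \<xi>\<bar> \<le> kap" "\<bar>s3 \<xi>\<bar> \<le> kap" "\<bar>s4 \<xi>\<bar> \<le> kap"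
  proof -
    have sq: "\<bar>t\<bar> \<le> kap" if "t\<^sup>2 \<le> kap\<^sup>2" for t using that kap_pos abs_le_square_iff[of t kap] by simp
    have nn: "0 \<le> (s0 \<xi>)\<^sup>2" "0 \<le> (s1 \<xi>)\<^sup>2" "0 \<le> (s2 \<xi>)\<^sup>2" "0 \<le> (s3 \<xi>)\<^sup>2" "0 \<le> (s4 \<xi>)\<^sup>2" by auto
    show "\<bar>s0 \<xi>\<bar> \<le> kap" "\<bar>s1 \<xi>\<bar> \<le> kap" "\<bar>s2 \<xi>\<bar> \<le> kap" "\<bar>s3 \<xi>\<bar> \<le> kap" "\<bar>s4 \<xi>\<bar> \<le> kap"
      by (rule sq; use fl nn in \<open>unfold fluct_def, linarith\<close>)+
  qed
  have csA: "cs A = sqrt V * sqrt p" "(cs A)\<^sup>2 = V * p" using p V by (auto simp: cs_alpha p_def real_sqrt_mult power_mult_distrib)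
  have sp: "0 \<le> sqrt p" "sqrt p \<le> 1" "0 \<le> sqrt V" using p V by auto
  have cs_le: "0 \<le> cs A" "cs A \<le> sqrt V" unfolding csA using sp by (auto simp: mult_left_le)
  show ?thesis unfolding G_def
  proof (intro CollectI conjI)
    show "F x \<xi> \<in> space S" using F_measurable \<xi> by (rule measurable_space)
    have "vm (F x \<xi>) - Yb = (1 - p) * (vm x - Yb) + (1 - p) * sqrt A * s0 \<xi> + cs A * s1 \<xi>"
      using vmean_F[of x \<xi>] bA(1) by (simp add: vm_def A_def p_def)
    then have "\<bar>vm (F x \<xi>) - Yb\<bar> \<le> \<bar>(1 - p) * (vm x - Yb)\<bar> + \<bar>(1 - p) * sqrt A * s0 \<xi>\<bar> + \<bar>cs A * s1 \<xi>\<bar>" by linarith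
    also have "\<dots> \<le> (1 - alpha lo) * 1 + 1 * sqrt hi * kap + sqrt V * kap"
    proof (intro add_mono)
      have "\<bar>(1 - p) * (vm x - Yb)\<bar> = (1 - p) * \<bar>vm x - Yb\<bar>" using p by (simp add: abs_mult)
      also have "\<dots> \<le> (1 - alpha lo) * 1" by (rule mult_mono) (use p u in auto)
      finally show "\<bar>(1 - p) * (vm x - Yb)\<bar> \<le> (1 - alpha lo) * 1" .
      have sA: "0 \<le> sqrt A" "sqrt A \<le> sqrt hi" using bA by auto
      have "\<bar>(1 - p) * sqrt A * s0 \<xi>\<bar> = (1 - p) * sqrt A * \<bar>s0 \<xi>\<bar>" using p sA by (simp add: abs_mult)
      also have "\<dots> \<le> 1 * sqrt hi * kap"
        by (rule mult_mono[OF mult_mono]) (use p sA sb(1) hi_pos in auto)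
      finally show "\<bar>(1 - p) * sqrt A * s0 \<xi>\<bar> \<le> 1 * sqrt hi * kap" .
      have "\<bar>cs A * s1 \<xi>\<bar> = cs A * \<bar>s1 \<xi>\<bar>" using cs_le by (simp add: abs_mult)
      also have "\<dots> \<le> sqrt V * kap" by (rule mult_mono) (use cs_le sb(2) sp in auto)
      finally show "\<bar>cs A * s1 \<xi>\<bar> \<le> sqrt V * kap" .
    qed
    also have "\<dots> \<le> 1" using kap_u by (simp add: algebra_simps)
    finally show "\<bar>vm (F x \<xi>) - Yb\<bar> \<le> 1" .
    define dn bn where "dn = D / real n" and "bn = b0 / real n"
    have n0: "real n > 0" using n10 by simp
    have dn: "D = real n * dn" "b0 = real n * bn" using n0 by (auto simp: dn_def bn_def)
    \<comment> \<open>The new A is \<open>t * (phi A + e)\<close>. Here \<open>e\<close> gathers the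
      normal noise with the biases from \<open>b0\<close> and from Delta = (n - 1) D, and
      \<open>t\<close> is n/2 times the inverse gamma variable, with mean
      \<open>tau\<close>.\<close>
    define e where "e = 2 * bn - p\<^sup>2 * dn + 2 * p * cs A * s3 \<xi> + V * p * (s2 \<xi> - (s1 \<xi>)\<^sup>2)"
    define t where "t = tau * (1 + s4 \<xi>)"
    have ssn: "ss (snd (snd (F x \<xi>))) = real n * (phi A + e - 2 * bn)"
    proof -
      have "ss (snd (snd (F x \<xi>))) = p\<^sup>2 * ((real n - 1) * D) + 2 * p * cs A * (real n * s3 \<xi>) + V * p * (real n * (1 + s2 \<xi> - (s1 \<xi>)\<^sup>2))"
        using ss_F[of x \<xi>] bA(1) unfolding A_def[symmetric] p_def[symmetric] csA(2) Delta_le(2) by blast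
      also have "\<dots> = real n * (phi A + e - 2 * bn)"
        unfolding phi_def e_def p_def[symmetric] dn(1) by (simp add: algebra_simps)
      finally show ?thesis .
    qed
    have w: "snd (snd \<xi>) = (1 + s4 \<xi>) / ((2 * a + real n - 3) / 2)"
    proof -
      have e: "(2 * a + real n - 3) / 2 = shape - 1" by (simp add: shape_def field_simps)
      show ?thesis unfolding e using shape_gt by (simp add: s4_def)
    qed
    have "fst (F x \<xi>) = (b0 + 1 / 2 * ss (snd (snd (F x \<xi>)))) * snd (snd \<xi>)" by (simp add: F_def Let_def)
    also have "\<dots> = t * (phi A + e)"
    proof -
      have sh0: "2 * a + real n - 3 > 0" using a n10 by simp
      have gen: "(N * b + 1 / 2 * (N * (X - 2 * b))) * (s / (r / 2)) = N / r * s * X" if "r > 0" for N b X s r :: real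
        using that by (simp add: field_simps)
      show ?thesis unfolding ssn w t_def tau_def using gen[OF sh0, of "real n" bn "phi A + e" "1 + s4 \<xi>"]
        by (simp only: dn(2)[symmetric])
    qed
    finally have fA: "fst (F x \<xi>) - phi A = (t - 1) * (phi A + e) + e" by (simp add: algebra_simps)
    have c0: "c \<ge> 1" using V by (simp add: c_def)
    have e: "\<bar>e\<bar> \<le> kap * c"
    proof -
      have 1: "\<bar>2 * bn - p\<^sup>2 * dn\<bar> \<le> kap"
      proof -
        have "p\<^sup>2 \<le> 1" using p by (simp add: power_le_one)
        moreover have "0 \<le> dn" "dn \<le> M / real n" using M_pos D_bounds n0 by (auto simp: dn_def divide_right_mono)
        ultimately have "0 \<le> p\<^sup>2 * dn" "p\<^sup>2 * dn \<le> M / real n"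
          using mult_right_mono[of "p\<^sup>2" 1 dn] by auto
        moreover have "2 * bn + M / real n \<le> kap" using large3 by (simp add: add_divide_distrib bn_def)
        moreover have "0 \<le> bn" "0 \<le> M / real n" using b0 M_pos by (auto simp: bn_def)
        ultimately show ?thesis by (simp add: abs_le_iff)
      qed
      have 2: "\<bar>2 * p * cs A * s3 \<xi>\<bar> \<le> 2 * 1 * sqrt V * kap"
        unfolding abs_mult using p cs_le sb V by (intro mult_mono) auto
      have 3: "\<bar>V * p * (s2 \<xi> - (s1 \<xi>)\<^sup>2)\<bar> \<le> V * 1 * (2 * kap)"
      proof -
        have "(s1 \<xi>)\<^sup>2 \<le> kap\<^sup>2" using power_mono[OF sb(2), of 2] by simp
        also have "\<dots> \<le> kap" using kap_le_1 kap_pos by (simp add: power2_eq_square mult_left_le)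
        finally have "(s1 \<xi>)\<^sup>2 \<le> kap" .
        then have "\<bar>s2 \<xi> - (s1 \<xi>)\<^sup>2\<bar> \<le> 2 * kap" using sb(3) zero_le_power2[of "s1 \<xi>"] by linarith
        then show ?thesis unfolding abs_mult using p V by (intro mult_mono) auto
      qed
      have "\<bar>e\<bar> \<le> kap + 2 * 1 * sqrt V * kap + V * 1 * (2 * kap)" unfolding e_def using 1 2 3 by linarith
      then show ?thesis by (simp add: c_def algebra_simps)
    qed
    have ph: "0 \<le> phi A" "phi A \<le> 2 * M"
    proof -
      show "0 \<le> phi A" using p V M_pos by (simp add: phi_def p_def)
      have "p\<^sup>2 * D \<le> 1 * M" using p D_bounds M_pos by (intro mult_mono) (auto simp: power_le_one)
      moreover have "V * p \<le> M * 1" using p V M_pos by (intro mult_mono) auto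
      ultimately show "phi A \<le> 2 * M" by (simp add: phi_def p_def)
    qed
    have t: "\<bar>t - 1\<bar> \<le> 3 * kap"
    proof -
      have ta: "0 \<le> tau" "tau \<le> 2" using large2 kap_le_1 by (auto simp: abs_le_iff)
      have "\<bar>tau * s4 \<xi>\<bar> \<le> 2 * kap" unfolding abs_mult using ta sb by (intro mult_mono) auto
      moreover have "t - 1 = (tau - 1) + tau * s4 \<xi>" by (simp add: t_def algebra_simps)
      ultimately show ?thesis using large2 by linarith
    qed
    have "\<bar>fst (F x \<xi>) - phi A\<bar> \<le> \<bar>t - 1\<bar> * \<bar>phi A + e\<bar> + \<bar>e\<bar>"
      unfolding fA by (rule order_trans[OF abs_triangle_ineq]) (simp add: abs_mult)
    \<comment> \<open>The factor 3 is one \<open>kap\<close> from \<open>tau\<close> itself plus two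
      from \<open>tau * s4\<close>, as \<open>tau\<close> is at most 2. The resulting 6 M + 4 c is
      the denominator in \<open>kap\<close>.\<close>
    also have "\<dots> \<le> 3 * kap * (2 * M + c) + kap * c"
    proof (intro add_mono mult_mono t e)
      have "kap * c \<le> 1 * c" using kap_le_1 c0 by (intro mult_right_mono) auto
      then show "\<bar>phi A + e\<bar> \<le> 2 * M + c" using ph e by linarith
    qed (use kap_pos in auto)
    also have "\<dots> = kap * (6 * M + 4 * c)" by (simp add: algebra_simps)
    also have "\<dots> \<le> eta * eps" unfolding c_def by (rule kap_A)
    finally have 1: "\<bar>fst (F x \<xi>) - phi A\<bar> \<le> eta * eps" .
    have "\<bar>phi A - As\<bar> \<le> (1 - eta) * \<bar>A - As\<bar>" using phi_lipschitz[OF nA, of As] eps_pos by (simp add: phi_As)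
    also have "\<dots> \<le> (1 - eta) * eps" using nA eta_le by (intro mult_left_mono) auto
    finally have 2: "\<bar>phi A - As\<bar> \<le> (1 - eta) * eps" .
    have "eta * eps + (1 - eta) * eps = eps" by (simp add: algebra_simps)
    with 1 2 show "\<bar>fst (F x \<xi>) - As\<bar> \<le> eps" by linarith
  qed
qed

end

lemma ennreal_mult3: "0 \<le> r \<Longrightarrow> 0 \<le> t \<Longrightarrow> 0 \<le> w \<Longrightarrow> ennreal (r * (t * w)) = ennreal r * (ennreal t * ennreal w)"
  by (simp add: ennreal_mult)

section \<open>Expected contraction and its iteration\<close>

context gibbs_regime_large
begin

lemma dd_measurable:
  assumes [measurable]: "f \<in> measurable N S" "g \<in> measurable N S"
  shows "(\<lambda>x. dd (f x) (g x)) \<in> borel_measurable N"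
proof -
  have [measurable]: "vm \<in> borel_measurable S" unfolding vm_def[abs_def] by measurable
  have [measurable]: "fst \<in> borel_measurable S" by measurable
  show ?thesis unfolding dd_def by measurable
qed

lemma nn_integral_s_abs:
  "(\<integral>\<^sup>+\<xi>. ennreal \<bar>s0 \<xi>\<bar> \<partial>noise) \<le> ennreal 1" "(\<integral>\<^sup>+\<xi>. ennreal \<bar>s1 \<xi>\<bar> \<partial>noise) \<le> ennreal 1"
  "(\<integral>\<^sup>+\<xi>. ennreal \<bar>s2 \<xi>\<bar> \<partial>noise) \<le> ennreal (sqrt (2 / real n))" "(\<integral>\<^sup>+\<xi>. ennreal \<bar>s3 \<xi>\<bar> \<partial>noise) \<le> ennreal (sqrt (M / real n))"
proof -
  interpret prob_space noise by (rule prob_noise)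
  have n0: "real n > 0" using n10 by simp
  show "(\<integral>\<^sup>+\<xi>. ennreal \<bar>s0 \<xi>\<bar> \<partial>noise) \<le> ennreal 1"
    by (rule nn_integral_abs_le_of_square) (use n10 in \<open>auto simp: noise_s0 intro!: ennreal_leI\<close>)
  show "(\<integral>\<^sup>+\<xi>. ennreal \<bar>s1 \<xi>\<bar> \<partial>noise) \<le> ennreal 1"
    by (rule nn_integral_abs_le_of_square) (use n10 in \<open>auto simp: noise_s1 intro!: ennreal_leI\<close>)
  show "(\<integral>\<^sup>+\<xi>. ennreal \<bar>s2 \<xi>\<bar> \<partial>noise) \<le> ennreal (sqrt (2 / real n))"
    by (rule nn_integral_abs_le_of_square) (use n0 in \<open>auto simp: noise_s2\<close>)
  show "(\<integral>\<^sup>+\<xi>. ennreal \<bar>s3 \<xi>\<bar> \<partial>noise) \<le> ennreal (sqrt (M / real n))"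
  proof (rule nn_integral_abs_le_of_square)
    have "\<Delta> / (real n)\<^sup>2 \<le> M / real n" using Delta_le(3) n0 by (simp add: field_simps power2_eq_square)
    then show "(\<integral>\<^sup>+\<xi>. ennreal ((s3 \<xi>)\<^sup>2) \<partial>noise) \<le> ennreal ((sqrt (M / real n))\<^sup>2)"
      using M_pos n0 by (simp add: noise_s3 ennreal_leI)
  qed (use M_pos n0 in auto)
qed

text \<open>The normals and the inverse gamma variable are independent, so the expectation factors,
  and n/2 times the mean of the latter is \<open>tau\<close>. Without \<open>s2\<close> and
  \<open>s3\<close> the factor would be tau (1 - eta) by \<open>slope_le\<close>; their expected
  absolute values are of order 1 / sqrt n and are absorbed by \<open>large1\<close>.\<close>

lemma nn_integral_F_diff_A:
  assumes x: "x \<in> G" and y: "y \<in> G"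
  shows "(\<integral>\<^sup>+\<xi>. ennreal \<bar>fst (F x \<xi>) - fst (F y \<xi>)\<bar> \<partial>noise) \<le> ennreal ((1 - eta / 2) * \<bar>fst x - fst y\<bar>)"
proof -
  define p q where "p = alpha (fst x)" and "q = alpha (fst y)"
  have nA: "\<bar>fst x - As\<bar> \<le> eps" "\<bar>fst y - As\<bar> \<le> eps" using x y by (auto simp: G_def)
  note bA = near_bounds[OF nA(1)] and bB = near_bounds[OF nA(2)]
  have pq: "0 < p" "0 < q" using alpha_pos bA(1) bB(1) by (auto simp: p_def q_def)
  have n0: "real n > 0" using n10 by simp
  define c1 where "c1 = (p + q) * (\<Delta> / real n)"
  have c1: "0 \<le> c1" using pq Delta_nonneg by (simp add: c1_def)
  \<comment> \<open>\<open>s2\<close> and \<open>s3\<close> look only at the vector of normals;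
    padding with zeros presents them as functions of that vector, as the factorization
    requires.\<close>
  define f where "f z = ennreal (c1 + V) + ennreal (4 * sqrt V) * ennreal \<bar>s3 (0, z, 0)\<bar> + ennreal V * ennreal \<bar>s2 (0, z, 0)\<bar>" for z
  have s3z: "(\<lambda>z. s3 (0, z, 0)) \<in> borel_measurable Lam" and s2z: "(\<lambda>z. s2 (0, z, 0)) \<in> borel_measurable Lam"
    unfolding s3_def s2_def
    by (auto intro!: borel_measurable_divide borel_measurable_sum borel_measurable_diff borel_measurable_power
          borel_measurable_times component_measurable)
  note [measurable] = s3z s2z
  have fm[measurable]: "f \<in> borel_measurable Lam" unfolding f_def[abs_def] by measurable
  have s3e: "s3 \<xi> = s3 (0, fst (snd \<xi>), 0)" and s2e: "s2 \<xi> = s2 (0, fst (snd \<xi>), 0)" for \<xi> by (auto simp: s3_def s2_def)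
  have If: "(\<integral>\<^sup>+z. f z \<partial>Pn) \<le> ennreal (c1 + V + 4 * sqrt V * sqrt (M / real n) + V * sqrt (2 / real n))"
  proof -
    have "(\<integral>\<^sup>+z. f z \<partial>Pn) = (\<integral>\<^sup>+\<xi>. f (fst (snd \<xi>)) \<partial>noise)" by (rule nn_integral_noise_1[symmetric, OF fm])
    also have "\<dots> = (\<integral>\<^sup>+\<xi>. ennreal (c1 + V) + ennreal (4 * sqrt V) * ennreal \<bar>s3 \<xi>\<bar> + ennreal V * ennreal \<bar>s2 \<xi>\<bar> \<partial>noise)"
      unfolding f_def s3e[symmetric] s2e[symmetric] ..
    also have "\<dots> = ennreal (c1 + V) + ennreal (4 * sqrt V) * (\<integral>\<^sup>+\<xi>. ennreal \<bar>s3 \<xi>\<bar> \<partial>noise) + ennreal V * (\<integral>\<^sup>+\<xi>. ennreal \<bar>s2 \<xi>\<bar> \<partial>noise)"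
      by (simp add: nn_integral_add nn_integral_cmult prob_space.emeasure_space_1[OF prob_noise])
    also have "\<dots> \<le> ennreal (c1 + V) + ennreal (4 * sqrt V) * ennreal (sqrt (M / real n)) + ennreal V * ennreal (sqrt (2 / real n))"
      by (intro add_mono mult_left_mono nn_integral_s_abs order_refl) auto
    also have "\<dots> = ennreal (c1 + V + 4 * sqrt V * sqrt (M / real n) + V * sqrt (2 / real n))"
      using c1 V M_pos n0 by (simp add: ennreal_mult'[symmetric] ennreal_plus[symmetric] del: ennreal_plus real_sqrt_mult)
    finally show ?thesis .
  qed
  have Iw: "(\<integral>\<^sup>+w. ennreal \<bar>w\<bar> \<partial>W) = ennreal (1 / (shape - 1))"
  proof -
    have "(\<integral>\<^sup>+w. ennreal \<bar>w\<bar> \<partial>W) = (\<integral>\<^sup>+w. ennreal w \<partial>W)"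
      unfolding W_def by (subst (1 2) nn_integral_density) (auto intro!: nn_integral_cong simp: inv_gamma_density_def)
    then show ?thesis by (simp add: noise_w shape_gt)
  qed
  let ?r = "real n / 2 * \<bar>p - q\<bar>"
  have "(\<integral>\<^sup>+\<xi>. ennreal \<bar>fst (F x \<xi>) - fst (F y \<xi>)\<bar> \<partial>noise) \<le> (\<integral>\<^sup>+\<xi>. ennreal ?r * (f (fst (snd \<xi>)) * ennreal \<bar>snd (snd \<xi>)\<bar>) \<partial>noise)"
  proof (rule nn_integral_mono)
    fix \<xi>
    have "\<bar>fst (F x \<xi>) - fst (F y \<xi>)\<bar> \<le> ?r * ((c1 + 4 * sqrt V * \<bar>s3 \<xi>\<bar> + V * (1 + \<bar>s2 \<xi>\<bar>)) * \<bar>snd (snd \<xi>)\<bar>)"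
      unfolding p_def q_def c1_def by (rule F_diff_A[OF bA(1) bB(1)])
    also have "\<dots> = ?r * ((c1 + V + 4 * sqrt V * \<bar>s3 \<xi>\<bar> + V * \<bar>s2 \<xi>\<bar>) * \<bar>snd (snd \<xi>)\<bar>)" by (simp add: algebra_simps)
    finally have "ennreal \<bar>fst (F x \<xi>) - fst (F y \<xi>)\<bar> \<le> ennreal (?r * ((c1 + V + 4 * sqrt V * \<bar>s3 \<xi>\<bar> + V * \<bar>s2 \<xi>\<bar>) * \<bar>snd (snd \<xi>)\<bar>))"
      by (rule ennreal_leI)
    also have "\<dots> = ennreal ?r * (f (fst (snd \<xi>)) * ennreal \<bar>snd (snd \<xi>)\<bar>)"
    proof -
      have fz: "f (fst (snd \<xi>)) = ennreal (c1 + V + 4 * sqrt V * \<bar>s3 \<xi>\<bar> + V * \<bar>s2 \<xi>\<bar>)"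
        unfolding f_def s3e[symmetric] s2e[symmetric] using c1 V by (simp add: ennreal_mult)
      show ?thesis unfolding fz by (rule ennreal_mult3) (use c1 V in auto)
    qed
    finally show "ennreal \<bar>fst (F x \<xi>) - fst (F y \<xi>)\<bar> \<le> ennreal ?r * (f (fst (snd \<xi>)) * ennreal \<bar>snd (snd \<xi>)\<bar>)" .
  qed
  also have "\<dots> = ennreal ?r * (\<integral>\<^sup>+\<xi>. f (fst (snd \<xi>)) * ennreal \<bar>snd (snd \<xi>)\<bar> \<partial>noise)"
  proof (rule nn_integral_cmult)
    have 1: "(\<lambda>\<xi>. fst (snd \<xi>)) \<in> measurable noise Lam" unfolding noise_def by measurable
    have [measurable]: "(\<lambda>\<xi>. f (fst (snd \<xi>))) \<in> borel_measurable noise" by (rule measurable_compose[OF 1 fm])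
    show "(\<lambda>\<xi>. f (fst (snd \<xi>)) * ennreal \<bar>snd (snd \<xi>)\<bar>) \<in> borel_measurable noise" by measurable
  qed
  also have "(\<integral>\<^sup>+\<xi>. f (fst (snd \<xi>)) * ennreal \<bar>snd (snd \<xi>)\<bar> \<partial>noise) = (\<integral>\<^sup>+z. f z \<partial>Pn) * (\<integral>\<^sup>+w. ennreal \<bar>w\<bar> \<partial>W)"
    by (rule nn_integral_noise_times) measurable
  also have "ennreal ?r * ((\<integral>\<^sup>+z. f z \<partial>Pn) * (\<integral>\<^sup>+w. ennreal \<bar>w\<bar> \<partial>W)) \<le>
     ennreal ?r * (ennreal (c1 + V + 4 * sqrt V * sqrt (M / real n) + V * sqrt (2 / real n)) * ennreal (1 / (shape - 1)))"
    unfolding Iw by (intro mult_left_mono mult_right_mono If) auto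
  also have "\<dots> = ennreal (?r * ((c1 + V + 4 * sqrt V * sqrt (M / real n) + V * sqrt (2 / real n)) * (1 / (shape - 1))))"
    by (rule ennreal_mult3[symmetric]) (use c1 V M_pos shape_gt in auto)
  also have "\<dots> \<le> ennreal ((1 - eta / 2) * \<bar>fst x - fst y\<bar>)"
  proof (rule ennreal_leI)
    let ?A = "fst x" and ?B = "fst y"
    define s where "s = V / ((V + ?A) * (V + ?B))"
    define c2 where "c2 = 4 * sqrt V * sqrt (M / real n) + V * sqrt (2 / real n)"
    have c2: "0 \<le> c2" using V M_pos by (simp add: c2_def)
    have s: "0 \<le> s" "s \<le> 1 / V" "s * ((p + q) * D + V) \<le> 1 - eta"
      using V bA(1) bB(1) slope_le[OF nA] by (auto simp: s_def p_def q_def)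
    have "p - q = s * (?A - ?B)" using alpha_diff[OF bA(1) bB(1)] by (simp add: p_def q_def s_def)
    then have pqd: "\<bar>p - q\<bar> = s * \<bar>?A - ?B\<bar>" using s by (simp add: abs_mult)
    have sh: "real n / 2 * (1 / (shape - 1)) = tau"
    proof -
      have e: "(2 * a + real n - 3) / 2 = shape - 1" by (simp add: shape_def field_simps)
      show ?thesis unfolding e[symmetric] tau_def by simp
    qed
    have tau0: "0 \<le> tau" using large2 kap_le_1 by (simp add: abs_le_iff)
    have "?r * ((c1 + V + 4 * sqrt V * sqrt (M / real n) + V * sqrt (2 / real n)) * (1 / (shape - 1)))
       = (real n / 2 * (1 / (shape - 1))) * (s * (c1 + V + c2)) * \<bar>?A - ?B\<bar>"
      unfolding pqd c2_def by (simp only: mult_ac add.assoc)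
    also have "\<dots> = tau * (s * (c1 + V + c2)) * \<bar>?A - ?B\<bar>" unfolding sh ..
    also have "\<dots> \<le> (1 - eta / 2) * \<bar>?A - ?B\<bar>"
    proof (rule mult_right_mono)
      have "s * (c1 + V + c2) = s * (c1 + V) + s * c2" by (simp add: algebra_simps)
      also have "\<dots> \<le> s * ((p + q) * D + V) + 1 / V * c2"
        unfolding c1_def using s c2 pq Delta_le(1) by (intro add_mono mult_left_mono mult_right_mono) auto
      also have "\<dots> \<le> 1 - eta + c2 / V" using s by simp
      finally have "tau * (s * (c1 + V + c2)) \<le> tau * (1 - eta + c2 / V)" using tau0 by (rule mult_left_mono)
      also have "\<dots> \<le> 1 - eta / 2" using large1 by (simp add: c2_def)
      finally show "tau * (s * (c1 + V + c2)) \<le> 1 - eta / 2" .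
    qed simp
    finally show "?r * ((c1 + V + 4 * sqrt V * sqrt (M / real n) + V * sqrt (2 / real n)) * (1 / (shape - 1))) \<le> (1 - eta / 2) * \<bar>?A - ?B\<bar>" .
  qed
  finally show ?thesis .
qed

lemma nn_integral_F_diff_vm:
  assumes x: "x \<in> G" and y: "y \<in> G"
  shows "(\<integral>\<^sup>+\<xi>. ennreal \<bar>vm (F x \<xi>) - vm (F y \<xi>)\<bar> \<partial>noise) \<le> ennreal ((1 - alpha lo) * \<bar>vm x - vm y\<bar> + Ku * \<bar>fst x - fst y\<bar>)"
proof -
  let ?d = "\<bar>fst x - fst y\<bar>"
  define k0 where "k0 = (1 - alpha lo) * \<bar>vm x - vm y\<bar> + ?d * (1 / V)"
  define k1 where "k1 = ?d * (1 / (2 * sqrt lo) + sqrt hi / V)"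
  define k2 where "k2 = ?d * (1 / (2 * sqrt V * sqrt (alpha lo)))"
  have k: "0 \<le> k0" "0 \<le> k1" "0 \<le> k2"
    using V lo_pos hi_pos alpha_lo_pos alpha_less[OF lo_pos] by (auto simp: k0_def k1_def k2_def)
  have "(\<integral>\<^sup>+\<xi>. ennreal \<bar>vm (F x \<xi>) - vm (F y \<xi>)\<bar> \<partial>noise) \<le> (\<integral>\<^sup>+\<xi>. ennreal k0 + ennreal k1 * ennreal \<bar>s0 \<xi>\<bar> + ennreal k2 * ennreal \<bar>s1 \<xi>\<bar> \<partial>noise)"
  proof (rule nn_integral_mono)
    fix \<xi>
    have "\<bar>vm (F x \<xi>) - vm (F y \<xi>)\<bar> \<le> k0 + k1 * \<bar>s0 \<xi>\<bar> + k2 * \<bar>s1 \<xi>\<bar>"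
    proof -
      have fac: "w + d * (p + q * s + r * t) = w + d * p + d * q * s + d * r * t" for w d p q r s t :: real by (simp add: algebra_simps)
      show ?thesis using F_diff_vm[OF x y, of \<xi>] by (simp only: k0_def k1_def k2_def fac)
    qed
    then have "ennreal \<bar>vm (F x \<xi>) - vm (F y \<xi>)\<bar> \<le> ennreal (k0 + k1 * \<bar>s0 \<xi>\<bar> + k2 * \<bar>s1 \<xi>\<bar>)" by (rule ennreal_leI)
    also have "\<dots> = ennreal k0 + ennreal k1 * ennreal \<bar>s0 \<xi>\<bar> + ennreal k2 * ennreal \<bar>s1 \<xi>\<bar>"
      using k by (simp add: ennreal_mult)
    finally show "ennreal \<bar>vm (F x \<xi>) - vm (F y \<xi>)\<bar> \<le> ennreal k0 + ennreal k1 * ennreal \<bar>s0 \<xi>\<bar> + ennreal k2 * ennreal \<bar>s1 \<xi>\<bar>" .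
  qed
  also have "\<dots> = ennreal k0 + ennreal k1 * (\<integral>\<^sup>+\<xi>. ennreal \<bar>s0 \<xi>\<bar> \<partial>noise) + ennreal k2 * (\<integral>\<^sup>+\<xi>. ennreal \<bar>s1 \<xi>\<bar> \<partial>noise)"
    by (simp add: nn_integral_add nn_integral_cmult prob_space.emeasure_space_1[OF prob_noise])
  also have "\<dots> \<le> ennreal k0 + ennreal k1 * ennreal 1 + ennreal k2 * ennreal 1"
    by (intro add_mono mult_left_mono nn_integral_s_abs order_refl) auto
  also have "\<dots> = ennreal (k0 + k1 + k2)" using k by simp
  also have "k0 + k1 + k2 = (1 - alpha lo) * \<bar>vm x - vm y\<bar> + Ku * ?d"
    unfolding k0_def k1_def k2_def Ku_def by (simp only: distrib_left distrib_right mult.commute add.assoc)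
  finally show ?thesis .
qed

lemma nn_integral_dd:
  assumes x: "x \<in> G" and y: "y \<in> G"
  shows "(\<integral>\<^sup>+\<xi>. ennreal (dd (F x \<xi>) (F y \<xi>)) \<partial>noise) \<le> ennreal (rho * dd x y)"
proof -
  have [measurable]: "vm \<in> borel_measurable S" unfolding vm_def[abs_def] by measurable
  have [measurable]: "fst \<in> borel_measurable S" by measurable
  let ?dA = "\<bar>fst x - fst y\<bar>" and ?du = "\<bar>vm x - vm y\<bar>"
  have w: "0 \<le> wt" using wt_pos by simp
  have "(\<integral>\<^sup>+\<xi>. ennreal (dd (F x \<xi>) (F y \<xi>)) \<partial>noise) = (\<integral>\<^sup>+\<xi>. ennreal \<bar>fst (F x \<xi>) - fst (F y \<xi>)\<bar> + ennreal wt * ennreal \<bar>vm (F x \<xi>) - vm (F y \<xi>)\<bar> \<partial>noise)"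
    unfolding dd_def using w by (simp add: ennreal_mult)
  also have "\<dots> = (\<integral>\<^sup>+\<xi>. ennreal \<bar>fst (F x \<xi>) - fst (F y \<xi>)\<bar> \<partial>noise) + ennreal wt * (\<integral>\<^sup>+\<xi>. ennreal \<bar>vm (F x \<xi>) - vm (F y \<xi>)\<bar> \<partial>noise)"
    by (subst nn_integral_add) (auto simp: nn_integral_cmult)
  also have "\<dots> \<le> ennreal ((1 - eta / 2) * ?dA) + ennreal wt * ennreal ((1 - alpha lo) * ?du + Ku * ?dA)"
    by (intro add_mono mult_left_mono nn_integral_F_diff_A nn_integral_F_diff_vm x y) auto
  also have "\<dots> = ennreal ((1 - eta / 2) * ?dA + wt * ((1 - alpha lo) * ?du + Ku * ?dA))"
    using w eta_le Ku_pos alpha_less[OF lo_pos] by (simp add: ennreal_mult'[symmetric] ennreal_plus[symmetric] del: ennreal_plus)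
  also have "\<dots> \<le> ennreal (rho * dd x y)"
  proof (rule ennreal_leI)
    \<comment> \<open>Of the gain \<open>eta / 2\<close> in the first coordinate, half pays for its
      influence on the second.\<close>
    have "wt * Ku = eta / 4" using Ku_pos by (simp add: wt_def)
    then have "(1 - eta / 2) * ?dA + wt * ((1 - alpha lo) * ?du + Ku * ?dA) = (1 - eta / 4) * ?dA + (1 - alpha lo) * (wt * ?du)"
      by (simp add: algebra_simps)
    also have "\<dots> \<le> rho * ?dA + rho * (wt * ?du)" using rho_bounds w by (intro add_mono mult_right_mono) auto
    finally show "(1 - eta / 2) * ?dA + wt * ((1 - alpha lo) * ?du + Ku * ?dA) \<le> rho * dd x y" by (simp add: dd_def algebra_simps)
  qed
  finally show ?thesis .
qed

text \<open>Markov's inequality for \<open>fluct\<close> at level \<open>kap\<^sup>2\<close>: the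
  escape probability per step is at most \<open>CB / real n\<close>.\<close>

definition CB where "CB = (8 + M) / kap\<^sup>2"
lemma CB_pos: "CB > 0" using M_pos kap_pos by (simp add: CB_def)

text \<open>The coupling in backward form: a function that is Lipschitz for \<open>dd\<close> on
  \<open>G\<close> up to an error keeps this property with constant multiplied by
  \<open>rho\<close>. If the noise is large, the coupled states may leave \<open>G\<close> and only
  \<open>g \<le> 1\<close> is known, but then 1 is at most \<open>fluct\<close> /
  \<open>kap\<^sup>2\<close>, whose mean is the added error.\<close>

lemma T_contraction:
  assumes g[measurable]: "g \<in> borel_measurable S" and g1: "\<And>z. z \<in> space S \<Longrightarrow> g z \<le> 1"
    and lip: "\<And>z z'. z \<in> G \<Longrightarrow> z' \<in> G \<Longrightarrow> g z \<le> g z' + ennreal (L * dd z z' + e)"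
    and L: "0 \<le> L" and e: "0 \<le> e" and x: "x \<in> G" and y: "y \<in> G"
  shows "T g x \<le> T g y + ennreal (rho * L * dd x y + e + CB / real n)"
proof -
  have sp: "x \<in> space S" "y \<in> space S" and A: "fst x > 0" "fst y > 0" using x y near_bounds(1) by (auto simp: G_def)
  have d0: "0 \<le> dd z z'" for z z' using wt_pos by (simp add: dd_def)
  have [measurable]: "(\<lambda>\<xi>. dd (F x \<xi>) (F y \<xi>)) \<in> borel_measurable noise" by (rule dd_measurable) measurable
  have "T g x = (\<integral>\<^sup>+\<xi>. g (F x \<xi>) \<partial>noise)" by (rule T_coupling[OF g sp(1) A(1)])
  also have "\<dots> \<le> (\<integral>\<^sup>+\<xi>. g (F y \<xi>) + (ennreal L * ennreal (dd (F x \<xi>) (F y \<xi>)) + ennreal e + ennreal (1 / kap\<^sup>2) * ennreal (fluct \<xi>)) \<partial>noise)"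
  proof (rule nn_integral_mono)
    fix \<xi> assume \<xi>: "\<xi> \<in> space noise"
    have f0: "0 \<le> fluct \<xi>" by (simp add: fluct_def)
    show "g (F x \<xi>) \<le> g (F y \<xi>) + (ennreal L * ennreal (dd (F x \<xi>) (F y \<xi>)) + ennreal e + ennreal (1 / kap\<^sup>2) * ennreal (fluct \<xi>))"
    proof (cases "fluct \<xi> \<le> kap\<^sup>2")
      case True
      have "g (F x \<xi>) \<le> g (F y \<xi>) + ennreal (L * dd (F x \<xi>) (F y \<xi>) + e)"
        by (intro lip F_in_G x y \<xi> True)
      also have "ennreal (L * dd (F x \<xi>) (F y \<xi>) + e) = ennreal L * ennreal (dd (F x \<xi>) (F y \<xi>)) + ennreal e"
        using L e d0 by (simp add: ennreal_mult)
      finally show ?thesis by (rule order_trans) (intro add_left_mono, simp)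
    next
      case False
      have "g (F x \<xi>) \<le> ennreal 1" using g1[OF measurable_space[OF F_measurable \<xi>]] by simp
      also have "\<dots> \<le> ennreal (1 / kap\<^sup>2 * fluct \<xi>)" using False kap_pos by (intro ennreal_leI) (simp add: field_simps)
      also have "\<dots> = ennreal (1 / kap\<^sup>2) * ennreal (fluct \<xi>)" using f0 by (intro ennreal_mult) auto
      finally show ?thesis by (rule order_trans) (simp add: add_increasing)
    qed
  qed
  also have "\<dots> = (\<integral>\<^sup>+\<xi>. g (F y \<xi>) \<partial>noise) + (ennreal L * (\<integral>\<^sup>+\<xi>. ennreal (dd (F x \<xi>) (F y \<xi>)) \<partial>noise) + ennreal e + ennreal (1 / kap\<^sup>2) * (\<integral>\<^sup>+\<xi>. ennreal (fluct \<xi>) \<partial>noise))"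
    by (simp add: nn_integral_add nn_integral_cmult prob_space.emeasure_space_1[OF prob_noise])
  also have "\<dots> \<le> (\<integral>\<^sup>+\<xi>. g (F y \<xi>) \<partial>noise) + (ennreal L * ennreal (rho * dd x y) + ennreal e + ennreal (1 / kap\<^sup>2) * ennreal ((8 + M) / real n))"
    by (intro add_mono mult_left_mono nn_integral_dd fluct_le x y order_refl) auto
  also have "(\<integral>\<^sup>+\<xi>. g (F y \<xi>) \<partial>noise) = T g y" by (rule T_coupling[OF g sp(2) A(2), symmetric])
  also have "ennreal L * ennreal (rho * dd x y) + ennreal e + ennreal (1 / kap\<^sup>2) * ennreal ((8 + M) / real n) = ennreal (rho * L * dd x y + e + CB / real n)"
    using L e d0[of x y] rho_bounds M_pos by (simp add: ennreal_mult'[symmetric] CB_def mult_ac)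
  finally show ?thesis .
qed

definition Ksm where "Ksm = (let K = sqrt (1 / (4 * (alpha lo)\<^sup>2) + (M + 1) / (8 * V * alpha lo)) in
   (3 / (2 * lo) + 3 / (2 * sqrt (2 * lo)) + 3 * K * (2 + hi) / V))"
text \<open>The maximum converts the unweighted sum of the two distances into the weighted
  \<open>dd\<close>.\<close>

definition Kd where "Kd = Ksm * max 1 (1 / wt)"

lemma Kd_nonneg: "0 \<le> Ksm" "0 \<le> Kd"
proof -
  show "0 \<le> Ksm" unfolding Ksm_def Let_def using lo_pos V hi_pos M_pos alpha_lo_pos by simp
  then show "0 \<le> Kd" by (simp add: Kd_def)
qed

lemma T_smooth_G:
  assumes h: "h \<in> borel_measurable S" and h1: "\<And>y. y \<in> space S \<Longrightarrow> h y \<le> 1" and x: "x \<in> G" and y: "y \<in> G"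
  shows "T h x \<le> T h y + ennreal (Kd * sqrt (real n) * dd x y)"
proof -
  define K where "K = sqrt (1 / (4 * (alpha lo)\<^sup>2) + (M + 1) / (8 * V * alpha lo))"
  have K: "1 / (4 * (alpha lo)\<^sup>2) + (M + 1) / (8 * V * alpha lo) \<le> K\<^sup>2" "0 \<le> K"
    using V M_pos alpha_lo_pos by (auto simp: K_def)
  have Ke: "3 / (2 * lo) + 3 / (2 * sqrt (2 * lo)) + 3 * K * (2 + hi) / V = Ksm" unfolding Ksm_def Let_def K_def ..
  have sp: "x \<in> space S" "y \<in> space S" and nA: "\<bar>fst x - As\<bar> \<le> eps" "\<bar>fst y - As\<bar> \<le> eps" and u: "\<bar>vmean n (snd (snd x)) - Yb\<bar> \<le> 1"
    using x y by (auto simp: G_def vm_def)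
  have "T h x \<le> T h y + ennreal ((3 / (2 * lo) + 3 / (2 * sqrt (2 * lo)) + 3 * K * (2 + hi) / V) * sqrt (real n) *
     (\<bar>fst x - fst y\<bar> + \<bar>vmean n (snd (snd x)) - vmean n (snd (snd y))\<bar>))"
    using near_bounds(2,3)[OF nA(1)] near_bounds(2)[OF nA(2)]
    by (intro T_smoothing[OF h h1 sp lo_pos _ _ _ u Delta_le(3) K]) auto
  also have "\<dots> \<le> T h y + ennreal (Kd * sqrt (real n) * dd x y)"
  proof (intro add_left_mono ennreal_leI)
    have "\<bar>fst x - fst y\<bar> + \<bar>vm x - vm y\<bar> \<le> max 1 (1 / wt) * dd x y"
    proof -
      have "1 * \<bar>fst x - fst y\<bar> \<le> max 1 (1 / wt) * \<bar>fst x - fst y\<bar>" by (intro mult_right_mono) auto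
      moreover have "1 / wt * (wt * \<bar>vm x - vm y\<bar>) \<le> max 1 (1 / wt) * (wt * \<bar>vm x - vm y\<bar>)" using wt_pos by (intro mult_right_mono) auto
      ultimately show ?thesis using wt_pos by (simp add: dd_def distrib_left)
    qed
    then have "Ksm * sqrt (real n) * (\<bar>fst x - fst y\<bar> + \<bar>vm x - vm y\<bar>) \<le> Ksm * sqrt (real n) * (max 1 (1 / wt) * dd x y)"
      using Kd_nonneg by (intro mult_left_mono) auto
    then show "(3 / (2 * lo) + 3 / (2 * sqrt (2 * lo)) + 3 * K * (2 + hi) / V) * sqrt (real n) *
     (\<bar>fst x - fst y\<bar> + \<bar>vmean n (snd (snd x)) - vmean n (snd (snd y))\<bar>) \<le> Kd * sqrt (real n) * dd x y"
      unfolding Ke by (simp only: Kd_def vm_def mult_ac)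
  qed
  finally show ?thesis .
qed

text \<open>The induction starts with the innermost \<open>T\<close>, the last step of the chain,
  where the factor sqrt n is paid. Each further \<open>T\<close> is an earlier step: it multiplies
  the Lipschitz constant by \<open>rho\<close> and adds one escape probability.\<close>

lemma T_pow_lipschitz:
  assumes h: "h \<in> borel_measurable S" and h1: "\<And>y. y \<in> space S \<Longrightarrow> h y \<le> 1" and x: "x \<in> G" and y: "y \<in> G"
  shows "(T ^^ Suc j) h x \<le> (T ^^ Suc j) h y + ennreal (Kd * sqrt (real n) * rho ^ j * dd x y + real j * (CB / real n))"
  using x y
proof (induction j arbitrary: x y)
  case 0
  then show ?case using T_smooth_G[OF h h1 0] by simp
next
  case (Suc j)
  have "T ((T ^^ Suc j) h) x \<le> T ((T ^^ Suc j) h) y + ennreal (rho * (Kd * sqrt (real n) * rho ^ j) * dd x y + real j * (CB / real n) + CB / real n)"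
  proof (rule T_contraction[OF _ _ _ _ _ Suc.prems])
    show "(T ^^ Suc j) h \<in> borel_measurable S" by (rule T_pow_measurable[OF h])
    show "(T ^^ Suc j) h z \<le> 1" if "z \<in> space S" for z by (rule T_pow_le_one[OF h h1 that])
    show "(T ^^ Suc j) h z \<le> (T ^^ Suc j) h z' + ennreal (Kd * sqrt (real n) * rho ^ j * dd z z' + real j * (CB / real n))"
      if "z \<in> G" "z' \<in> G" for z z' by (rule Suc.IH[OF that])
  qed (use Kd_nonneg rho_bounds CB_pos in auto)
  also have "rho * (Kd * sqrt (real n) * rho ^ j) * dd x y + real j * (CB / real n) + CB / real n = Kd * sqrt (real n) * rho ^ Suc j * dd x y + real (Suc j) * (CB / real n)"
    by (simp add: algebra_simps add_divide_distrib)
  finally show ?case by simp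
qed

end

subsection \<open>Factorizations of the posterior and invariance\<close>

context gibbs_model
begin

abbreviation "pd \<equiv> post_dens V a b0 Y n"

lemma post_dens_measurable [measurable]: "pd \<in> borel_measurable S"
proof -
  have c: "(\<lambda>x. snd (snd x) i) \<in> borel_measurable S" if "i < n" for i
  proof -
    have "(\<lambda>x. snd (snd x)) \<in> measurable S Lam" by measurable
    from measurable_compose[OF this component_measurable] that show ?thesis by simp
  qed
  have 1: "fst \<in> borel_measurable S" "(\<lambda>x. fst (snd x)) \<in> borel_measurable S" by measurable
  note [measurable] = 1
  have [measurable]: "(\<lambda>x. \<Prod>i<n. fst x powr (-1/2) * exp (-(snd (snd x) i - fst (snd x))\<^sup>2 / (2 * fst x)) * exp (-(Y n i - snd (snd x) i)\<^sup>2 / (2 * V))) \<in> borel_measurable S"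
  proof (rule borel_measurable_prod)
    fix i assume "i \<in> {..<n}"
    then have [measurable]: "(\<lambda>x. snd (snd x) i) \<in> borel_measurable S" using c by simp
    show "(\<lambda>x. fst x powr (-1/2) * exp (-(snd (snd x) i - fst (snd x))\<^sup>2 / (2 * fst x)) * exp (-(Y n i - snd (snd x) i)\<^sup>2 / (2 * V))) \<in> borel_measurable S"
      by measurable
  qed
  show ?thesis unfolding post_dens_def[abs_def] Let_def by measurable
qed

lemma post_dens_nonneg [simp]: "0 \<le> pd x"
  by (auto simp: post_dens_def Let_def intro!: mult_nonneg_nonneg prod_nonneg)

text \<open>The unnormalised marginal posterior density of theta.\<close>

definition rr :: "(nat \<Rightarrow> real) \<Rightarrow> real" where
  "rr \<theta> = sqrt (2 * pi / real n) * Gamma shape / (b0 + (1/2) * ss \<theta>) powr shape * exp (- (\<Sum>i<n. (Y n i - \<theta> i)\<^sup>2) / (2 * V))"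

lemma rr_nonneg [simp]: "0 \<le> rr \<theta>" using Gamma_real_nonneg[OF shape_pos] by (simp add: rr_def)

lemma rr_measurable [measurable]: "rr \<in> borel_measurable Lam"
proof -
  have [measurable]: "(\<lambda>\<theta>. \<Sum>i<n. (Y n i - \<theta> i)\<^sup>2) \<in> borel_measurable Lam"
    using component_measurable by (intro borel_measurable_sum borel_measurable_power borel_measurable_diff) auto
  show ?thesis unfolding rr_def[abs_def] by measurable
qed

lemma sum_dev_vmean: "(\<Sum>i<n. (\<theta> i - \<mu>)\<^sup>2) = ss \<theta> + real n * (\<mu> - vmean n \<theta>)\<^sup>2"
proof -
  have s: "(\<Sum>i<n. \<theta> i) = real n * vmean n \<theta>" using n by (simp add: vmean_def)
  have "(\<Sum>i<n. (\<theta> i - \<mu>)\<^sup>2) = (\<Sum>i<n. (\<theta> i - vmean n \<theta>)\<^sup>2 + 2 * (vmean n \<theta> - \<mu>) * (\<theta> i - vmean n \<theta>) + (\<mu> - vmean n \<theta>)\<^sup>2)"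
    by (rule sum.cong) (auto simp: power2_eq_square algebra_simps)
  also have "\<dots> = ss \<theta> + 2 * (vmean n \<theta> - \<mu>) * (\<Sum>i<n. \<theta> i - vmean n \<theta>) + real n * (\<mu> - vmean n \<theta>)\<^sup>2"
    by (simp add: sum.distrib ss_def sum_distrib_left[symmetric])
  also have "(\<Sum>i<n. \<theta> i - vmean n \<theta>) = 0" by (simp add: sum_subtractf s)
  finally show ?thesis by simp
qed

lemma powr_minus_half_power: "A > 0 \<Longrightarrow> (A powr (-1/2)) ^ n = A powr (- real n / 2)" for A :: real
  by (simp add: powr_realpow[symmetric] powr_powr)

text \<open>The posterior as theta, then A given theta, then mu given both: the squares about mu
  split into \<open>ss\<close> and a term in mu alone. The last two factors are exactly the
  densities by which the sampler draws A and mu.\<close>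

lemma post_dens_factor1: "pd (A, \<mu>, \<theta>) = rr \<theta> * (dA \<theta> A * dmu A \<theta> \<mu>)"
proof (cases "A > 0")
  case False then show ?thesis by (simp add: post_dens_def dA_def inv_gamma_density_def)
next
  case A: True
  define \<beta> where "\<beta> = b0 + (1/2) * ss \<theta>"
  define E where "E = exp (- (\<Sum>i<n. (Y n i - \<theta> i)\<^sup>2) / (2 * V))"
  have \<beta>: "\<beta> > 0" using b0 ss_nonneg[of \<theta>] by (simp add: \<beta>_def add_pos_nonneg)
  have G: "Gamma shape > 0" using shape_pos by (rule Gamma_real_pos)
  have n0: "real n > 0" using n by simp
  have "(\<Prod>i<n. A powr (-1/2) * exp (-(\<theta> i - \<mu>)\<^sup>2 / (2 * A)) * exp (-(Y n i - \<theta> i)\<^sup>2 / (2 * V)))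
    = (A powr (-1/2)) ^ n * exp (\<Sum>i<n. -(\<theta> i - \<mu>)\<^sup>2 / (2 * A)) * exp (\<Sum>i<n. -(Y n i - \<theta> i)\<^sup>2 / (2 * V))"
    by (simp add: prod.distrib exp_sum)
  also have "(\<Sum>i<n. -(\<theta> i - \<mu>)\<^sup>2 / (2 * A)) = - (ss \<theta> + real n * (\<mu> - vmean n \<theta>)\<^sup>2) / (2 * A)"
    by (simp only: sum_divide_distrib[symmetric] sum_negf sum_dev_vmean)
  also have "(\<Sum>i<n. -(Y n i - \<theta> i)\<^sup>2 / (2 * V)) = - (\<Sum>i<n. (Y n i - \<theta> i)\<^sup>2) / (2 * V)"
    by (simp only: sum_divide_distrib[symmetric] sum_negf)
  also have "(A powr (-1/2)) ^ n = A powr (- real n / 2)" by (rule powr_minus_half_power[OF A])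
  finally have "pd (A, \<mu>, \<theta>) = A powr (-a - 1) * exp (-b0 / A) * (A powr (- real n / 2) * exp (- (ss \<theta> + real n * (\<mu> - vmean n \<theta>)\<^sup>2) / (2 * A)) * E)"
    using A by (simp add: post_dens_def E_def)
  also have "\<dots> = (A powr (-a - 1) * A powr (- real n / 2)) * (exp (-b0 / A) * exp (- (ss \<theta> + real n * (\<mu> - vmean n \<theta>)\<^sup>2) / (2 * A))) * E"
    by (simp only: mult_ac)
  \<comment> \<open>One factor A^(-1/2) normalizes the law of mu. The remaining n - 1 half powers go
    into the shape, which is why it contains n - 1.\<close>
  also have "A powr (-a - 1) * A powr (- real n / 2) = A powr (-shape - 1) * A powr (-1/2)"
  proof -
    have "-a - 1 + - real n / 2 = -shape - 1 + -1/2" by (simp add: shape_def add_divide_distrib diff_divide_distrib)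
    then show ?thesis unfolding powr_add[symmetric] by (rule arg_cong)
  qed
  also have "A powr (-1/2) = 1 / sqrt A" using A by (simp add: powr_minus powr_half_sqrt field_simps)
  also have "exp (-b0 / A) * exp (- (ss \<theta> + real n * (\<mu> - vmean n \<theta>)\<^sup>2) / (2 * A)) = exp (-\<beta> / A) * exp (- (\<mu> - vmean n \<theta>)\<^sup>2 / (2 * (A / real n)))"
    unfolding exp_add[symmetric] \<beta>_def using A n0 by (simp add: field_simps)
  also have "A powr (- shape - 1) * (1 / sqrt A) * (exp (-\<beta> / A) * exp (- (\<mu> - vmean n \<theta>)\<^sup>2 / (2 * (A / real n)))) * E
     = rr \<theta> * (dA \<theta> A * dmu A \<theta> \<mu>)"
  proof -
    have d: "dmu A \<theta> \<mu> = 1 / (sqrt (2 * pi / real n) * sqrt A) * exp (- (\<mu> - vmean n \<theta>)\<^sup>2 / (2 * (A / real n)))"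
    proof -
      have "sqrt (2 * pi * (sqrt (A / real n))\<^sup>2) = sqrt (2 * pi / real n * A)" using A n0 by simp
      then show ?thesis unfolding dmu_def normal_density_def using A n0 by (simp only: real_sqrt_mult) simp
    qed
    have dA: "dA \<theta> A = \<beta> powr shape / Gamma shape * A powr (- shape - 1) * exp (-\<beta> / A)"
      using A by (simp add: dA_def inv_gamma_density_def \<beta>_def)
    have r: "rr \<theta> = sqrt (2 * pi / real n) * Gamma shape / \<beta> powr shape * E" by (simp add: rr_def \<beta>_def E_def)
    have nz: "sqrt (2 * pi / real n) \<noteq> 0" "\<beta> powr shape \<noteq> 0" "Gamma shape \<noteq> 0" using n0 \<beta> G by auto
    have gen: "P * (1 / Q) * (X * Z) * W = c * g / b * W * (b / g * P * X * (1 / (c * Q) * Z))"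
      if "c \<noteq> 0" "b \<noteq> 0" "g \<noteq> 0" for P Q X Z W c g b :: real using that by simp
    show ?thesis unfolding d dA r by (rule gen[OF nz])
  qed
  finally show ?thesis .
qed

text \<open>\<open>nV A\<close> is the posterior density of mu given A with theta integrated out;
  \<open>qq\<close> below is the unnormalised marginal posterior density of A.\<close>

definition nV :: "real \<Rightarrow> real \<Rightarrow> real" where "nV A \<mu> = normal_density Yb (sqrt ((V + A) / real n)) \<mu>"
definition qq :: "real \<Rightarrow> real" where
  "qq A = (if A > 0 then A powr (-a - 1) * exp (-b0 / A) * (sqrt (2 * pi * V)) ^ n * sqrt (2 * pi / real n) *
     ((V + A) powr (- ((real n - 1) / 2)) * exp (- \<Delta> / (2 * (V + A)))) else 0)"

lemma qq_nonneg [simp]: "0 \<le> qq A" using V by (simp add: qq_def)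
lemma qq_measurable [measurable]: "qq \<in> borel_measurable borel" unfolding qq_def[abs_def] by measurable
lemma nV_nonneg [simp]: "0 \<le> nV A \<mu>" by (simp add: nV_def)
lemma nV_measurable [measurable (raw)]:
  assumes [measurable]: "f \<in> borel_measurable N" "g \<in> borel_measurable N"
  shows "(\<lambda>x. nV (f x) (g x)) \<in> borel_measurable N"
  unfolding nV_def by measurable

text \<open>Normal conjugacy in one coordinate: completing the square in t splits off the marginal
  law of the observation, with variance V + A, from the full conditional.\<close>

lemma factor2_one:
  assumes A: "A > 0"
  shows "A powr (-1/2) * exp (-(t - \<mu>)\<^sup>2 / (2 * A)) * exp (-(y - t)\<^sup>2 / (2 * V)) =
    sqrt (2 * pi * V) * (1 / sqrt (V + A)) * exp (-(y - \<mu>)\<^sup>2 / (2 * (V + A))) *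
    normal_density ((\<mu> * V + y * A) / (V + A)) (sqrt (A * V / (V + A))) t"
proof -
  define w where "w = V + A"
  have w: "w > 0" using A V by (simp add: w_def)
  define m where "m = (\<mu> * V + y * A) / w"
  have wm: "w * m = \<mu> * V + y * A" using w by (simp add: m_def)
  have ex: "(t - \<mu>)\<^sup>2 / A + (y - t)\<^sup>2 / V = (y - \<mu>)\<^sup>2 / w + (t - m)\<^sup>2 / (A * V / w)"
  proof -
    have "(t - \<mu>)\<^sup>2 / A + (y - t)\<^sup>2 / V = ((t - \<mu>)\<^sup>2 * V + (y - t)\<^sup>2 * A) / (A * V)"
      using A V by (simp add: field_simps)
    moreover have "(y - \<mu>)\<^sup>2 / w + (t - m)\<^sup>2 / (A * V / w) = ((y - \<mu>)\<^sup>2 * (A * V) + (w * t - w * m)\<^sup>2) / (w * (A * V))"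
      using A V w by (simp add: field_simps power2_eq_square)
    moreover have "(y - \<mu>)\<^sup>2 * (A * V) + (w * t - (\<mu> * V + y * A))\<^sup>2 = w * ((t - \<mu>)\<^sup>2 * V + (y - t)\<^sup>2 * A)"
      unfolding w_def by (simp add: power2_eq_square algebra_simps)
    ultimately show ?thesis using wm w by simp
  qed
  have E: "exp (-(t - \<mu>)\<^sup>2 / (2 * A)) * exp (-(y - t)\<^sup>2 / (2 * V)) = exp (-(y - \<mu>)\<^sup>2 / (2 * w)) * exp (-(t - m)\<^sup>2 / (2 * (A * V / w)))"
  proof -
    have "-(t - \<mu>)\<^sup>2 / (2 * A) + -(y - t)\<^sup>2 / (2 * V) = - ((t - \<mu>)\<^sup>2 / A + (y - t)\<^sup>2 / V) / 2" by (simp add: field_simps)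
    also have "\<dots> = -(y - \<mu>)\<^sup>2 / (2 * w) + -(t - m)\<^sup>2 / (2 * (A * V / w))" unfolding ex by (simp add: field_simps)
    finally show ?thesis unfolding exp_add[symmetric] by simp
  qed
  have c: "sqrt (2 * pi * V) * (1 / sqrt w) * (1 / sqrt (2 * pi * (sqrt (A * V / w))\<^sup>2)) = A powr (-1/2)"
  proof -
    have "2 * pi * (sqrt (A * V / w))\<^sup>2 = (2 * pi * V) * A / w" using A V w by simp
    then have "sqrt (2 * pi * (sqrt (A * V / w))\<^sup>2) = sqrt (2 * pi * V) * sqrt A / sqrt w" by (simp only: real_sqrt_mult real_sqrt_divide)
    moreover have "sqrt (2 * pi * V) > 0" using V by simp
    ultimately have "sqrt (2 * pi * V) * (1 / sqrt w) * (1 / sqrt (2 * pi * (sqrt (A * V / w))\<^sup>2)) = 1 / sqrt A" using w A V by simp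
    then show ?thesis using A by (simp add: powr_minus powr_half_sqrt field_simps)
  qed
  have "normal_density ((\<mu> * V + y * A) / (V + A)) (sqrt (A * V / (V + A))) t = 1 / sqrt (2 * pi * (sqrt (A * V / w))\<^sup>2) * exp (-(t - m)\<^sup>2 / (2 * (A * V / w)))"
    unfolding normal_density_def m_def w_def using A V by simp
  then show ?thesis unfolding mult.assoc E w_def[symmetric] c[symmetric] by (simp only: mult_ac)
qed

text \<open>The same density in the order A, mu, theta. It exhibits the sampler's law for theta as
  the full conditional and yields the marginal of A, for which concentration is proved.\<close>

lemma post_dens_factor2: "pd (A, \<mu>, \<theta>) = qq A * (nV A \<mu> * dth A \<mu> \<theta>)"
proof (cases "A > 0")
  case False then show ?thesis by (simp add: post_dens_def qq_def)
next
  case A: True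
  define w where "w = V + A"
  have w: "w > 0" using A V by (simp add: w_def)
  have n0: "real n > 0" using n by simp
  have "(\<Prod>i<n. A powr (-1/2) * exp (-(\<theta> i - \<mu>)\<^sup>2 / (2 * A)) * exp (-(Y n i - \<theta> i)\<^sup>2 / (2 * V)))
    = (sqrt (2 * pi * V)) ^ n * (1 / sqrt w) ^ n * exp (\<Sum>i<n. -(Y n i - \<mu>)\<^sup>2 / (2 * w)) * dth A \<mu> \<theta>"
    unfolding factor2_one[OF A] dth_def cm_def cs_def w_def[symmetric]
    by (simp only: prod.distrib exp_sum[OF finite_lessThan] prod_constant card_lessThan)
  also have "(\<Sum>i<n. -(Y n i - \<mu>)\<^sup>2 / (2 * w)) = - (\<Delta> + real n * (\<mu> - Yb)\<^sup>2) / (2 * w)"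
    by (simp only: sum_divide_distrib[symmetric] sum_negf sum_dev)
  also have "(1 / sqrt w) ^ n = w powr (- real n / 2)"
  proof -
    have "1 / sqrt w = w powr (-1/2)" using w by (simp add: powr_minus powr_half_sqrt field_simps)
    then show ?thesis using w by (simp only: powr_minus_half_power)
  qed
  also have "w powr (- real n / 2) = w powr (- ((real n - 1) / 2)) * (1 / sqrt w)"
  proof -
    have "w powr (- real n / 2) = w powr (- ((real n - 1) / 2) + (-1/2))" by (rule arg_cong[where f="\<lambda>z. w powr z"]) (simp add: field_simps)
    also have "\<dots> = w powr (- ((real n - 1) / 2)) * w powr (-1/2)" by (rule powr_add)
    also have "w powr (-1/2) = 1 / sqrt w" using w by (simp add: powr_minus powr_half_sqrt field_simps)
    finally show ?thesis .
  qed
  also have "exp (- (\<Delta> + real n * (\<mu> - Yb)\<^sup>2) / (2 * w)) = exp (- \<Delta> / (2 * w)) * exp (- (\<mu> - Yb)\<^sup>2 / (2 * (w / real n)))"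
    unfolding exp_add[symmetric] using w n0 by (simp add: field_simps)
  finally have p: "pd (A, \<mu>, \<theta>) = A powr (-a - 1) * exp (-b0 / A) * ((sqrt (2 * pi * V)) ^ n * (w powr (- ((real n - 1) / 2)) * (1 / sqrt w)) *
     (exp (- \<Delta> / (2 * w)) * exp (- (\<mu> - Yb)\<^sup>2 / (2 * (w / real n)))) * dth A \<mu> \<theta>)"
    using A by (simp add: post_dens_def)
  have nv: "nV A \<mu> = 1 / (sqrt (2 * pi / real n) * sqrt w) * exp (- (\<mu> - Yb)\<^sup>2 / (2 * (w / real n)))"
  proof -
    have "sqrt (2 * pi * (sqrt (w / real n))\<^sup>2) = sqrt (2 * pi / real n * w)" using w n0 by simp
    then show ?thesis unfolding nV_def normal_density_def w_def[symmetric] using w n0 by (simp only: real_sqrt_mult) simp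
  qed
  have q: "qq A = A powr (-a - 1) * exp (-b0 / A) * (sqrt (2 * pi * V)) ^ n * sqrt (2 * pi / real n) * (w powr (- ((real n - 1) / 2)) * exp (- \<Delta> / (2 * w)))"
    using A by (simp add: qq_def w_def)
  have nz: "sqrt (2 * pi / real n) \<noteq> 0" using n0 by simp
  have gen: "x1 * x2 * (x3 * (x4 * (1 / Q)) * (x5 * x6) * x7) = x1 * x2 * x3 * c * (x4 * x5) * (1 / (c * Q) * x6 * x7)"
    if "c \<noteq> 0" for x1 x2 x3 x4 x5 x6 x7 Q c :: real using that by simp
  show ?thesis unfolding p q nv by (rule gen[OF nz])
qed

text \<open>Posterior expectation before normalization. Invariance and moment bounds are homogeneous
  in it, so properness is needed only for the final division.\<close>

definition U :: "(real \<times> real \<times> (nat \<Rightarrow> real) \<Rightarrow> ennreal) \<Rightarrow> ennreal" where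
  "U h = (\<integral>\<^sup>+x. ennreal (pd x) * h x \<partial>S)"

lemma nn_integral_S:
  assumes [measurable]: "f \<in> borel_measurable S"
  shows "(\<integral>\<^sup>+x. f x \<partial>S) = (\<integral>\<^sup>+A. \<integral>\<^sup>+\<mu>. \<integral>\<^sup>+\<theta>. f (A, \<mu>, \<theta>) \<partial>Lam \<partial>lborel \<partial>lborel)"
proof -
  interpret L: sigma_finite_measure Lam by (rule sigma_finite_Lam)
  interpret P: pair_sigma_finite "lborel :: real measure" Lam
    unfolding pair_sigma_finite_def using sigma_finite_Lam sigma_finite_lborel by blast
  have PS: "sigma_finite_measure (lborel \<Otimes>\<^sub>M Lam)" by (rule sigma_finite_pair_measure[OF sigma_finite_lborel sigma_finite_Lam])
  have f: "f \<in> borel_measurable (lborel \<Otimes>\<^sub>M (lborel \<Otimes>\<^sub>M Lam))" using assms by (simp add: state_space_def)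
  have "(\<integral>\<^sup>+x. f x \<partial>S) = (\<integral>\<^sup>+A. \<integral>\<^sup>+p. f (A, p) \<partial>(lborel \<Otimes>\<^sub>M Lam) \<partial>lborel)"
    unfolding state_space_def by (rule sigma_finite_measure.nn_integral_fst[OF PS f, symmetric])
  also have "\<dots> = (\<integral>\<^sup>+A. \<integral>\<^sup>+\<mu>. \<integral>\<^sup>+\<theta>. f (A, \<mu>, \<theta>) \<partial>Lam \<partial>lborel \<partial>lborel)"
  proof (rule nn_integral_cong)
    fix A :: real
    have "(\<lambda>p. f (A, p)) \<in> borel_measurable (lborel \<Otimes>\<^sub>M Lam)"
      using measurable_compose[OF measurable_Pair1'[of A lborel] f] by simp
    then show "(\<integral>\<^sup>+p. f (A, p) \<partial>(lborel \<Otimes>\<^sub>M Lam)) = (\<integral>\<^sup>+\<mu>. \<integral>\<^sup>+\<theta>. f (A, \<mu>, \<theta>) \<partial>Lam \<partial>lborel)"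
      by (rule L.nn_integral_fst[symmetric])
  qed
  finally show ?thesis .
qed

lemma space_S_iff: "(A, \<mu>, \<theta>) \<in> space S \<longleftrightarrow> \<theta> \<in> space Lam" by (simp add: state_space_def space_pair_measure)

lemma U_form2:
  assumes [measurable]: "h \<in> borel_measurable S"
  shows "U h = (\<integral>\<^sup>+A. ennreal (qq A) * (\<integral>\<^sup>+\<mu>. ennreal (nV A \<mu>) * (\<integral>\<^sup>+\<theta>. ennreal (dth A \<mu> \<theta>) * h (A, \<mu>, \<theta>) \<partial>Lam) \<partial>lborel) \<partial>lborel)"
proof -
  interpret L: sigma_finite_measure Lam by (rule sigma_finite_Lam)
  have "U h = (\<integral>\<^sup>+A. \<integral>\<^sup>+\<mu>. \<integral>\<^sup>+\<theta>. ennreal (pd (A, \<mu>, \<theta>)) * h (A, \<mu>, \<theta>) \<partial>Lam \<partial>lborel \<partial>lborel)"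
    unfolding U_def by (rule nn_integral_S) measurable
  also have "\<dots> = (\<integral>\<^sup>+A. \<integral>\<^sup>+\<mu>. \<integral>\<^sup>+\<theta>. ennreal (qq A) * (ennreal (nV A \<mu>) * (ennreal (dth A \<mu> \<theta>) * h (A, \<mu>, \<theta>))) \<partial>Lam \<partial>lborel \<partial>lborel)"
    unfolding post_dens_factor2 by (simp add: ennreal_mult mult.assoc)
  also have "\<dots> = (\<integral>\<^sup>+A. ennreal (qq A) * (\<integral>\<^sup>+\<mu>. ennreal (nV A \<mu>) * (\<integral>\<^sup>+\<theta>. ennreal (dth A \<mu> \<theta>) * h (A, \<mu>, \<theta>) \<partial>Lam) \<partial>lborel) \<partial>lborel)"
    by (simp add: nn_integral_cmult)
  finally show ?thesis .
qed

lemma U_form1: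
  assumes [measurable]: "h \<in> borel_measurable S"
  shows "U h = (\<integral>\<^sup>+\<theta>. ennreal (rr \<theta>) * (\<integral>\<^sup>+A. ennreal (dA \<theta> A) * (\<integral>\<^sup>+\<mu>. ennreal (dmu A \<theta> \<mu>) * h (A, \<mu>, \<theta>) \<partial>lborel) \<partial>lborel) \<partial>Lam)"
proof -
  interpret L: sigma_finite_measure Lam by (rule sigma_finite_Lam)
  interpret P: pair_sigma_finite "lborel :: real measure" Lam
    unfolding pair_sigma_finite_def using sigma_finite_Lam sigma_finite_lborel by blast
  let ?f = "\<lambda>A \<mu> \<theta>. ennreal (rr \<theta>) * (ennreal (dA \<theta> A) * (ennreal (dmu A \<theta> \<mu>) * h (A, \<mu>, \<theta>)))"
  have "U h = (\<integral>\<^sup>+A. \<integral>\<^sup>+\<mu>. \<integral>\<^sup>+\<theta>. ennreal (pd (A, \<mu>, \<theta>)) * h (A, \<mu>, \<theta>) \<partial>Lam \<partial>lborel \<partial>lborel)"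
    unfolding U_def by (rule nn_integral_S) measurable
  also have "\<dots> = (\<integral>\<^sup>+A. \<integral>\<^sup>+\<mu>. \<integral>\<^sup>+\<theta>. ?f A \<mu> \<theta> \<partial>Lam \<partial>lborel \<partial>lborel)"
    unfolding post_dens_factor1 by (simp add: ennreal_mult mult.assoc)
  also have "\<dots> = (\<integral>\<^sup>+A. \<integral>\<^sup>+\<theta>. \<integral>\<^sup>+\<mu>. ?f A \<mu> \<theta> \<partial>lborel \<partial>Lam \<partial>lborel)"
  proof (rule nn_integral_cong)
    fix A :: real
    have "(\<lambda>(\<mu>, \<theta>). ?f A \<mu> \<theta>) \<in> borel_measurable (lborel \<Otimes>\<^sub>M Lam)" by measurable
    from P.Fubini'[OF this]
    show "(\<integral>\<^sup>+\<mu>. \<integral>\<^sup>+\<theta>. ?f A \<mu> \<theta> \<partial>Lam \<partial>lborel) = (\<integral>\<^sup>+\<theta>. \<integral>\<^sup>+\<mu>. ?f A \<mu> \<theta> \<partial>lborel \<partial>Lam)" by simp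
  qed
  also have "\<dots> = (\<integral>\<^sup>+\<theta>. \<integral>\<^sup>+A. \<integral>\<^sup>+\<mu>. ?f A \<mu> \<theta> \<partial>lborel \<partial>lborel \<partial>Lam)"
  proof -
    have "(\<lambda>(A, \<theta>). \<integral>\<^sup>+\<mu>. ?f A \<mu> \<theta> \<partial>lborel) \<in> borel_measurable (lborel \<Otimes>\<^sub>M Lam)" by measurable
    from P.Fubini'[OF this] show ?thesis by simp
  qed
  also have "\<dots> = (\<integral>\<^sup>+\<theta>. ennreal (rr \<theta>) * (\<integral>\<^sup>+A. ennreal (dA \<theta> A) * (\<integral>\<^sup>+\<mu>. ennreal (dmu A \<theta> \<mu>) * h (A, \<mu>, \<theta>) \<partial>lborel) \<partial>lborel) \<partial>Lam)"
  proof (rule nn_integral_cong)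
    fix \<theta> assume [measurable]: "\<theta> \<in> space Lam"
    show "(\<integral>\<^sup>+A. \<integral>\<^sup>+\<mu>. ?f A \<mu> \<theta> \<partial>lborel \<partial>lborel) = ennreal (rr \<theta>) * (\<integral>\<^sup>+A. ennreal (dA \<theta> A) * (\<integral>\<^sup>+\<mu>. ennreal (dmu A \<theta> \<mu>) * h (A, \<mu>, \<theta>) \<partial>lborel) \<partial>lborel)"
      by (simp add: nn_integral_cmult)
  qed
  finally show ?thesis .
qed

end

section \<open>The sampler started from the posterior\<close>

context gibbs_model
begin

definition J :: "(real \<times> real \<times> (nat \<Rightarrow> real) \<Rightarrow> ennreal) \<Rightarrow> real \<times> real \<times> (nat \<Rightarrow> real) \<Rightarrow> ennreal" where
  "J h x = (\<integral>\<^sup>+A'. ennreal (dA (snd (snd x)) A') * h (A', fst (snd x), snd (snd x)) \<partial>lborel)"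

lemma J_measurable [measurable]:
  assumes [measurable]: "h \<in> borel_measurable S" shows "J h \<in> borel_measurable S"
  unfolding J_def[abs_def] by measurable

lemma T_tuple:
  assumes h: "h \<in> borel_measurable S" and th: "\<theta> \<in> space Lam"
  shows "T h (A, \<mu>, \<theta>) = (\<integral>\<^sup>+\<mu>'. ennreal (dmu A \<theta> \<mu>') * (\<integral>\<^sup>+\<theta>'. ennreal (dth A \<mu>' \<theta>') * J h (A, \<mu>', \<theta>') \<partial>Lam) \<partial>lborel)"
  unfolding T_def J_def using nn_integral_gibbs_step[OF h, of "(A, \<mu>, \<theta>)"] th by (simp add: space_S_iff)

lemma dA_mult_cong: "(A > 0 \<Longrightarrow> f = g) \<Longrightarrow> ennreal (dA \<theta> A) * f = ennreal (dA \<theta> A) * g"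
  by (cases "A > 0") (auto simp: dA_def inv_gamma_density_def)

lemma qq_mult_cong: "(A > 0 \<Longrightarrow> f = g) \<Longrightarrow> ennreal (qq A) * f = ennreal (qq A) * g"
  by (cases "A > 0") (auto simp: qq_def)

lemma rr_dA_cong:
  assumes "\<And>\<theta> A. \<theta> \<in> space Lam \<Longrightarrow> A > 0 \<Longrightarrow> f \<theta> A = g \<theta> A"
  shows "(\<integral>\<^sup>+\<theta>. ennreal (rr \<theta>) * (\<integral>\<^sup>+A. ennreal (dA \<theta> A) * f \<theta> A \<partial>lborel) \<partial>Lam) =
     (\<integral>\<^sup>+\<theta>. ennreal (rr \<theta>) * (\<integral>\<^sup>+A. ennreal (dA \<theta> A) * g \<theta> A \<partial>lborel) \<partial>Lam)"
  by (intro nn_integral_cong arg_cong2[where f="(*)"] refl dA_mult_cong assms) auto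

lemma nn_integral_nV: "A > 0 \<Longrightarrow> (\<integral>\<^sup>+\<mu>. ennreal (nV A \<mu>) \<partial>lborel) = 1"
  unfolding nV_def using n V by (intro nn_integral_normal_density) auto

text \<open>\<open>\<mu>\<close> and then \<open>\<theta>\<close> are refreshed from their full conditionals, which leaves the posterior invariant; only the
  last update, which draws \<open>A\<close> given \<open>\<theta>\<close> with \<open>\<mu>\<close> integrated out, is not a full conditional.\<close>
lemma U_T:
  assumes h[measurable]: "h \<in> borel_measurable S"
  shows "U (T h) = U (J h)"
proof -
  interpret L: sigma_finite_measure Lam by (rule sigma_finite_Lam)
  define H where "H A \<mu> = (\<integral>\<^sup>+\<theta>. ennreal (dth A \<mu> \<theta>) * J h (A, \<mu>, \<theta>) \<partial>Lam)" for A \<mu>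
  have [measurable]: "(\<lambda>x. H (fst x) (fst (snd x))) \<in> borel_measurable S" unfolding H_def by measurable
  have [measurable]: "(\<lambda>p. H (fst p) (snd p)) \<in> borel_measurable (borel \<Otimes>\<^sub>M borel)" unfolding H_def by measurable
  have "U (T h) = (\<integral>\<^sup>+\<theta>. ennreal (rr \<theta>) * (\<integral>\<^sup>+A. ennreal (dA \<theta> A) * (\<integral>\<^sup>+\<mu>. ennreal (dmu A \<theta> \<mu>) * T h (A, \<mu>, \<theta>) \<partial>lborel) \<partial>lborel) \<partial>Lam)"
    by (rule U_form1) measurable
  also have "\<dots> = (\<integral>\<^sup>+\<theta>. ennreal (rr \<theta>) * (\<integral>\<^sup>+A. ennreal (dA \<theta> A) * (\<integral>\<^sup>+\<mu>. ennreal (dmu A \<theta> \<mu>) * H A \<mu> \<partial>lborel) \<partial>lborel) \<partial>Lam)"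
  proof (rule rr_dA_cong)
    fix \<theta> A assume th[measurable]: "\<theta> \<in> space Lam" and A: "A > (0::real)"
    have "(\<integral>\<^sup>+\<mu>. ennreal (dmu A \<theta> \<mu>) * T h (A, \<mu>, \<theta>) \<partial>lborel) = (\<integral>\<^sup>+\<mu>. ennreal (dmu A \<theta> \<mu>) * (\<integral>\<^sup>+\<mu>'. ennreal (dmu A \<theta> \<mu>') * H A \<mu>' \<partial>lborel) \<partial>lborel)"
      unfolding T_tuple[OF h th] H_def ..
    also have "\<dots> = (\<integral>\<^sup>+\<mu>'. ennreal (dmu A \<theta> \<mu>') * H A \<mu>' \<partial>lborel)"
      using A by (simp add: nn_integral_multc nn_integral_dmu)
    finally show "(\<integral>\<^sup>+\<mu>. ennreal (dmu A \<theta> \<mu>) * T h (A, \<mu>, \<theta>) \<partial>lborel) = (\<integral>\<^sup>+\<mu>. ennreal (dmu A \<theta> \<mu>) * H A \<mu> \<partial>lborel)" .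
  qed
  also have "\<dots> = U (\<lambda>x. H (fst x) (fst (snd x)))"
    by (subst U_form1) simp_all
  also have "\<dots> = (\<integral>\<^sup>+A. ennreal (qq A) * (\<integral>\<^sup>+\<mu>. ennreal (nV A \<mu>) * (\<integral>\<^sup>+\<theta>. ennreal (dth A \<mu> \<theta>) * H A \<mu> \<partial>Lam) \<partial>lborel) \<partial>lborel)"
    by (subst U_form2) simp_all
  also have "\<dots> = (\<integral>\<^sup>+A. ennreal (qq A) * (\<integral>\<^sup>+\<mu>. ennreal (nV A \<mu>) * H A \<mu> \<partial>lborel) \<partial>lborel)"
    by (intro nn_integral_cong qq_mult_cong arg_cong2[where f="(*)"] refl) (simp add: nn_integral_multc nn_integral_dth)
  also have "\<dots> = U (J h)" unfolding H_def by (rule U_form2[symmetric]) measurable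
  finally show ?thesis .
qed

text \<open>After one step from the posterior, mu has been drawn with the old A while the state
  shows A', which given theta is an independent draw from the same law.\<close>

lemma U_J_form:
  assumes h[measurable]: "h \<in> borel_measurable S"
  shows "U (J h) = (\<integral>\<^sup>+\<theta>. ennreal (rr \<theta>) * (\<integral>\<^sup>+A. ennreal (dA \<theta> A) *
     (\<integral>\<^sup>+A'. ennreal (dA \<theta> A') * (\<integral>\<^sup>+\<mu>. ennreal (dmu A \<theta> \<mu>) * h (A', \<mu>, \<theta>) \<partial>lborel) \<partial>lborel) \<partial>lborel) \<partial>Lam)"
proof -
  have "U (J h) = (\<integral>\<^sup>+\<theta>. ennreal (rr \<theta>) * (\<integral>\<^sup>+A. ennreal (dA \<theta> A) * (\<integral>\<^sup>+\<mu>. ennreal (dmu A \<theta> \<mu>) * J h (A, \<mu>, \<theta>) \<partial>lborel) \<partial>lborel) \<partial>Lam)"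
    by (rule U_form1) measurable
  also have "\<dots> = (\<integral>\<^sup>+\<theta>. ennreal (rr \<theta>) * (\<integral>\<^sup>+A. ennreal (dA \<theta> A) *
     (\<integral>\<^sup>+A'. ennreal (dA \<theta> A') * (\<integral>\<^sup>+\<mu>. ennreal (dmu A \<theta> \<mu>) * h (A', \<mu>, \<theta>) \<partial>lborel) \<partial>lborel) \<partial>lborel) \<partial>Lam)"
  proof (rule rr_dA_cong)
    fix \<theta> and A :: real assume th[measurable]: "\<theta> \<in> space Lam"
    have "(\<integral>\<^sup>+\<mu>. ennreal (dmu A \<theta> \<mu>) * J h (A, \<mu>, \<theta>) \<partial>lborel)
      = (\<integral>\<^sup>+\<mu>. \<integral>\<^sup>+A'. ennreal (dmu A \<theta> \<mu>) * (ennreal (dA \<theta> A') * h (A', \<mu>, \<theta>)) \<partial>lborel \<partial>lborel)"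
      unfolding J_def by (simp add: nn_integral_cmult)
    also have "\<dots> = (\<integral>\<^sup>+A'. \<integral>\<^sup>+\<mu>. ennreal (dmu A \<theta> \<mu>) * (ennreal (dA \<theta> A') * h (A', \<mu>, \<theta>)) \<partial>lborel \<partial>lborel)"
    proof -
      have "(\<lambda>(\<mu>, A'). ennreal (dmu A \<theta> \<mu>) * (ennreal (dA \<theta> A') * h (A', \<mu>, \<theta>))) \<in> borel_measurable (lborel \<Otimes>\<^sub>M lborel)" by measurable
      from lborel_pair.Fubini'[OF this] show ?thesis by simp
    qed
    also have "\<dots> = (\<integral>\<^sup>+A'. \<integral>\<^sup>+\<mu>. ennreal (dA \<theta> A') * (ennreal (dmu A \<theta> \<mu>) * h (A', \<mu>, \<theta>)) \<partial>lborel \<partial>lborel)"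
      by (simp add: mult.left_commute)
    also have "\<dots> = (\<integral>\<^sup>+A'. ennreal (dA \<theta> A') * (\<integral>\<^sup>+\<mu>. ennreal (dmu A \<theta> \<mu>) * h (A', \<mu>, \<theta>) \<partial>lborel) \<partial>lborel)"
      by (simp add: nn_integral_cmult)
    finally show "(\<integral>\<^sup>+\<mu>. ennreal (dmu A \<theta> \<mu>) * J h (A, \<mu>, \<theta>) \<partial>lborel) = (\<integral>\<^sup>+A'. ennreal (dA \<theta> A') * (\<integral>\<^sup>+\<mu>. ennreal (dmu A \<theta> \<mu>) * h (A', \<mu>, \<theta>) \<partial>lborel) \<partial>lborel)" .
  qed
  finally show ?thesis .
qed

text \<open>A dummy draw A is added so that this expression differs from \<open>U_J_form\<close>
  only in the scale of mu: A' here, A there.\<close>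

lemma U_form1_double:
  assumes h[measurable]: "h \<in> borel_measurable S"
  shows "U h = (\<integral>\<^sup>+\<theta>. ennreal (rr \<theta>) * (\<integral>\<^sup>+A. ennreal (dA \<theta> A) *
     (\<integral>\<^sup>+A'. ennreal (dA \<theta> A') * (\<integral>\<^sup>+\<mu>. ennreal (dmu A' \<theta> \<mu>) * h (A', \<mu>, \<theta>) \<partial>lborel) \<partial>lborel) \<partial>lborel) \<partial>Lam)"
  unfolding U_form1[OF h]
  by (rule nn_integral_cong, rule arg_cong2[where f="(*)"], rule refl) (simp add: nn_integral_multc nn_integral_dA)

lemma U_T_mu_free:
  assumes h[measurable]: "h \<in> borel_measurable S" and mu: "\<And>A \<mu> \<mu>' \<theta>. h (A, \<mu>, \<theta>) = h (A, \<mu>', \<theta>)"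
  shows "U (T h) = U h"
  unfolding U_T[OF h] U_J_form[OF h] U_form1_double[OF h]
proof (rule rr_dA_cong, rule nn_integral_cong, rule dA_mult_cong)
  fix \<theta> A A' assume th[measurable]: "\<theta> \<in> space Lam" and A: "A > (0::real)" "A' > (0::real)"
  have "(\<integral>\<^sup>+\<mu>. ennreal (dmu B \<theta> \<mu>) * h (A', \<mu>, \<theta>) \<partial>lborel) = h (A', 0, \<theta>)" if "B > 0" for B
  proof -
    have "(\<integral>\<^sup>+\<mu>. ennreal (dmu B \<theta> \<mu>) * h (A', \<mu>, \<theta>) \<partial>lborel) = (\<integral>\<^sup>+\<mu>. ennreal (dmu B \<theta> \<mu>) * h (A', 0, \<theta>) \<partial>lborel)"
      by (rule nn_integral_cong, rule arg_cong2[where f="(*)"], rule refl, rule mu)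
    then show ?thesis using that by (simp add: nn_integral_multc nn_integral_dmu)
  qed
  then show "(\<integral>\<^sup>+\<mu>. ennreal (dmu A \<theta> \<mu>) * h (A', \<mu>, \<theta>) \<partial>lborel) = (\<integral>\<^sup>+\<mu>. ennreal (dmu A' \<theta> \<mu>) * h (A', \<mu>, \<theta>) \<partial>lborel)"
    using A by simp
qed

lemma T_mu_free: "T h (A, \<mu>, \<theta>) = T h (A, \<mu>', \<theta>)"
  unfolding T_def gibbs_step_def Let_def by simp

lemma U_T_pow:
  assumes h: "h \<in> borel_measurable S"
  shows "U ((T ^^ Suc j) h) = U (T h)"
proof (induction j)
  case (Suc j)
  have "U ((T ^^ Suc (Suc j)) h) = U (T (T ((T ^^ j) h)))" by simp
  also have "\<dots> = U (T ((T ^^ j) h))"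
    by (rule U_T_mu_free) (use T_mu_free T_pow_measurable[OF h] in auto)
  finally show ?case using Suc by simp
qed simp

text \<open>The ratio is free of scale, so the bound does not depend on theta: two independent draws
  differ relatively by about twice the coefficient of variation 1 / sqrt (shape - 2).\<close>

lemma nn_integral_dA_pair_diff:
  assumes sh: "shape > 2"
  shows "(\<integral>\<^sup>+A. ennreal (dA \<theta> A) * (\<integral>\<^sup>+A'. ennreal (dA \<theta> A') * ennreal (3 * (\<bar>A - A'\<bar> / (A + A'))) \<partial>lborel) \<partial>lborel) \<le> ennreal (6 / sqrt (shape - 2))"
proof -
  define \<beta> where "\<beta> = b0 + (1/2) * ss \<theta>"
  define m where "m = \<beta> / (shape - 1)"
  define v where "v = m / sqrt (shape - 2)"
  have \<beta>: "\<beta> > 0" using b0 ss_nonneg[of \<theta>] by (simp add: \<beta>_def add_pos_nonneg)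
  have m: "m > 0" using \<beta> sh by (simp add: m_def)
  have v: "v > 0" using m sh by (simp add: v_def)
  define c where "c = 3 / m"
  have c: "c > 0" using m by (simp add: c_def)
  have [measurable]: "dA \<theta> \<in> borel_measurable borel" unfolding dA_def by measurable
  let ?M = "density lborel (\<lambda>A. ennreal (dA \<theta> A))"
  interpret P: prob_space ?M by (rule prob_spaceI) (simp add: emeasure_density nn_integral_dA)
  have "(\<integral>\<^sup>+A. ennreal \<bar>A - m\<bar> \<partial>?M) \<le> ennreal v"
  proof (rule P.nn_integral_abs_le_of_square)
    have "(\<integral>\<^sup>+A. ennreal ((A - m)\<^sup>2) \<partial>?M) = ennreal (m\<^sup>2 / (shape - 2))"
      using nn_integral_inv_gamma_variance[OF sh \<beta>] by (simp add: nn_integral_density dA_def \<beta>_def m_def)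
    also have "m\<^sup>2 / (shape - 2) = v\<^sup>2" using sh by (simp add: v_def power_divide)
    finally show "(\<integral>\<^sup>+A. ennreal ((A - m)\<^sup>2) \<partial>?M) \<le> ennreal (v\<^sup>2)" by simp
  qed (use v in auto)
  then have I: "(\<integral>\<^sup>+A. ennreal (dA \<theta> A) * ennreal \<bar>A - m\<bar> \<partial>lborel) \<le> ennreal v" by (simp add: nn_integral_density)
  have pt: "3 * (\<bar>A - A'\<bar> / (A + A')) \<le> c * \<bar>A - m\<bar> + c * \<bar>A' - m\<bar>" if A: "A > 0" "A' > 0" for A A'
  proof -
    \<comment> \<open>The denominator may be small. But if A + A' < m, the two deviations from m sum
      to more than m, and the right side exceeds 1, the trivial bound for the left.\<close>
    have "\<bar>A - A'\<bar> / (A + A') \<le> (\<bar>A - m\<bar> + \<bar>A' - m\<bar>) / m"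
    proof (cases "A + A' \<ge> m")
      case True
      have "\<bar>A - A'\<bar> / (A + A') \<le> \<bar>A - A'\<bar> / m" using True m A by (intro divide_left_mono) auto
      also have "\<dots> \<le> (\<bar>A - m\<bar> + \<bar>A' - m\<bar>) / m" using m by (intro divide_right_mono) auto
      finally show ?thesis .
    next
      case False
      have "\<bar>A - A'\<bar> / (A + A') \<le> 1" using A by simp
      also have "1 \<le> (\<bar>A - m\<bar> + \<bar>A' - m\<bar>) / m" using False m by (simp add: le_divide_eq)
      finally show ?thesis .
    qed
    from mult_left_mono[OF this, of 3] show ?thesis by (simp add: add_divide_distrib c_def)
  qed
  have "(\<integral>\<^sup>+A. ennreal (dA \<theta> A) * (\<integral>\<^sup>+A'. ennreal (dA \<theta> A') * ennreal (3 * (\<bar>A - A'\<bar> / (A + A'))) \<partial>lborel) \<partial>lborel)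
    \<le> (\<integral>\<^sup>+A. ennreal (dA \<theta> A) * (ennreal c * ennreal \<bar>A - m\<bar> + ennreal (c * v)) \<partial>lborel)"
  proof (rule nn_integral_mono)
    fix A :: real
    have "ennreal (dA \<theta> A) * (\<integral>\<^sup>+A'. ennreal (dA \<theta> A') * ennreal (3 * (\<bar>A - A'\<bar> / (A + A'))) \<partial>lborel)
       \<le> ennreal (dA \<theta> A) * (ennreal c * ennreal \<bar>A - m\<bar> + ennreal (c * v))" if A: "A > 0"
    proof (rule mult_left_mono)
      have "(\<integral>\<^sup>+A'. ennreal (dA \<theta> A') * ennreal (3 * (\<bar>A - A'\<bar> / (A + A'))) \<partial>lborel)
         \<le> (\<integral>\<^sup>+A'. ennreal (c * \<bar>A - m\<bar>) * ennreal (dA \<theta> A') + ennreal c * (ennreal (dA \<theta> A') * ennreal \<bar>A' - m\<bar>) \<partial>lborel)"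
      proof (rule nn_integral_mono)
        fix A' :: real
        have "ennreal (dA \<theta> A') * ennreal (3 * (\<bar>A - A'\<bar> / (A + A'))) \<le> ennreal (dA \<theta> A') * ennreal (c * \<bar>A - m\<bar> + c * \<bar>A' - m\<bar>)"
        proof (cases "A' > 0")
          case True then show ?thesis by (intro mult_left_mono ennreal_leI pt A) auto
        qed (simp add: dA_def inv_gamma_density_def)
        also have "\<dots> = ennreal (c * \<bar>A - m\<bar>) * ennreal (dA \<theta> A') + ennreal c * (ennreal (dA \<theta> A') * ennreal \<bar>A' - m\<bar>)"
          using c by (subst ennreal_plus) (auto simp: ennreal_mult distrib_left mult_ac)
        finally show "ennreal (dA \<theta> A') * ennreal (3 * (\<bar>A - A'\<bar> / (A + A'))) \<le> ennreal (c * \<bar>A - m\<bar>) * ennreal (dA \<theta> A') + ennreal c * (ennreal (dA \<theta> A') * ennreal \<bar>A' - m\<bar>)" .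
      qed
      also have "\<dots> = ennreal (c * \<bar>A - m\<bar>) + ennreal c * (\<integral>\<^sup>+A'. ennreal (dA \<theta> A') * ennreal \<bar>A' - m\<bar> \<partial>lborel)"
        by (simp add: nn_integral_add nn_integral_cmult nn_integral_dA)
      also have "\<dots> \<le> ennreal (c * \<bar>A - m\<bar>) + ennreal c * ennreal v"
        by (intro add_left_mono mult_left_mono I) auto
      also have "\<dots> = ennreal c * ennreal \<bar>A - m\<bar> + ennreal (c * v)"
        using c v by (simp add: ennreal_mult[symmetric])
      finally show "(\<integral>\<^sup>+A'. ennreal (dA \<theta> A') * ennreal (3 * (\<bar>A - A'\<bar> / (A + A'))) \<partial>lborel) \<le> ennreal c * ennreal \<bar>A - m\<bar> + ennreal (c * v)" .
    qed simp
    then show "ennreal (dA \<theta> A) * (\<integral>\<^sup>+A'. ennreal (dA \<theta> A') * ennreal (3 * (\<bar>A - A'\<bar> / (A + A'))) \<partial>lborel)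
       \<le> ennreal (dA \<theta> A) * (ennreal c * ennreal \<bar>A - m\<bar> + ennreal (c * v))"
      by (cases "A > 0") (auto simp: dA_def inv_gamma_density_def)
  qed
  also have "\<dots> = (\<integral>\<^sup>+A. ennreal c * (ennreal (dA \<theta> A) * ennreal \<bar>A - m\<bar>) + ennreal (c * v) * ennreal (dA \<theta> A) \<partial>lborel)"
    by (simp add: distrib_left mult_ac)
  also have "\<dots> = ennreal c * (\<integral>\<^sup>+A. ennreal (dA \<theta> A) * ennreal \<bar>A - m\<bar> \<partial>lborel) + ennreal (c * v)"
    by (simp add: nn_integral_add nn_integral_cmult nn_integral_dA)
  also have "\<dots> \<le> ennreal c * ennreal v + ennreal (c * v)"
    by (intro add_right_mono mult_left_mono I) auto
  also have "\<dots> = ennreal (2 * (c * v))" using c v by (simp add: ennreal_mult[symmetric] ennreal_plus[symmetric] del: ennreal_plus)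
  also have "2 * (c * v) = 6 / sqrt (shape - 2)" using m by (simp add: v_def c_def)
  finally show ?thesis .
qed

text \<open>By the two double forms, the defect of invariance is the cost of replacing
  \<open>dmu A\<close> by \<open>dmu A'\<close> with the same mean. That is the relative difference
  of A and A', averaged by \<open>nn_integral_dA_pair_diff\<close>.\<close>

lemma U_T_le:
  assumes sh: "shape > 2" and h[measurable]: "h \<in> borel_measurable S" and h1: "\<And>x. x \<in> space S \<Longrightarrow> h x \<le> 1"
  shows "U (T h) \<le> U h + U (\<lambda>_. 1) * ennreal (6 / sqrt (shape - 2))"
proof -
  let ?d = "\<lambda>A A'. ennreal (3 * (\<bar>A - A'\<bar> / (A + A')))"
  let ?K = "\<lambda>\<theta> A'. \<integral>\<^sup>+\<mu>. ennreal (dmu A' \<theta> \<mu>) * h (A', \<mu>, \<theta>) \<partial>lborel"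
  let ?I = "\<lambda>\<theta>. \<integral>\<^sup>+A. ennreal (dA \<theta> A) * (\<integral>\<^sup>+A'. ennreal (dA \<theta> A') * ?K \<theta> A' \<partial>lborel) \<partial>lborel"
  have "U (T h) = (\<integral>\<^sup>+\<theta>. ennreal (rr \<theta>) * (\<integral>\<^sup>+A. ennreal (dA \<theta> A) *
     (\<integral>\<^sup>+A'. ennreal (dA \<theta> A') * (\<integral>\<^sup>+\<mu>. ennreal (dmu A \<theta> \<mu>) * h (A', \<mu>, \<theta>) \<partial>lborel) \<partial>lborel) \<partial>lborel) \<partial>Lam)"
    unfolding U_T[OF h] by (rule U_J_form[OF h])
  also have "\<dots> \<le> (\<integral>\<^sup>+\<theta>. ennreal (rr \<theta>) * ?I \<theta> + ennreal (6 / sqrt (shape - 2)) * ennreal (rr \<theta>) \<partial>Lam)"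
  proof (rule nn_integral_mono)
    fix \<theta> assume th[measurable]: "\<theta> \<in> space Lam"
    have "(\<integral>\<^sup>+A. ennreal (dA \<theta> A) * (\<integral>\<^sup>+A'. ennreal (dA \<theta> A') * (\<integral>\<^sup>+\<mu>. ennreal (dmu A \<theta> \<mu>) * h (A', \<mu>, \<theta>) \<partial>lborel) \<partial>lborel) \<partial>lborel)
       \<le> (\<integral>\<^sup>+A. ennreal (dA \<theta> A) * (\<integral>\<^sup>+A'. ennreal (dA \<theta> A') * ?K \<theta> A' + ennreal (dA \<theta> A') * ?d A A' \<partial>lborel) \<partial>lborel)"
    proof (rule nn_integral_mono)
      fix A :: real
      have "(\<integral>\<^sup>+A'. ennreal (dA \<theta> A') * (\<integral>\<^sup>+\<mu>. ennreal (dmu A \<theta> \<mu>) * h (A', \<mu>, \<theta>) \<partial>lborel) \<partial>lborel)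
         \<le> (\<integral>\<^sup>+A'. ennreal (dA \<theta> A') * ?K \<theta> A' + ennreal (dA \<theta> A') * ?d A A' \<partial>lborel)" if A: "A > 0"
      proof (rule nn_integral_mono)
        fix A' :: real
        have "(\<integral>\<^sup>+\<mu>. ennreal (dmu A \<theta> \<mu>) * h (A', \<mu>, \<theta>) \<partial>lborel) \<le> ?K \<theta> A' + ?d A A'" if A': "A' > 0"
        proof -
          have "(\<integral>\<^sup>+\<mu>. ennreal (dmu A \<theta> \<mu>) * h (A', \<mu>, \<theta>) \<partial>lborel) \<le> ?K \<theta> A' + (\<integral>\<^sup>+\<mu>. ennreal \<bar>dmu A \<theta> \<mu> - dmu A' \<theta> \<mu>\<bar> \<partial>lborel)"
            by (rule nn_integral_le_add_abs_diff) (use h1 th space_S_iff in auto)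
          also have "\<dots> \<le> ?K \<theta> A' + ?d A A'"
            using nn_integral_dmu_diff[OF A A', of \<theta> \<theta>] by (intro add_left_mono) simp
          finally show ?thesis .
        qed
        then show "ennreal (dA \<theta> A') * (\<integral>\<^sup>+\<mu>. ennreal (dmu A \<theta> \<mu>) * h (A', \<mu>, \<theta>) \<partial>lborel) \<le> ennreal (dA \<theta> A') * ?K \<theta> A' + ennreal (dA \<theta> A') * ?d A A'"
          by (cases "A' > 0") (auto simp: distrib_left[symmetric] dA_def inv_gamma_density_def intro!: mult_left_mono)
      qed
      then show "ennreal (dA \<theta> A) * (\<integral>\<^sup>+A'. ennreal (dA \<theta> A') * (\<integral>\<^sup>+\<mu>. ennreal (dmu A \<theta> \<mu>) * h (A', \<mu>, \<theta>) \<partial>lborel) \<partial>lborel)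
         \<le> ennreal (dA \<theta> A) * (\<integral>\<^sup>+A'. ennreal (dA \<theta> A') * ?K \<theta> A' + ennreal (dA \<theta> A') * ?d A A' \<partial>lborel)"
        by (cases "A > 0") (auto simp: dA_def inv_gamma_density_def intro!: mult_left_mono)
    qed
    also have "\<dots> = ?I \<theta> + (\<integral>\<^sup>+A. ennreal (dA \<theta> A) * (\<integral>\<^sup>+A'. ennreal (dA \<theta> A') * ?d A A' \<partial>lborel) \<partial>lborel)"
      by (simp add: nn_integral_add distrib_left)
    also have "\<dots> \<le> ?I \<theta> + ennreal (6 / sqrt (shape - 2))"
      by (intro add_left_mono nn_integral_dA_pair_diff[OF sh])
    finally have "ennreal (rr \<theta>) * (\<integral>\<^sup>+A. ennreal (dA \<theta> A) * (\<integral>\<^sup>+A'. ennreal (dA \<theta> A') * (\<integral>\<^sup>+\<mu>. ennreal (dmu A \<theta> \<mu>) * h (A', \<mu>, \<theta>) \<partial>lborel) \<partial>lborel) \<partial>lborel)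
      \<le> ennreal (rr \<theta>) * (?I \<theta> + ennreal (6 / sqrt (shape - 2)))" by (intro mult_left_mono) auto
    then show "ennreal (rr \<theta>) * (\<integral>\<^sup>+A. ennreal (dA \<theta> A) * (\<integral>\<^sup>+A'. ennreal (dA \<theta> A') * (\<integral>\<^sup>+\<mu>. ennreal (dmu A \<theta> \<mu>) * h (A', \<mu>, \<theta>) \<partial>lborel) \<partial>lborel) \<partial>lborel)
      \<le> ennreal (rr \<theta>) * ?I \<theta> + ennreal (6 / sqrt (shape - 2)) * ennreal (rr \<theta>)" by (simp add: distrib_left mult.commute)
  qed
  also have "\<dots> = U h + ennreal (6 / sqrt (shape - 2)) * (\<integral>\<^sup>+\<theta>. ennreal (rr \<theta>) \<partial>Lam)"
    unfolding U_form1_double[OF h] by (subst nn_integral_add) (auto simp: nn_integral_cmult)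
  also have "(\<integral>\<^sup>+\<theta>. ennreal (rr \<theta>) \<partial>Lam) = U (\<lambda>_. 1)"
  proof -
    have "U (\<lambda>_. 1) = (\<integral>\<^sup>+\<theta>. ennreal (rr \<theta>) * (\<integral>\<^sup>+A. ennreal (dA \<theta> A) * 1 \<partial>lborel) \<partial>Lam)"
      by (subst U_form1, simp) (intro nn_integral_cong arg_cong2[where f="(*)"] refl dA_mult_cong, simp add: nn_integral_dmu)
    then show ?thesis by (simp add: nn_integral_dA)
  qed
  finally show ?thesis by (simp add: mult.commute)
qed

end

subsection \<open>Concentration of the posterior\<close>

context gibbs_model
begin

lemma U_fst:
  assumes [measurable]: "f \<in> borel_measurable borel"
  shows "U (\<lambda>x. f (fst x)) = (\<integral>\<^sup>+A. ennreal (qq A) * f A \<partial>lborel)"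
proof -
  have [measurable]: "(\<lambda>x. f (fst x)) \<in> borel_measurable S" by measurable
  have "U (\<lambda>x. f (fst x)) = (\<integral>\<^sup>+A. ennreal (qq A) * (\<integral>\<^sup>+\<mu>. ennreal (nV A \<mu>) * (\<integral>\<^sup>+\<theta>. ennreal (dth A \<mu> \<theta>) * f A \<partial>Lam) \<partial>lborel) \<partial>lborel)"
    by (subst U_form2) simp_all
  also have "\<dots> = (\<integral>\<^sup>+A. ennreal (qq A) * f A \<partial>lborel)"
  proof (rule nn_integral_cong, rule qq_mult_cong)
    fix A :: real assume A: "A > 0"
    show "(\<integral>\<^sup>+\<mu>. ennreal (nV A \<mu>) * (\<integral>\<^sup>+\<theta>. ennreal (dth A \<mu> \<theta>) * f A \<partial>Lam) \<partial>lborel) = f A"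
      using A by (simp add: nn_integral_multc nn_integral_dth nn_integral_nV)
  qed
  finally show ?thesis .
qed

lemma U_one: "U (\<lambda>_. 1) = (\<integral>\<^sup>+A. ennreal (qq A) \<partial>lborel)"
  using U_fst[of "\<lambda>_. 1"] by simp

lemma nn_integral_dth_vmean:
  assumes A: "A > 0"
  shows "(\<integral>\<^sup>+\<theta>. ennreal (dth A \<mu> \<theta>) * ennreal ((vmean n \<theta> - Yb)\<^sup>2) \<partial>Lam)
    \<le> ennreal (2 * (1 - alpha A)\<^sup>2) * ennreal ((\<mu> - Yb)\<^sup>2) + ennreal (2 * V / real n)"
proof -
  let ?al = "alpha A"
  have al: "0 < ?al" "?al < 1" using alpha_pos alpha_less A by auto
  have s1z: "(\<lambda>z. s1 (0, z, 0)) \<in> borel_measurable Lam"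
    unfolding s1_def by (auto intro!: borel_measurable_divide borel_measurable_sum component_measurable)
  note [measurable] = s1z
  have I1: "(\<integral>\<^sup>+z. ennreal ((s1 (0, z, 0))\<^sup>2) \<partial>Pn) = ennreal (1 / real n)"
  proof -
    have e: "s1 \<xi> = s1 (0, fst (snd \<xi>), 0)" for \<xi> by (simp add: s1_def)
    have "(\<integral>\<^sup>+z. ennreal ((s1 (0, z, 0))\<^sup>2) \<partial>Pn) = (\<integral>\<^sup>+\<xi>. ennreal ((s1 (0, fst (snd \<xi>), 0))\<^sup>2) \<partial>noise)"
      by (rule nn_integral_noise_1[symmetric]) measurable
    then show ?thesis unfolding e[symmetric] noise_s1 .
  qed
  have vm: "vmean n (Fth A \<mu> z) - Yb = (1 - ?al) * (\<mu> - Yb) + cs A * s1 (0, z, 0)" for z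
    by (simp add: vmean_Fth[OF A] s1_def algebra_simps)
  have "(\<integral>\<^sup>+\<theta>. ennreal (dth A \<mu> \<theta>) * ennreal ((vmean n \<theta> - Yb)\<^sup>2) \<partial>Lam) = (\<integral>\<^sup>+\<theta>. ennreal ((vmean n \<theta> - Yb)\<^sup>2) \<partial>density Lam (\<lambda>\<theta>. ennreal (dth A \<mu> \<theta>)))"
    by (subst nn_integral_density) auto
  also have "\<dots> = (\<integral>\<^sup>+z. ennreal ((vmean n (Fth A \<mu> z) - Yb)\<^sup>2) \<partial>Pn)"
    unfolding dth_distr[OF A] by (subst nn_integral_distr) auto
  also have "\<dots> \<le> (\<integral>\<^sup>+z. ennreal (2 * (1 - ?al)\<^sup>2 * (\<mu> - Yb)\<^sup>2) + ennreal (2 * V) * ennreal ((s1 (0, z, 0))\<^sup>2) \<partial>Pn)"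
  proof (rule nn_integral_mono)
    fix z
    let ?p = "(1 - ?al) * (\<mu> - Yb)" and ?q = "cs A * s1 (0, z, 0)"
    have "0 \<le> (?p - ?q)\<^sup>2" by simp
    then have "(?p + ?q)\<^sup>2 \<le> 2 * ?p\<^sup>2 + 2 * ?q\<^sup>2" by (simp add: power2_sum power2_diff)
    also have "?q\<^sup>2 = V * ?al * (s1 (0, z, 0))\<^sup>2" using al V by (simp add: power_mult_distrib cs_alpha)
    also have "2 * ?p\<^sup>2 + 2 * (V * ?al * (s1 (0, z, 0))\<^sup>2) \<le> 2 * (1 - ?al)\<^sup>2 * (\<mu> - Yb)\<^sup>2 + 2 * V * (s1 (0, z, 0))\<^sup>2"
    proof -
      have "V * ?al * (s1 (0, z, 0))\<^sup>2 \<le> V * (s1 (0, z, 0))\<^sup>2" using al V by (intro mult_right_mono) auto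
      then show ?thesis by (simp add: power_mult_distrib)
    qed
    finally have "(?p + ?q)\<^sup>2 \<le> 2 * (1 - ?al)\<^sup>2 * (\<mu> - Yb)\<^sup>2 + 2 * V * (s1 (0, z, 0))\<^sup>2" .
    from ennreal_leI[OF this] show "ennreal ((vmean n (Fth A \<mu> z) - Yb)\<^sup>2) \<le> ennreal (2 * (1 - ?al)\<^sup>2 * (\<mu> - Yb)\<^sup>2) + ennreal (2 * V) * ennreal ((s1 (0, z, 0))\<^sup>2)"
      unfolding vm using V by (simp add: ennreal_mult[symmetric] ennreal_plus[symmetric] del: ennreal_plus)
  qed
  also have "\<dots> = ennreal (2 * (1 - ?al)\<^sup>2 * (\<mu> - Yb)\<^sup>2) + ennreal (2 * V) * ennreal (1 / real n)"
    by (simp add: nn_integral_add nn_integral_cmult prob_space.emeasure_space_1[OF prob_Pn] I1)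
  also have "\<dots> = ennreal (2 * (1 - ?al)\<^sup>2) * ennreal ((\<mu> - Yb)\<^sup>2) + ennreal (2 * V / real n)"
    using V by (simp add: ennreal_mult[symmetric])
  finally show ?thesis .
qed

text \<open>The variance (V + A) / n of mu is unbounded in A, but mu enters the mean of theta with
  weight 1 - alpha = V / (V + A). The product V^2 / (V + A) is at most V, so no moment of A is
  needed.\<close>

lemma U_vmean_sq: "U (\<lambda>x. ennreal ((vmean n (snd (snd x)) - Yb)\<^sup>2)) \<le> U (\<lambda>_. 1) * ennreal (4 * V / real n)"
proof -
  have n0: "real n > 0" using n by simp
  have "U (\<lambda>x. ennreal ((vmean n (snd (snd x)) - Yb)\<^sup>2)) = (\<integral>\<^sup>+A. ennreal (qq A) * (\<integral>\<^sup>+\<mu>. ennreal (nV A \<mu>) * (\<integral>\<^sup>+\<theta>. ennreal (dth A \<mu> \<theta>) * ennreal ((vmean n \<theta> - Yb)\<^sup>2) \<partial>Lam) \<partial>lborel) \<partial>lborel)"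
    by (subst U_form2) simp_all
  also have "\<dots> \<le> (\<integral>\<^sup>+A. ennreal (qq A) * ennreal (4 * V / real n) \<partial>lborel)"
  proof (rule nn_integral_mono)
    fix A :: real
    have "(\<integral>\<^sup>+\<mu>. ennreal (nV A \<mu>) * (\<integral>\<^sup>+\<theta>. ennreal (dth A \<mu> \<theta>) * ennreal ((vmean n \<theta> - Yb)\<^sup>2) \<partial>Lam) \<partial>lborel) \<le> ennreal (4 * V / real n)" if A: "A > 0"
    proof -
      define c where "c = 2 * (1 - alpha A)\<^sup>2"
      have c: "0 \<le> c" by (simp add: c_def)
      let ?s = "sqrt ((V + A) / real n)"
      have s: "?s > 0" "?s\<^sup>2 = (V + A) / real n" using V A n0 by auto
      have I: "(\<integral>\<^sup>+\<mu>. ennreal (nV A \<mu>) * ennreal ((\<mu> - Yb)\<^sup>2) \<partial>lborel) = ennreal ((V + A) / real n)"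
      proof -
        have "has_bochner_integral lborel (\<lambda>x. normal_density Yb ?s x * (x - Yb)\<^sup>2) (?s\<^sup>2)"
          using normal_moment_even[OF s(1), of Yb 1] s(1) by (simp del: real_sqrt_pow2_iff real_sqrt_pow2)
        then have "has_bochner_integral lborel (\<lambda>x. normal_density Yb ?s x * (x - Yb)\<^sup>2) ((V + A) / real n)" unfolding s(2) .
        then have "(\<integral>\<^sup>+x. ennreal (normal_density Yb ?s x * (x - Yb)\<^sup>2) \<partial>lborel) = ennreal ((V + A) / real n)"
          by (subst nn_integral_eq_integral) (auto simp: has_bochner_integral_iff)
        then show ?thesis by (simp add: nV_def ennreal_mult'')
      qed
      have [measurable]: "nV A \<in> borel_measurable borel" by measurable
      have "(\<integral>\<^sup>+\<mu>. ennreal (nV A \<mu>) * (\<integral>\<^sup>+\<theta>. ennreal (dth A \<mu> \<theta>) * ennreal ((vmean n \<theta> - Yb)\<^sup>2) \<partial>Lam) \<partial>lborel)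
        \<le> (\<integral>\<^sup>+\<mu>. ennreal (nV A \<mu>) * (ennreal c * ennreal ((\<mu> - Yb)\<^sup>2) + ennreal (2 * V / real n)) \<partial>lborel)"
        unfolding c_def by (intro nn_integral_mono mult_left_mono nn_integral_dth_vmean A) auto
      also have "\<dots> = (\<integral>\<^sup>+\<mu>. ennreal c * (ennreal (nV A \<mu>) * ennreal ((\<mu> - Yb)\<^sup>2)) + ennreal (2 * V / real n) * ennreal (nV A \<mu>) \<partial>lborel)"
        by (simp add: distrib_left mult_ac)
      also have "\<dots> = ennreal c * ennreal ((V + A) / real n) + ennreal (2 * V / real n)"
        using A by (simp add: nn_integral_add nn_integral_cmult nn_integral_nV I)
      also have "\<dots> = ennreal (c * ((V + A) / real n) + 2 * V / real n)"
        using c V A by (simp add: ennreal_mult[symmetric] ennreal_plus[symmetric] del: ennreal_plus)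
      also have "\<dots> \<le> ennreal (4 * V / real n)"
      proof (rule ennreal_leI)
        have "(1 - alpha A)\<^sup>2 * (V + A) = V * (V / (V + A))"
        proof -
          have "1 - alpha A = V / (V + A)" using V A by (simp add: alpha_def field_simps)
          then show ?thesis using V A by (simp add: power2_eq_square)
        qed
        also have "\<dots> \<le> V" using V A by (intro mult_left_le) auto
        finally have "c * (V + A) \<le> 2 * V" by (simp add: c_def)
        then have "c * (V + A) / real n \<le> 2 * V / real n" using n0 by (intro divide_right_mono) auto
        then show "c * ((V + A) / real n) + 2 * V / real n \<le> 4 * V / real n" by simp
      qed
      finally show ?thesis .
    qed
    then show "ennreal (qq A) * (\<integral>\<^sup>+\<mu>. ennreal (nV A \<mu>) * (\<integral>\<^sup>+\<theta>. ennreal (dth A \<mu> \<theta>) * ennreal ((vmean n \<theta> - Yb)\<^sup>2) \<partial>Lam) \<partial>lborel) \<le> ennreal (qq A) * ennreal (4 * V / real n)"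
      by (cases "A > 0") (auto simp: qq_def intro!: mult_left_mono)
  qed
  also have "\<dots> = U (\<lambda>_. 1) * ennreal (4 * V / real n)"
    unfolding U_one by (rule nn_integral_multc) measurable
  finally show ?thesis .
qed

text \<open>With mu and theta integrated out, the likelihood is bounded in A because V + A >= V. So
  \<open>qq\<close> is dominated by a multiple of the proper prior density of A, although the prior
  of mu is improper.\<close>

lemma U_one_finite: "U (\<lambda>_. 1) < \<infinity>"
proof -
  define C where "C = Gamma a / b0 powr a * (sqrt (2 * pi * V)) ^ n * sqrt (2 * pi / real n) * V powr (- ((real n - 1) / 2))"
  have "qq A \<le> C * inv_gamma_density a b0 A" for A
  proof (cases "A > 0")
    case A: True
    have "(V + A) powr (- ((real n - 1) / 2)) * exp (- \<Delta> / (2 * (V + A))) \<le> V powr (- ((real n - 1) / 2)) * 1"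
    proof (rule mult_mono)
      show "(V + A) powr (- ((real n - 1) / 2)) \<le> V powr (- ((real n - 1) / 2))" using V A n by (intro powr_mono2') auto
      show "exp (- \<Delta> / (2 * (V + A))) \<le> 1" using Delta_nonneg V A by simp
    qed auto
    then have "qq A \<le> A powr (-a - 1) * exp (-b0 / A) * (sqrt (2 * pi * V)) ^ n * sqrt (2 * pi / real n) * (V powr (- ((real n - 1) / 2)) * 1)"
      unfolding qq_def using A V by (simp only: if_True) (intro mult_left_mono, auto)
    also have "\<dots> = C * inv_gamma_density a b0 A"
      using A b0 Gamma_real_pos[OF a] by (simp add: C_def inv_gamma_density_def)
    finally show ?thesis .
  qed (simp add: qq_def inv_gamma_density_def)
  moreover have "0 \<le> C" using V Gamma_real_pos[OF a] by (simp add: C_def)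
  ultimately have "(\<integral>\<^sup>+A. ennreal (qq A) \<partial>lborel) \<le> (\<integral>\<^sup>+A. ennreal C * ennreal (inv_gamma_density a b0 A) \<partial>lborel)"
    using inv_gamma_density_nonneg[OF a] by (intro nn_integral_mono) (simp add: ennreal_mult[symmetric] ennreal_leI)
  also have "\<dots> = ennreal C" by (simp add: nn_integral_cmult nn_integral_inv_gamma_density a b0)
  finally show ?thesis unfolding U_one by (simp add: order_le_less_trans)
qed

lemma U_one_pos: "U (\<lambda>_. 1) \<noteq> 0"
proof
  assume "U (\<lambda>_. 1) = 0"
  then have "AE A in lborel. ennreal (qq A) = 0"
    unfolding U_one by (subst (asm) nn_integral_0_iff_AE) auto
  then have "AE A in lborel. qq A = 0" by (rule eventually_mono) (simp add: ennreal_eq_0_iff antisym)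
  moreover have "qq A \<noteq> 0" if "A \<in> {1..2}" for A
    using that V n by (auto simp: qq_def)
  ultimately have "AE A in lborel. A \<notin> {1..2::real}" by (auto elim: eventually_mono)
  then have "emeasure lborel {1..2::real} = 0" by (subst (asm) AE_iff_measurable[where N="{1..2}"]) auto
  then show False by simp
qed

end

section \<open>Second moment of A under the posterior\<close>

context gibbs_regime
begin

definition K5 where "K5 = 1 + M * (a + 1)\<^sup>2 / (4 * b0) + b0 / \<delta>"
lemma K5_pos: "K5 > 0" unfolding K5_def using M_pos b0 \<delta> by (intro add_pos_nonneg) auto

text \<open>The bracket is the logarithmic derivative of the prior of A, singular at 0. Below
  \<open>As\<close> the singular term b0 / A^2 has the favourable sign: in y = 1 / A the
  contribution is a downward parabola with maximum (a + 1)^2 / (4 b0). Above \<open>As\<close> only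
  b0 / A survives, at most b0 / delta. The 1 is the derivative of \<open>A - As\<close>.\<close>

lemma prior_drift_le:
  assumes A: "A > 0"
  shows "1 + (A - As) * (- (a + 1) / A + b0 / A\<^sup>2) \<le> K5"
proof -
  have AM: "As \<le> M" using D_bounds V by (simp add: As_def)
  have nn: "0 \<le> M * (a + 1)\<^sup>2 / (4 * b0)" "0 \<le> b0 / \<delta>" using M_pos b0 \<delta> by auto
  show ?thesis
  proof (cases "A \<ge> As")
    case True
    have "(A - As) * (- (a + 1) / A + b0 / A\<^sup>2) \<le> A * (b0 / A\<^sup>2)"
    proof -
      have "(A - As) * (- (a + 1) / A + b0 / A\<^sup>2) \<le> (A - As) * (b0 / A\<^sup>2)"
        using True A a by (intro mult_left_mono) (auto intro!: divide_nonpos_pos)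
      also have "\<dots> \<le> A * (b0 / A\<^sup>2)" using As_ge \<delta> b0 by (intro mult_right_mono) auto
      finally show ?thesis .
    qed
    also have "\<dots> = b0 / A" using A by (simp add: power2_eq_square)
    also have "\<dots> \<le> b0 / \<delta>" using True As_ge \<delta> b0 by (intro divide_left_mono) auto
    finally show ?thesis using nn by (simp add: K5_def)
  next
    case False
    define y where "y = 1 / A"
    have "(a + 1) * y - b0 * y\<^sup>2 \<le> (a + 1)\<^sup>2 / (4 * b0)"
    proof -
      have "0 \<le> (2 * b0 * y - (a + 1))\<^sup>2 / (4 * b0)" using b0 by simp
      also have "\<dots> = b0 * y\<^sup>2 - (a + 1) * y + (a + 1)\<^sup>2 / (4 * b0)"
        using b0 by (simp add: power2_diff power_mult_distrib field_simps power2_eq_square)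
      finally show ?thesis by simp
    qed
    then have "(As - A) * ((a + 1) * y - b0 * y\<^sup>2) \<le> (As - A) * ((a + 1)\<^sup>2 / (4 * b0))"
      using False by (intro mult_left_mono) auto
    also have "\<dots> \<le> M * ((a + 1)\<^sup>2 / (4 * b0))" using AM A b0 by (intro mult_right_mono) auto
    finally have "(As - A) * ((a + 1) * y - b0 * y\<^sup>2) \<le> M * (a + 1)\<^sup>2 / (4 * b0)" by simp
    moreover have "(A - As) * (- (a + 1) / A + b0 / A\<^sup>2) = (As - A) * ((a + 1) * y - b0 * y\<^sup>2)"
    proof -
      have e1: "- (a + 1) / A = - ((a + 1) * y)" by (simp only: y_def minus_divide_left times_divide_eq_right mult_1_right)
      have e2: "b0 / A\<^sup>2 = b0 * y\<^sup>2" by (simp add: y_def power_divide)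
      show ?thesis unfolding e1 e2 by (simp add: algebra_simps)
    qed
    ultimately show ?thesis using nn by (simp add: K5_def)
  qed
qed

text \<open>Integrating the derivative of \<open>(A - As) * qq A\<close> over an interval around \<open>As\<close> gives boundary terms of the
  favourable sign, so no Laplace-type estimate is needed.\<close>
lemma nn_integral_qq_dev:
  "(\<integral>\<^sup>+A. ennreal (qq A) * ennreal (((A - As) / (V + A))\<^sup>2) \<partial>lborel) \<le> (\<integral>\<^sup>+A. ennreal (qq A) \<partial>lborel) * ennreal (2 * K5 / (real n - 1))"
proof -
  define m where "m = (real n - 1) / 2"
  have m: "m > 0" using n by (simp add: m_def)
  have As0: "As > 0" using As_ge \<delta> by simp
  define c where "c = (sqrt (2 * pi * V)) ^ n * sqrt (2 * pi / real n)"
  have c: "c \<ge> 0" using V by (simp add: c_def)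
  \<comment> \<open>\<open>l\<close> is the logarithm of \<open>qq\<close> up to the constant factor
    \<open>c\<close>. In its derivative the two likelihood terms merge, as 1 / (V + A) - D / (V +
    A)^2 = (A - As) / (V + A)^2: the likelihood always drives A towards \<open>As\<close>.\<close>
  define l where "l A = (-a - 1) * ln A - b0 / A - m * ln (V + A) - m * D / (V + A)" for A
  define l' where "l' A = - (a + 1) / A + b0 / A\<^sup>2 - m * (A - As) / (V + A)\<^sup>2" for A
  have qq: "qq A = c * exp (l A)" if A: "A > 0" for A
  proof -
    have "real n - 1 \<noteq> 0" using n by simp
    then have "(real n - 1) * D = \<Delta>" by (simp add: D_def)
    then have "\<Delta> / 2 = m * D" by (simp add: m_def)
    moreover have "- \<Delta> / (2 * (V + A)) = - (\<Delta> / 2 / (V + A))" by simp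
    ultimately have e: "- \<Delta> / (2 * (V + A)) = - (m * D / (V + A))" by simp
    have "qq A = c * ((A powr (-a - 1) * exp (-b0 / A)) * ((V + A) powr (-m) * exp (- (m * D / (V + A)))))"
      unfolding qq_def e m_def[symmetric] c_def using A by simp
    also have "(A powr (-a - 1) * exp (-b0 / A)) * ((V + A) powr (-m) * exp (- (m * D / (V + A)))) = exp (l A)"
      using A V by (simp add: powr_def l_def exp_add[symmetric] exp_diff)
    finally show ?thesis .
  qed
  have dl: "(l has_real_derivative l' A) (at A within X)" if A: "A > 0" for A X
  proof -
    have "(l has_real_derivative ((-a - 1) * (1 / A) - (- b0 / A\<^sup>2) - m * (1 / (V + A)) - (- (m * D) / (V + A)\<^sup>2))) (at A within X)"
      unfolding l_def[abs_def] using A V by (auto intro!: derivative_eq_intros simp: power2_eq_square)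
    moreover have "((-a - 1) * (1 / A) - (- b0 / A\<^sup>2) - m * (1 / (V + A)) - (- (m * D) / (V + A)\<^sup>2)) = l' A"
    proof -
      have "m * (1 / (V + A)) + (- (m * D) / (V + A)\<^sup>2) = m * (A - As) / (V + A)\<^sup>2"
      proof -
        define w where "w = V + A"
        have w: "w \<noteq> 0" "A - As = w - D" using A V by (auto simp: w_def As_def)
        have "m * (1 / w) + (- (m * D) / w\<^sup>2) = (m * w - m * D) / w\<^sup>2" using w(1) by (simp add: power2_eq_square diff_divide_distrib)
        then show ?thesis unfolding w_def[symmetric] w(2) by (simp add: right_diff_distrib)
      qed
      then show ?thesis by (simp add: l'_def diff_divide_distrib)
    qed
    ultimately show ?thesis by simp
  qed
  define g where "g A = (A - As) * (c * exp (l A))" for A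
  define g' where "g' A = c * exp (l A) * (1 + (A - As) * l' A)" for A
  have dg: "(g has_real_derivative g' A) (at A within X)" if A: "A > 0" for A X
    unfolding g_def[abs_def] g'_def using dl[OF A, of X] by (auto intro!: derivative_eq_intros simp: algebra_simps)
  \<comment> \<open>The likelihood part of \<open>l'\<close> contributes exactly
    \<open>- m * ph\<close> to \<open>g'\<close>. So the second moment comes with the large factor
    m, and what is left is the prior part.\<close>
  define ph where "ph A = c * exp (l A) * ((A - As) / (V + A))\<^sup>2" for A
  have key: "m * ph A \<le> K5 * (c * exp (l A)) - g' A" if A: "A > 0" for A
  proof -
    have "m * ph A + g' A = c * exp (l A) * (1 + (A - As) * (- (a + 1) / A + b0 / A\<^sup>2))"
      by (simp add: ph_def g'_def l'_def power_divide power2_eq_square algebra_simps)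
    also have "\<dots> \<le> c * exp (l A) * K5" using c by (intro mult_left_mono prior_drift_le A) auto
    finally show ?thesis by (simp add: mult.commute)
  qed
  \<comment> \<open>Compact subintervals of the positive half line that contain \<open>As\<close>
    and exhaust it. The fundamental theorem applies on each, with no decay of \<open>qq\<close> at 0
    or infinity to be checked; the full integral follows by monotone convergence.\<close>
  define I where "I k = {As / real (k + 2) .. As * real (k + 2)}" for k :: nat
  have Ipos: "A > 0" if "A \<in> I k" for A k
  proof -
    have "0 < As / real (k + 2)" using As0 by simp
    then show ?thesis using that by (simp add: I_def)
  qed
  have cont_l: "continuous_on (I k) l" for k
    using dl Ipos by (intro DERIV_continuous_on) blast
  have nnI: "(\<integral>\<^sup>+A. indicator (I k) A * ennreal (f A) \<partial>lborel) = ennreal (integral (I k) f)"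
    if "continuous_on (I k) f" "\<And>A. A \<in> I k \<Longrightarrow> 0 \<le> f A" for f k
  proof -
    have "f integrable_on I k" using that(1) unfolding I_def by (rule integrable_continuous_interval)
    then have "(f has_integral (integral (I k) f)) (I k)" by (rule integrable_integral)
    from nn_integral_has_integral_lebesgue[OF that(2) this]
    have "(\<integral>\<^sup>+A. ennreal (indicator (I k) A * f A) \<partial>lborel) = ennreal (integral (I k) f)" .
    moreover have "ennreal (indicator (I k) A * f A) = indicator (I k) A * ennreal (f A)" for A by (simp add: indicator_def)
    ultimately show ?thesis by simp
  qed
  have bound: "(\<integral>\<^sup>+A. indicator (I k) A * (ennreal (qq A) * ennreal (((A - As) / (V + A))\<^sup>2)) \<partial>lborel) \<le> (\<integral>\<^sup>+A. ennreal (qq A) \<partial>lborel) * ennreal (2 * K5 / (real n - 1))" for k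
  proof -
    have cph: "continuous_on (I k) ph"
      unfolding ph_def[abs_def] using cont_l Ipos V by (intro continuous_intros) (auto simp: add_pos_pos less_imp_neq[symmetric])
    have cq: "continuous_on (I k) (\<lambda>A. c * exp (l A))" using cont_l by (intro continuous_intros) auto
    have le: "As / real (k + 2) \<le> As" "As \<le> As * real (k + 2)"
      using As0 by (auto simp: divide_le_eq)
    have FTC: "(g' has_integral (g (As * real (k + 2)) - g (As / real (k + 2)))) (I k)"
      unfolding I_def
    proof (rule fundamental_theorem_of_calculus)
      show "As / real (k + 2) \<le> As * real (k + 2)" using le by linarith
      fix x assume "x \<in> {As / real (k + 2)..As * real (k + 2)}"
      then have "x > 0" using Ipos[of x k] by (simp add: I_def)
      then show "(g has_vector_derivative g' x) (at x within {As / real (k + 2)..As * real (k + 2)})"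
        using dg by (simp add: has_real_derivative_iff_has_vector_derivative)
    qed
    have gs: "0 \<le> g (As * real (k + 2)) - g (As / real (k + 2))"
    proof -
      have "0 \<le> g (As * real (k + 2))" unfolding g_def using le c by (intro mult_nonneg_nonneg) auto
      moreover have "g (As / real (k + 2)) \<le> 0" unfolding g_def using le c by (intro mult_nonpos_nonneg) auto
      ultimately show ?thesis by linarith
    qed
    have iq: "((\<lambda>A. c * exp (l A)) has_integral integral (I k) (\<lambda>A. c * exp (l A))) (I k)"
      using cq unfolding I_def by (intro integrable_integral integrable_continuous_interval)
    have iph: "(ph has_integral integral (I k) ph) (I k)"
      using cph unfolding I_def by (intro integrable_integral integrable_continuous_interval)
    have "m * integral (I k) ph \<le> K5 * integral (I k) (\<lambda>A. c * exp (l A)) - (g (As * real (k + 2)) - g (As / real (k + 2)))"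
      by (rule has_integral_le[OF has_integral_mult_right[OF iph] has_integral_diff[OF has_integral_mult_right[OF iq] FTC]]) (use key Ipos in auto)
    then have "m * integral (I k) ph \<le> K5 * integral (I k) (\<lambda>A. c * exp (l A))" using gs by linarith
    then have ip: "integral (I k) ph \<le> integral (I k) (\<lambda>A. c * exp (l A)) * (K5 / m)"
      using m by (simp add: field_simps)
    have "(\<integral>\<^sup>+A. indicator (I k) A * (ennreal (qq A) * ennreal (((A - As) / (V + A))\<^sup>2)) \<partial>lborel) = (\<integral>\<^sup>+A. indicator (I k) A * ennreal (ph A) \<partial>lborel)"
      using c by (intro nn_integral_cong) (auto simp: indicator_def qq Ipos ph_def ennreal_mult)
    also have "\<dots> = ennreal (integral (I k) ph)" using c by (intro nnI cph) (auto simp: ph_def)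
    also have "\<dots> \<le> ennreal (integral (I k) (\<lambda>A. c * exp (l A)) * (K5 / m))" by (rule ennreal_leI[OF ip])
    also have "\<dots> = ennreal (integral (I k) (\<lambda>A. c * exp (l A))) * ennreal (K5 / m)"
      using m K5_pos by (intro ennreal_mult'') auto
    also have "ennreal (integral (I k) (\<lambda>A. c * exp (l A))) = (\<integral>\<^sup>+A. indicator (I k) A * ennreal (c * exp (l A)) \<partial>lborel)"
      using c by (intro nnI[symmetric] cq) auto
    also have "\<dots> \<le> (\<integral>\<^sup>+A. ennreal (qq A) \<partial>lborel)"
      by (intro nn_integral_mono) (auto simp: indicator_def qq Ipos)
    also have "K5 / m = 2 * K5 / (real n - 1)" by (simp add: m_def)
    finally show ?thesis by (simp add: mult_right_mono)
  qed
  have inc: "I k \<subseteq> I (Suc k)" for k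
  proof -
    have "As / real (Suc k + 2) \<le> As / real (k + 2)" using As0 by (intro divide_left_mono) auto
    moreover have "As * real (k + 2) \<le> As * real (Suc k + 2)" using As0 by (intro mult_left_mono) auto
    ultimately show ?thesis by (auto simp: I_def)
  qed
  let ?F = "\<lambda>A. ennreal (qq A) * ennreal (((A - As) / (V + A))\<^sup>2)"
  have sup: "(SUP k. indicator (I k) A * ?F A) = ?F A" for A
  proof (cases "A > 0")
    case True
    obtain k1 where k1: "As / A \<le> real k1" using real_arch_simple by blast
    obtain k2 where k2: "A / As \<le> real k2" using real_arch_simple by blast
    define k where "k = k1 + k2"
    have "A \<in> I k"
    proof -
      have "As \<le> real k1 * A" using k1 True by (simp add: divide_le_eq)
      also have "\<dots> \<le> real (k + 2) * A" using True by (intro mult_right_mono) (auto simp: k_def)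
      finally have 1: "As / real (k + 2) \<le> A" by (simp add: divide_le_eq mult.commute)
      have "A \<le> real k2 * As" using k2 As0 by (simp add: divide_le_eq)
      also have "\<dots> \<le> real (k + 2) * As" using As0 by (intro mult_right_mono) (auto simp: k_def)
      finally show ?thesis using 1 by (simp add: I_def mult.commute)
    qed
    then show ?thesis
      by (intro antisym SUP_least SUP_upper2[of k]) (auto simp: indicator_def)
  qed (simp add: qq_def)
  have Im: "I k \<in> sets borel" for k by (simp add: I_def)
  have "(\<integral>\<^sup>+A. ?F A \<partial>lborel) = (\<integral>\<^sup>+A. (SUP k. indicator (I k) A * ?F A) \<partial>lborel)" unfolding sup ..
  also have "\<dots> = (SUP k. \<integral>\<^sup>+A. indicator (I k) A * ?F A \<partial>lborel)"
  proof (rule nn_integral_monotone_convergence_SUP)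
    show "incseq (\<lambda>k A. indicator (I k) A * ?F A)"
      using inc by (intro incseq_SucI le_funI) (auto simp: indicator_def)
    show "(\<lambda>A. indicator (I k) A * ?F A) \<in> borel_measurable lborel" for k using Im[of k] by measurable
  qed
  also have "\<dots> \<le> (\<integral>\<^sup>+A. ennreal (qq A) \<partial>lborel) * ennreal (2 * K5 / (real n - 1))"
    by (intro SUP_least bound)
  finally show ?thesis .
qed

end

subsection \<open>Total variation bound\<close>

context gibbs_regime_large
begin

text \<open>\<open>K6\<close> collects the terms that carry the factor Kd rho^j, and
  \<open>K7\<close> below those that decay like 1/n.\<close>

definition K6 where "K6 = (M + eps) / 2 + wt / 2 + 3 * (M + eps) * K5 / 2 + 2 * wt * V"
definition K7 where "K7 = 3 * ((M + eps) / eps)\<^sup>2 * K5 + 4 * V"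

lemma K67_pos: "K6 > 0" "K7 > 0"
  unfolding K6_def K7_def using M_pos eps_pos wt_pos K5_pos V by (auto intro!: add_pos_pos add_nonneg_pos)

text \<open>\<open>T_pow_lipschitz\<close> between \<open>x0\<close> and a posterior point y,
  averaged over y. The start sits exactly at the centre (As, Yb), so the distances are posterior
  deviations of order 1 / sqrt n and cancel the factor sqrt n. For y outside \<open>G\<close> the
  same second moments act as Chebyshev's inequality.\<close>

lemma T_pow_le_posterior:
  assumes h[measurable]: "h \<in> borel_measurable S" and h1: "\<And>y. y \<in> space S \<Longrightarrow> h y \<le> 1"
    and x0: "x0 \<in> space S" "fst x0 = As" "vm x0 = Yb"
  shows "(T ^^ Suc j) h x0 * U (\<lambda>_. 1) \<le> U h + U (\<lambda>_. 1) *
     ennreal (6 / sqrt (shape - 2) + Kd * rho ^ j * K6 + real j * (CB / real n) + K7 / real n)"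
proof -
  define g where "g = (T ^^ Suc j) h"
  define c where "c = Kd * rho ^ j"
  define e where "e = real j * (CB / real n)"
  define k1 where "k1 = ((M + eps) / eps)\<^sup>2"
  \<comment> \<open>The scaled deviation whose second moment \<open>nn_integral_qq_dev\<close>
    controls. On \<open>G\<close> it is comparable with \<open>A - As\<close>, since there V + A is
    at most M + eps.\<close>
  define r where "r A = (A - As) / (V + A)" for A
  define ca where "ca = c * ((M + eps) / 2 + wt / 2) + e"
  define cb where "cb = c * (M + eps) * real n / 2 + k1"
  define cc where "cc = c * wt * real n / 2 + 1"
  have n0: "real n > 0" and n1: "real n \<ge> 10" using n10 by auto
  have c: "0 \<le> c" and e: "0 \<le> e" and k1: "0 \<le> k1"
    using Kd_nonneg rho_bounds CB_pos by (auto simp: c_def e_def k1_def)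
  have cabc: "0 \<le> ca" "0 \<le> cb" "0 \<le> cc" using c e k1 M_pos eps_pos wt_pos by (auto simp: ca_def cb_def cc_def)
  have gm[measurable]: "g \<in> borel_measurable S" unfolding g_def by (rule T_pow_measurable[OF h])
  have [measurable]: "vm \<in> borel_measurable S" unfolding vm_def[abs_def] by measurable
  have [measurable]: "fst \<in> borel_measurable S" by measurable
  have rm[measurable]: "r \<in> borel_measurable borel" unfolding r_def[abs_def] by measurable
  have x0G: "x0 \<in> G" using x0 eps_pos by (simp add: G_def)
  have pt: "g x0 \<le> g y + (ennreal ca + ennreal cb * ennreal ((r (fst y))\<^sup>2) + ennreal cc * ennreal ((vm y - Yb)\<^sup>2))"
    if y: "y \<in> space S" "fst y > 0" for y
  proof -
    define A u where "A = fst y" and "u = vm y - Yb"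
    have A: "A > 0" using y by (simp add: A_def)
    have sum: "ennreal ca + ennreal cb * ennreal ((r A)\<^sup>2) + ennreal cc * ennreal (u\<^sup>2) = ennreal (ca + cb * (r A)\<^sup>2 + cc * u\<^sup>2)"
      using cabc by (simp add: ennreal_mult)
    have "g x0 \<le> g y + ennreal (ca + cb * (r A)\<^sup>2 + cc * u\<^sup>2)"
    proof (cases "y \<in> G")
      case True
      have "g x0 \<le> g y + ennreal (Kd * sqrt (real n) * rho ^ j * dd x0 y + real j * (CB / real n))"
        unfolding g_def by (rule T_pow_lipschitz[OF h h1 x0G True])
      also have "\<dots> \<le> g y + ennreal (ca + cb * (r A)\<^sup>2 + cc * u\<^sup>2)"
      proof (intro add_left_mono ennreal_leI)
        \<comment> \<open>This trades the first moment, magnified by sqrt n, for a constant plus n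
          times the second moment, which is bounded.\<close>
        have am: "sqrt (real n) * \<bar>t\<bar> \<le> 1 / 2 + real n * t\<^sup>2 / 2" for t
        proof -
          have "0 \<le> (sqrt (real n) * \<bar>t\<bar> - 1)\<^sup>2" by simp
          also have "\<dots> = real n * t\<^sup>2 + 1 - 2 * (sqrt (real n) * \<bar>t\<bar>)" by (simp add: power2_diff power_mult_distrib)
          finally show ?thesis by simp
        qed
        have nA: "\<bar>A - As\<bar> \<le> eps" using True by (simp add: G_def A_def)
        have VA: "V + A > 0" "V + A \<le> M + eps" using A V nA D_bounds by (auto simp: As_def)
        have "\<bar>A - As\<bar> = \<bar>r A\<bar> * (V + A)" using VA by (simp add: r_def abs_divide)
        also have "\<dots> \<le> \<bar>r A\<bar> * (M + eps)" using VA by (intro mult_left_mono) auto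
        finally have "sqrt (real n) * \<bar>A - As\<bar> \<le> (sqrt (real n) * \<bar>r A\<bar>) * (M + eps)"
          by (simp add: mult.assoc mult_left_mono)
        also have "\<dots> \<le> (1 / 2 + real n * (r A)\<^sup>2 / 2) * (M + eps)" using M_pos eps_pos by (intro mult_right_mono am) auto
        finally have 1: "sqrt (real n) * \<bar>A - As\<bar> \<le> (1 / 2 + real n * (r A)\<^sup>2 / 2) * (M + eps)" .
        have 2: "wt * (sqrt (real n) * \<bar>u\<bar>) \<le> wt * (1 / 2 + real n * u\<^sup>2 / 2)" using wt_pos am[of u] by (intro mult_left_mono) auto
        have dd: "dd x0 y = \<bar>A - As\<bar> + wt * \<bar>u\<bar>" using x0 by (simp add: dd_def A_def u_def abs_minus_commute)
        have "Kd * sqrt (real n) * rho ^ j * dd x0 y + real j * (CB / real n) = c * (sqrt (real n) * \<bar>A - As\<bar> + wt * (sqrt (real n) * \<bar>u\<bar>)) + e"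
          unfolding dd c_def e_def by (simp add: distrib_left mult_ac)
        also have "\<dots> \<le> c * ((1 / 2 + real n * (r A)\<^sup>2 / 2) * (M + eps) + wt * (1 / 2 + real n * u\<^sup>2 / 2)) + e"
          using c by (intro add_right_mono mult_left_mono add_mono 1 2) auto
        also have "\<dots> = ca + (c * (M + eps) * real n / 2) * (r A)\<^sup>2 + (c * wt * real n / 2) * u\<^sup>2"
          by (simp add: ca_def algebra_simps add_divide_distrib)
        also have "\<dots> \<le> ca + cb * (r A)\<^sup>2 + cc * u\<^sup>2"
          using k1 by (intro add_mono mult_right_mono) (auto simp: cb_def cc_def)
        finally show "Kd * sqrt (real n) * rho ^ j * dd x0 y + real j * (CB / real n) \<le> ca + cb * (r A)\<^sup>2 + cc * u\<^sup>2" .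
      qed
      finally show ?thesis .
    next
      case False
      \<comment> \<open>Outside \<open>G\<close> one coordinate is far off. If it is A, then, as t /
        (M + t) increases in t = |A - As|, the scaled deviation is at least eps / (M + eps); this is
        where \<open>k1\<close> comes from.\<close>
      have one: "1 \<le> k1 * (r A)\<^sup>2 + 1 * u\<^sup>2"
      proof (cases "\<bar>u\<bar> \<le> 1")
        case False
        then have "1 \<le> u\<^sup>2" using abs_square_le_1[of u] by simp
        then show ?thesis using k1 by (simp add: add_increasing)
      next
        case True
        then have nA: "\<bar>A - As\<bar> > eps" using False y by (auto simp: G_def A_def u_def)
        let ?t = "\<bar>A - As\<bar>"
        have VA: "V + A > 0" "V + A \<le> M + ?t" using A V D_bounds by (auto simp: As_def)
        have "eps * (V + A) \<le> eps * (M + ?t)" using VA eps_pos by (intro mult_left_mono) auto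
        also have "\<dots> \<le> (M + eps) * ?t" using nA M_pos by (simp add: algebra_simps)
        finally have "1 \<le> (M + eps) / eps * (?t / (V + A))" using VA eps_pos by (simp add: le_divide_eq)
        then have "1 \<le> ((M + eps) / eps * (?t / (V + A)))\<^sup>2" by (rule one_le_power)
        also have "\<dots> = k1 * (r A)\<^sup>2" unfolding power_mult_distrib k1_def r_def by (simp add: power_divide)
        finally show ?thesis by (simp add: add_increasing2)
      qed
      have "g x0 \<le> ennreal 1" unfolding g_def using T_pow_le_one[OF h h1 x0(1), of "Suc j"] by (simp del: funpow.simps)
      also have "\<dots> \<le> ennreal (ca + cb * (r A)\<^sup>2 + cc * u\<^sup>2)"
      proof (rule ennreal_leI)
        have "k1 \<le> cb" "1 \<le> cc" using c M_pos eps_pos wt_pos by (auto simp: cb_def cc_def)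
        then have "k1 * (r A)\<^sup>2 \<le> cb * (r A)\<^sup>2" "1 * u\<^sup>2 \<le> cc * u\<^sup>2" by (auto simp only: intro!: mult_right_mono zero_le_power2)
        then show "1 \<le> ca + cb * (r A)\<^sup>2 + cc * u\<^sup>2" using one cabc by linarith
      qed
      finally show ?thesis by (simp add: add_increasing)
    qed
    then show ?thesis unfolding sum[symmetric] by (simp add: A_def u_def)
  qed
  have "g x0 * U (\<lambda>_. 1) = (\<integral>\<^sup>+y. ennreal (pd y) * g x0 \<partial>S)" unfolding U_def by (subst nn_integral_multc) (simp_all add: mult.commute)
  also have "\<dots> \<le> (\<integral>\<^sup>+y. ennreal (pd y) * g y + (ennreal ca * (ennreal (pd y) * 1) + ennreal cb * (ennreal (pd y) * ennreal ((r (fst y))\<^sup>2)) + ennreal cc * (ennreal (pd y) * ennreal ((vm y - Yb)\<^sup>2))) \<partial>S)"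
  proof (rule nn_integral_mono)
    fix y assume y: "y \<in> space S"
    show "ennreal (pd y) * g x0 \<le> ennreal (pd y) * g y + (ennreal ca * (ennreal (pd y) * 1) + ennreal cb * (ennreal (pd y) * ennreal ((r (fst y))\<^sup>2)) + ennreal cc * (ennreal (pd y) * ennreal ((vm y - Yb)\<^sup>2)))"
    proof (cases "fst y > 0")
      case True
      from mult_left_mono[OF pt[OF y True], of "ennreal (pd y)"] show ?thesis by (simp add: distrib_left mult_ac)
    qed (simp add: post_dens_def Let_def)
  qed
  also have "\<dots> = U g + (ennreal ca * U (\<lambda>_. 1) + ennreal cb * U (\<lambda>y. ennreal ((r (fst y))\<^sup>2)) + ennreal cc * U (\<lambda>y. ennreal ((vm y - Yb)\<^sup>2)))"
    unfolding U_def by (simp add: nn_integral_add nn_integral_cmult)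
  also have "\<dots> \<le> (U h + U (\<lambda>_. 1) * ennreal (6 / sqrt (shape - 2))) + (ennreal ca * U (\<lambda>_. 1) + ennreal cb * (U (\<lambda>_. 1) * ennreal (2 * K5 / (real n - 1))) + ennreal cc * (U (\<lambda>_. 1) * ennreal (4 * V / real n)))"
  proof (intro add_mono mult_left_mono order_refl)
    have "U g = U (T h)" unfolding g_def by (rule U_T_pow[OF h])
    then show "U g \<le> U h + U (\<lambda>_. 1) * ennreal (6 / sqrt (shape - 2))" using U_T_le[OF shape_gt h h1] by simp
    have "U (\<lambda>y. ennreal ((r (fst y))\<^sup>2)) = (\<integral>\<^sup>+A. ennreal (qq A) * ennreal ((r A)\<^sup>2) \<partial>lborel)"
      by (rule U_fst) measurable
    then show "U (\<lambda>y. ennreal ((r (fst y))\<^sup>2)) \<le> U (\<lambda>_. 1) * ennreal (2 * K5 / (real n - 1))"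
      using nn_integral_qq_dev by (simp add: r_def U_one)
    show "U (\<lambda>y. ennreal ((vm y - Yb)\<^sup>2)) \<le> U (\<lambda>_. 1) * ennreal (4 * V / real n)"
      using U_vmean_sq by (simp add: vm_def)
  qed auto
  also have "\<dots> = U h + U (\<lambda>_. 1) * (ennreal (6 / sqrt (shape - 2)) + (ennreal ca + ennreal cb * ennreal (2 * K5 / (real n - 1)) + ennreal cc * ennreal (4 * V / real n)))"
    by (simp add: distrib_left mult_ac add_ac)
  also have "ennreal (6 / sqrt (shape - 2)) + (ennreal ca + ennreal cb * ennreal (2 * K5 / (real n - 1)) + ennreal cc * ennreal (4 * V / real n))
    = ennreal (6 / sqrt (shape - 2) + (ca + cb * (2 * K5 / (real n - 1)) + cc * (4 * V / real n)))"
    using shape_gt cabc K5_pos n1 V by (simp add: ennreal_mult[symmetric] ennreal_plus[symmetric] del: ennreal_plus)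
  also have "\<dots> \<le> ennreal (6 / sqrt (shape - 2) + Kd * rho ^ j * K6 + real j * (CB / real n) + K7 / real n)"
  proof (rule ennreal_leI)
    have "2 * K5 / (real n - 1) \<le> 3 * K5 / real n"
    proof -
      have "2 / (real n - 1) \<le> 3 / real n" using n1 by (simp add: field_simps)
      from mult_right_mono[OF this, of K5] show ?thesis using K5_pos by simp
    qed
    then have "cb * (2 * K5 / (real n - 1)) \<le> cb * (3 * K5 / real n)" using cabc by (intro mult_left_mono)
    also have "\<dots> = c * (3 * (M + eps) * K5 / 2) + 3 * k1 * K5 / real n" using n0 by (simp add: cb_def field_simps)
    finally have 1: "cb * (2 * K5 / (real n - 1)) \<le> c * (3 * (M + eps) * K5 / 2) + 3 * k1 * K5 / real n" .
    have 2: "cc * (4 * V / real n) = c * (2 * wt * V) + 4 * V / real n" using n0 by (simp add: cc_def field_simps)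
    have "ca + cb * (2 * K5 / (real n - 1)) + cc * (4 * V / real n)
      \<le> (c * ((M + eps) / 2 + wt / 2) + e) + (c * (3 * (M + eps) * K5 / 2) + 3 * k1 * K5 / real n) + (c * (2 * wt * V) + 4 * V / real n)"
      unfolding 2 using 1 by (simp add: ca_def)
    also have "\<dots> = c * K6 + e + K7 / real n"
      unfolding K6_def K7_def k1_def[symmetric] by (simp add: distrib_left add_divide_distrib)
    finally show "6 / sqrt (shape - 2) + (ca + cb * (2 * K5 / (real n - 1)) + cc * (4 * V / real n))
       \<le> 6 / sqrt (shape - 2) + Kd * rho ^ j * K6 + real j * (CB / real n) + K7 / real n"
      by (simp add: c_def e_def)
  qed
  finally show ?thesis by (simp add: g_def add_left_mono mult_left_mono)
qed

text \<open>The comparison with the posterior is one-sided. Both measures being probabilities,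
  applying it to an event and to its complement gives both directions.\<close>

lemma tv_dist_le:
  assumes init: "init_state V Y n x0"
  shows "tv_dist (chain_law V a b0 Y n x0 (Suc j)) (posterior V a b0 Y n)
    \<le> 6 / sqrt (shape - 2) + Kd * rho ^ j * K6 + real j * (CB / real n) + K7 / real n" (is "_ \<le> ?R")
proof -
  let ?P = "chain_law V a b0 Y n x0 (Suc j)" and ?Q = "posterior V a b0 Y n"
  define Z where "Z = U (\<lambda>_. 1)"
  have Z: "Z \<noteq> 0" "Z < \<infinity>" using U_one_pos U_one_finite by (auto simp: Z_def)
  have x0: "x0 \<in> space S" "fst x0 = As" "vm x0 = Yb"
  proof -
    have "\<Delta> / (real n - 1) > V" using D_bounds \<delta> by (simp add: D_def)
    then show "fst x0 = As" using init by (simp add: init_state_def As_def D_def)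
    show "vm x0 = Yb" using init by (simp add: init_state_def vm_def)
    show "x0 \<in> space S" using init by (cases x0) (auto simp: init_state_def space_S_iff space_PiM PiE_iff extensional_def)
  qed
  have A0: "fst x0 > 0" using x0 As_ge \<delta> by simp
  have R0: "0 \<le> ?R" using shape_gt Kd_nonneg rho_bounds K67_pos CB_pos by (intro add_nonneg_nonneg) auto
  have sP: "sets ?P = sets S" by (rule sets_chain_law)
  have spP: "space ?P = space S" by (rule sets_eq_imp_space_eq[OF sP])
  interpret P: prob_space ?P by (rule prob_spaceI) (simp only: spP emeasure_chain_law_space[OF x0(1) A0])
  have Zd: "(\<integral>\<^sup>+x. ennreal (pd x) \<partial>S) = Z" by (simp add: Z_def U_def)
  have Qd: "?Q = density S (\<lambda>x. ennreal (pd x) / Z)" unfolding posterior_def Let_def Zd ..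
  have sQ: "sets ?Q = sets S" unfolding Qd by simp
  have eQ: "emeasure ?Q B = U (indicator B) / Z" if [measurable]: "B \<in> sets S" for B
  proof -
    have "emeasure ?Q B = (\<integral>\<^sup>+x. ennreal (pd x) / Z * indicator B x \<partial>S)"
      unfolding Qd by (rule emeasure_density) measurable
    also have "\<dots> = (\<integral>\<^sup>+x. ennreal (pd x) * indicator B x * inverse Z \<partial>S)"
      by (simp add: divide_ennreal_def mult_ac)
    also have "\<dots> = U (indicator B) / Z" unfolding U_def by (subst nn_integral_multc) (auto simp: divide_ennreal_def)
    finally show ?thesis .
  qed
  interpret Q: prob_space ?Q
  proof (rule prob_spaceI)
    have "space ?Q = space S" by (rule sets_eq_imp_space_eq[OF sQ])
    moreover have "U (indicator (space S)) = Z" unfolding Z_def U_def by (rule nn_integral_cong) simp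
    ultimately show "emeasure ?Q (space ?Q) = 1" using Z by (simp add: eQ ennreal_divide_self)
  qed
  have le: "measure ?P B \<le> measure ?Q B + ?R" if B[measurable]: "B \<in> sets S" for B
  proof -
    have [measurable]: "indicator B \<in> borel_measurable S" by (rule borel_measurable_indicator[OF B])
    have eP: "emeasure ?P B = (T ^^ Suc j) (indicator B) x0"
      using nn_integral_chain_law[OF x0(1), of "indicator B" "Suc j"] B sP by simp
    have "emeasure ?P B * Z \<le> U (indicator B) + Z * ennreal ?R"
      unfolding eP Z_def by (rule T_pow_le_posterior[OF _ _ x0]) (auto simp: indicator_def)
    then have "emeasure ?P B * Z / Z \<le> (U (indicator B) + Z * ennreal ?R) / Z" by (rule divide_right_mono_ennreal)
    also have "\<dots> = emeasure ?Q B + ennreal ?R * Z / Z" by (simp add: eQ add_divide_distrib_ennreal mult.commute)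
    finally have "emeasure ?P B \<le> emeasure ?Q B + ennreal ?R" using Z by (simp add: ennreal_mult_divide_eq)
    then have "ennreal (measure ?P B) \<le> ennreal (measure ?Q B + ?R)"
      by (simp only: P.emeasure_eq_measure Q.emeasure_eq_measure ennreal_plus[OF measure_nonneg R0])
    then show ?thesis using R0 by (subst (asm) ennreal_le_iff) (auto intro: add_nonneg_nonneg)
  qed
  show ?thesis unfolding tv_dist_def
  proof (rule cSUP_least)
    show "sets ?P \<noteq> {}" using sets.top by blast
    fix B assume "B \<in> sets ?P"
    then have B: "B \<in> sets S" by (simp only: sP)
    have C: "space S - B \<in> sets S" using B by auto
    have "measure ?P (space S - B) = 1 - measure ?P B" using P.prob_compl[of B] B sP spP by simp
    moreover have "measure ?Q (space S - B) = 1 - measure ?Q B" using Q.prob_compl[of B] B sQ sets_eq_imp_space_eq[OF sQ] by simp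
    ultimately show "\<bar>measure ?P B - measure ?Q B\<bar> \<le> ?R" using le[OF B] le[OF C] by linarith
  qed
qed

lemma tv_dist_rate:
  assumes init: "init_state V Y n x0" and k: "k \<ge> 1"
  shows "tv_dist (chain_law V a b0 Y n x0 k) (posterior V a b0 Y n)
    \<le> (Kd * K6 / rho + 1) * rho ^ k + (CB + K7) * (real k * (1 + real k) / real n) + 12 * (real k / sqrt (real n))"
proof -
  obtain j where j: "k = Suc j" using k by (cases k) auto
  have n0: "real n > 0" "real n \<ge> 10" using n10 by auto
  have 1: "6 / sqrt (shape - 2) \<le> 12 * (real k / sqrt (real n))"
  proof -
    \<comment> \<open>This is a + (n - 1) / 2 - 2 >= n / 4; with a > 0 it holds as soon as n is at
      least 10.\<close>
    have "real n / 4 \<le> shape - 2" using a n0 by (simp add: shape_def field_simps)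
    then have "sqrt (real n / 4) \<le> sqrt (shape - 2)" by (rule real_sqrt_le_mono)
    then have s: "sqrt (real n) / 2 \<le> sqrt (shape - 2)" by (simp add: real_sqrt_divide)
    have "6 / sqrt (shape - 2) \<le> 6 / (sqrt (real n) / 2)" using s n0 shape_gt by (intro divide_left_mono mult_pos_pos) auto
    also have "\<dots> = 12 * (1 / sqrt (real n))" by simp
    also have "\<dots> \<le> 12 * (real k / sqrt (real n))" using k n0 by (intro mult_left_mono divide_right_mono) auto
    finally show ?thesis .
  qed
  \<comment> \<open>\<open>Kd\<close> is only known to be nonnegative, so the summand 1 secures a
    positive constant; division by \<open>rho\<close> turns the exponent k - 1 into k.\<close>
  have 2: "Kd * rho ^ j * K6 \<le> (Kd * K6 / rho + 1) * rho ^ k"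
    using rho_bounds j by (simp add: distrib_right)
  have 3: "real j * (CB / real n) + K7 / real n \<le> (CB + K7) * (real k * (1 + real k) / real n)"
  proof -
    have "real j * (CB / real n) + K7 / real n = (real j * CB + 1 * K7) / real n" by (simp add: add_divide_distrib)
    also have "\<dots> \<le> (real k * (1 + real k) * CB + real k * (1 + real k) * K7) / real n"
    proof (intro divide_right_mono add_mono mult_right_mono)
      have "1 \<le> real k" using k by simp
      then have "real k * 1 \<le> real k * (1 + real k)" by (intro mult_left_mono) auto
      then show "real j \<le> real k * (1 + real k)" "1 \<le> real k * (1 + real k)" using \<open>1 \<le> real k\<close> j by linarith+
    qed (use CB_pos K67_pos n0 in auto)
    also have "\<dots> = (CB + K7) * (real k * (1 + real k) / real n)" by (simp add: algebra_simps add_divide_distrib)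
    finally show ?thesis .
  qed
  show ?thesis using tv_dist_le[OF init, of j] 1 2 3 unfolding j by linarith
qed

end

section \<open>The choice of \<open>N\<close>\<close>

lemma eventually_large:
  fixes V a b0 M eta kap :: real
  assumes "eta > 0" "kap > 0" "a > 0" "M > 0" "V > 0"
  shows "\<forall>\<^sub>F n in sequentially. real n / (2 * a + real n - 3) * (1 - eta + (4 * sqrt V * sqrt (M / real n) + V * sqrt (2 / real n)) / V) \<le> 1 - eta / 2
     \<and> \<bar>real n / (2 * a + real n - 3) - 1\<bar> \<le> kap \<and> (2 * b0 + M) / real n \<le> kap"
proof -
  have tau: "(\<lambda>n. real n / (2 * a + real n - 3)) \<longlonglongrightarrow> 1" by real_asymp
  have inv: "(\<lambda>n. c / real n) \<longlonglongrightarrow> 0" for c :: real by real_asymp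
  have sq: "(\<lambda>n. sqrt (c / real n)) \<longlonglongrightarrow> 0" for c using tendsto_real_sqrt[OF inv[of c]] by simp
  have "(\<lambda>n. real n / (2 * a + real n - 3) * (1 - eta + (4 * sqrt V * sqrt (M / real n) + V * sqrt (2 / real n)) / V)) \<longlonglongrightarrow> 1 * (1 - eta + (4 * sqrt V * 0 + V * 0) / V)"
    using assms by (intro tendsto_intros tau sq) auto
  then have "\<forall>\<^sub>F n in sequentially. real n / (2 * a + real n - 3) * (1 - eta + (4 * sqrt V * sqrt (M / real n) + V * sqrt (2 / real n)) / V) < 1 - eta / 2"
    by (rule order_tendstoD) (use assms in simp)
  moreover have "\<forall>\<^sub>F n in sequentially. \<bar>real n / (2 * a + real n - 3) - 1\<bar> < kap"
    using tendstoD[OF tau \<open>kap > 0\<close>] by (simp add: dist_real_def)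
  moreover have "\<forall>\<^sub>F n in sequentially. (2 * b0 + M) / real n < kap"
    using order_tendstoD(2)[OF inv \<open>kap > 0\<close>] .
  ultimately show ?thesis by eventually_elim auto
qed

theorem mainTheorem5:
  fixes V a b0 :: real and Y :: "nat \<Rightarrow> nat \<Rightarrow> real"
  assumes "V > 0" and "a > 0" and "b0 > 0"
    and assumA: "\<exists>\<delta>>0. \<exists>M. \<exists>N0::nat.
          (\<forall>n\<ge>2. Delta Y n / (real n - 1) \<le> M) \<and>
          (\<forall>n\<ge>max 2 N0. Delta Y n / (real n - 1) \<ge> V + \<delta>)"
  shows "\<exists>(N::nat) C1 C2 C3 \<gamma>::real. C1 > 0 \<and> C2 > 0 \<and> C3 > 0 \<and> 0 < \<gamma> \<and> \<gamma> < 1 \<and>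
          (\<forall>n\<ge>N. \<forall>x0. init_state V Y n x0 \<longrightarrow>
             (\<forall>k\<ge>1. tv_dist (chain_law V a b0 Y n x0 k) (posterior V a b0 Y n)
                \<le> C1 * \<gamma> ^ k + C2 * (real k * (1 + real k) / real n) + C3 * (real k / sqrt (real n))))"
proof -
  obtain \<delta> M N0 where \<delta>: "\<delta> > 0" and ub: "\<And>n. n \<ge> 2 \<Longrightarrow> Delta Y n / (real n - 1) \<le> M"
    and lb: "\<And>n. n \<ge> max 2 N0 \<Longrightarrow> V + \<delta> \<le> Delta Y n / (real n - 1)"
    using assumA by blast
  have reg: "gibbs_regime V a b0 Y n \<delta> M" if "n \<ge> max 2 N0" for n
    using that assms(1-3) \<delta> ub[of n] lb[of n] by unfold_locales auto
  \<comment> \<open>\<open>eta\<close> and \<open>kap\<close> are needed before \<open>N\<close> can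
    be chosen. An instance at one admissible sample size provides them, and they do not depend on
    it.\<close>
  interpret R: gibbs_regime V a b0 Y "max 2 N0" \<delta> M by (rule reg) simp
  obtain N1 where N1: "\<And>n. n \<ge> N1 \<Longrightarrow> real n / (2 * a + real n - 3) * (1 - R.eta + (4 * sqrt V * sqrt (M / real n) + V * sqrt (2 / real n)) / V) \<le> 1 - R.eta / 2
     \<and> \<bar>real n / (2 * a + real n - 3) - 1\<bar> \<le> R.kap \<and> (2 * b0 + M) / real n \<le> R.kap"
    using eventually_large[OF R.eta_pos R.kap_pos assms(2) R.M_pos(1) assms(1), of b0] unfolding eventually_sequentially by blast
  define N where "N = max (max 2 N0) (max 10 N1)"
  have large: "gibbs_regime_large V a b0 Y n \<delta> M" if n: "n \<ge> N" for n
  proof -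
    interpret L: gibbs_regime V a b0 Y n \<delta> M by (rule reg) (use n in \<open>simp add: N_def\<close>)
    show ?thesis
      using n N1[of n] by unfold_locales (auto simp: N_def L.tau_def)
  qed
  \<comment> \<open>The constants below are built from \<open>V\<close>, \<open>a\<close>,
    \<open>b0\<close>, \<open>\<delta>\<close> and \<open>M\<close> only. Their instances at
    \<open>N\<close> and at any larger n are therefore the same terms, which is the uniformity in n
    that the theorem asks for.\<close>
  interpret L0: gibbs_regime_large V a b0 Y N \<delta> M by (rule large) simp
  show ?thesis
  proof (intro exI conjI allI impI)
    show "0 < L0.Kd * L0.K6 / L0.rho + 1" using L0.Kd_nonneg L0.K67_pos L0.rho_bounds by (intro add_nonneg_pos) auto
    show "0 < L0.CB + L0.K7" using L0.CB_pos L0.K67_pos by simp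
    show "(0::real) < 12" by simp
    show "0 < L0.rho" "L0.rho < 1" using L0.rho_bounds by auto
    fix n x0 and k :: nat assume n: "N \<le> n" and i: "init_state V Y n x0" and k: "1 \<le> k"
    interpret L: gibbs_regime_large V a b0 Y n \<delta> M by (rule large[OF n])
    show "tv_dist (chain_law V a b0 Y n x0 k) (posterior V a b0 Y n)
      \<le> (L0.Kd * L0.K6 / L0.rho + 1) * L0.rho ^ k + (L0.CB + L0.K7) * (real k * (1 + real k) / real n) + 12 * (real k / sqrt (real n))"
      by (rule L.tv_dist_rate[OF i k])
  qed
qed

end
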